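(* For any fixed connected pattern graph $Q$ with $O(1)$ vertices and any $\Delta\ge 1$, there is a data structure for the Range Subgraph Listing problem that uses $\tilde{O}(m+m^{\rho^*}/\Delta)$ space and answers a query with a delay of $\tilde{O}(\Delta)$, where $\rho^*$ is the fractional edge covering number of $Q$.
   Context: Range Subgraph Listing: $G=(V,E)$ is an undirected graph with $m=|E|$ edges, each vertex $v$ carrying a real-valued attribute $A_v$. For an interval $q=[x_1,x_2]$, $G_q$ is the subgraph of $G$ induced by $\{v\in V\mid x_1\le A_v\le x_2\}$. A query, given $q$, reports all occurrences (subgraphs isomorphic to $Q$) of $Q$ in $G_q$. A query has delay $\Delta$ if, after the previous output (with a dummy output assumed at the start), it reports a new occurrence or declares that there are no more occurrences within $\Delta$ time. The fractional edge covering number of $Q$ is the minimum of $\sum_{e} W(e)$ over all assignments of non-negative weights $W(e)$ to the edges $e$ of $Q$ such that for every vertex of $Q$ the incident edges have total weight at least $1$. $\tilde{O}(\cdot)$ hides polylogarithmic factors. *)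

theory Defs
  imports "HOL-Analysis.Analysis"
begin

section \<open>Graphs, occurrences, fractional edge covers\<close>

record 'a ugraph =
  verts :: "'a set"
  edges :: "'a set set"

definition simple_graph :: "'a ugraph \<Rightarrow> bool" where
  "simple_graph G \<longleftrightarrow>
     finite (verts G) \<and> (\<forall>e\<in>edges G. e \<subseteq> verts G \<and> card e = 2)"

definition connected_graph :: "'a ugraph \<Rightarrow> bool" where
  "connected_graph G \<longleftrightarrow>
     verts G \<noteq> {} \<and>
     (\<forall>u\<in>verts G. \<forall>v\<in>verts G. (u, v) \<in> {(a, b). {a, b} \<in> edges G}\<^sup>*)"

definition subgraph_of :: "'a ugraph \<Rightarrow> 'a ugraph \<Rightarrow> bool" where
  "subgraph_of H G \<longleftrightarrow> simple_graph H \<and> verts H \<subseteq> verts G \<and> edges H \<subseteq> edges G"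

definition induced_subgraph :: "'a ugraph \<Rightarrow> 'a set \<Rightarrow> 'a ugraph" where
  "induced_subgraph G S =
     \<lparr>verts = verts G \<inter> S, edges = {e \<in> edges G. e \<subseteq> S}\<rparr>"

definition isomorphic_graphs :: "'a ugraph \<Rightarrow> 'b ugraph \<Rightarrow> bool" where
  "isomorphic_graphs G H \<longleftrightarrow>
     (\<exists>f. bij_betw f (verts G) (verts H) \<and> edges H = (\<lambda>e. f ` e) ` edges G)"

text \<open>An occurrence is a subgraph, not an embedding: embeddings of \<open>Q\<close> that differ by an
  automorphism of \<open>Q\<close> give the same occurrence.\<close>

definition occurrences :: "'a ugraph \<Rightarrow> 'b ugraph \<Rightarrow> 'b ugraph set" where
  "occurrences Q G = {H. subgraph_of H G \<and> isomorphic_graphs Q H}"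

definition range_subgraph :: "'a ugraph \<Rightarrow> ('a \<Rightarrow> real) \<Rightarrow> real \<Rightarrow> real \<Rightarrow> 'a ugraph" where
  "range_subgraph G A x1 x2 = induced_subgraph G {v \<in> verts G. x1 \<le> A v \<and> A v \<le> x2}"

definition fractional_edge_cover :: "'a ugraph \<Rightarrow> ('a set \<Rightarrow> real) \<Rightarrow> bool" where
  "fractional_edge_cover Q W \<longleftrightarrow>
     (\<forall>e\<in>edges Q. 0 \<le> W e) \<and> (\<forall>v\<in>verts Q. 1 \<le> (\<Sum>e\<in>{e \<in> edges Q. v \<in> e}. W e))"

text \<open>The infimum below is a minimum whenever a cover exists at all
  (lemma \<open>fractional_edge_cover_number_attained\<close>); a graph with an isolated vertex has none.\<close>

definition fractional_edge_cover_number :: "'a ugraph \<Rightarrow> real" where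
  "fractional_edge_cover_number Q =
     Inf {(\<Sum>e\<in>edges Q. W e) | W. fractional_edge_cover Q W}"

lemma finite_edges: "simple_graph G \<Longrightarrow> finite (edges G)"
  unfolding simple_graph_def
  by (meson Pow_iff finite_Pow_iff finite_subset subsetI)

lemma fractional_edge_cover_number_attained:
  assumes Q: "simple_graph Q" and ex: "fractional_edge_cover Q W0"
  shows "\<exists>W. fractional_edge_cover Q W \<and> (\<Sum>e\<in>edges Q. W e) = fractional_edge_cover_number Q
           \<and> (\<forall>W'. fractional_edge_cover Q W' \<longrightarrow> (\<Sum>e\<in>edges Q. W e) \<le> (\<Sum>e\<in>edges Q. W' e))"
proof -
  have fin: "finite (edges Q)" using Q by (rule finite_edges)
  define box where "box = (Pi\<^sub>E UNIV (\<lambda>_. {0..1}) :: ('a set \<Rightarrow> real) set)"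
  define K where "K = box \<inter> (\<Inter>v\<in>verts Q. {W. 1 \<le> (\<Sum>e\<in>{e \<in> edges Q. v \<in> e}. W e)})"
  have cont: "continuous_on UNIV (\<lambda>W::'a set \<Rightarrow> real. \<Sum>e\<in>F. W e)" for F
    by (intro continuous_on_sum) simp
  have "compactin (product_topology (\<lambda>_. euclidean) UNIV) box"
    unfolding box_def compactin_PiE by auto
  then have "compact box"
    by (simp add: euclidean_product_topology)
  moreover have "closed (\<Inter>v\<in>verts Q. {W::'a set \<Rightarrow> real. 1 \<le> (\<Sum>e\<in>{e \<in> edges Q. v \<in> e}. W e)})"
    using closed_Collect_le[OF continuous_on_const cont] by (intro closed_INT ballI) auto
  ultimately have "compact K"
    unfolding K_def by (rule compact_Int_closed)
  define cap where "cap W = (\<lambda>e. if e \<in> edges Q then min 1 (W e) else 0)" for W :: "'a set \<Rightarrow> real"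
  have capK: "cap W \<in> K" if W: "fractional_edge_cover Q W" for W
  proof -
    have nonneg: "0 \<le> W e" if "e \<in> edges Q" for e
      using W that unfolding fractional_edge_cover_def by auto
    have "cap W \<in> box"
      using nonneg unfolding box_def cap_def by auto
    moreover have "1 \<le> (\<Sum>e\<in>{e \<in> edges Q. v \<in> e}. cap W e)" if v: "v \<in> verts Q" for v
    proof (cases "\<exists>e0\<in>{e \<in> edges Q. v \<in> e}. 1 \<le> W e0")
      case True
      then obtain e0 where e0: "e0 \<in> {e \<in> edges Q. v \<in> e}" "1 \<le> W e0" by blast
      have "cap W e0 \<le> (\<Sum>e\<in>{e \<in> edges Q. v \<in> e}. cap W e)"
        using fin e0 nonneg by (intro member_le_sum) (auto simp: cap_def)
      moreover have "cap W e0 = 1" using e0 by (auto simp: cap_def)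
      ultimately show ?thesis by simp
    next
      case False
      then have "(\<Sum>e\<in>{e \<in> edges Q. v \<in> e}. cap W e) = (\<Sum>e\<in>{e \<in> edges Q. v \<in> e}. W e)"
        by (intro sum.cong) (auto simp: cap_def)
      then show ?thesis using W v unfolding fractional_edge_cover_def by auto
    qed
    ultimately show ?thesis unfolding K_def by auto
  qed
  have cap_le: "(\<Sum>e\<in>edges Q. cap W e) \<le> (\<Sum>e\<in>edges Q. W e)" for W
    by (intro sum_mono) (auto simp: cap_def)
  have "K \<noteq> {}" using capK[OF ex] by auto
  moreover have "continuous_on K (\<lambda>W. \<Sum>e\<in>edges Q. W e)"
    using cont continuous_on_subset by blast
  ultimately obtain W where W: "W \<in> K"
    and min: "\<And>W'. W' \<in> K \<Longrightarrow> (\<Sum>e\<in>edges Q. W e) \<le> (\<Sum>e\<in>edges Q. W' e)"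
    using continuous_attains_inf[OF \<open>compact K\<close>] by blast
  have cov: "fractional_edge_cover Q W"
    using W unfolding K_def box_def fractional_edge_cover_def by auto
  have least: "(\<Sum>e\<in>edges Q. W e) \<le> (\<Sum>e\<in>edges Q. W' e)" if "fractional_edge_cover Q W'" for W'
    using min[OF capK[OF that]] cap_le[of W'] by linarith
  have "(\<Sum>e\<in>edges Q. W e) = fractional_edge_cover_number Q"
    unfolding fractional_edge_cover_number_def
    using cov least by (intro cInf_eq_minimum[symmetric]) auto
  then show ?thesis using cov least by blast
qed


section \<open>A real RAM with output\<close>

text \<open>
  Unit-cost word RAM with word length \<open>w\<close> (word arithmetic is modulo \<open>2 ^ w\<close>), extended by cells
  and registers for real numbers, which can only be copied and compared. An access outside the
  allocated memory has no transition, so the two lists bound all memory touched by a program,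
  working space included. A program mentions only finitely many registers.\<close>

datatype binop = Plus | Minus | Times | Div | Mod

fun binop_fun :: "binop \<Rightarrow> nat \<Rightarrow> nat \<Rightarrow> nat" where
  "binop_fun Plus a b = a + b"
| "binop_fun Minus a b = a - b"
| "binop_fun Times a b = a * b"
| "binop_fun Div a b = a div b"
| "binop_fun Mod a b = a mod b"

datatype test = Less nat nat | Equal nat nat | RealLeq nat nat

datatype com =
    Skip
  | Const nat nat                 \<comment> \<open>register, constant\<close>
  | Op binop nat nat nat          \<comment> \<open>target register, two argument registers\<close>
  | Load nat nat                  \<comment> \<open>target register, register holding the address\<close>
  | Store nat nat                 \<comment> \<open>register holding the address, source register\<close>
  | RealMove nat nat              \<comment> \<open>target real register, source real register\<close>
  | RealLoad nat nat              \<comment> \<open>target real register, (word) register holding the address\<close>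
  | RealStore nat nat             \<comment> \<open>(word) register holding the address, source real register\<close>
  | Report "nat list" "(nat \<times> nat) list"
      \<comment> \<open>registers holding the vertices, pairs of registers holding the end points of the edges\<close>
  | Seq com com
  | Cond test com com
  | While test com

record memory =
  words :: "nat list"
  reals :: "real list"

record state =
  reg :: "nat \<Rightarrow> nat"
  rreg :: "nat \<Rightarrow> real"
  mem :: memory

fun test_holds :: "test \<Rightarrow> state \<Rightarrow> bool" where
  "test_holds (Less i j) s \<longleftrightarrow> reg s i < reg s j"
| "test_holds (Equal i j) s \<longleftrightarrow> reg s i = reg s j"
| "test_holds (RealLeq i j) s \<longleftrightarrow> rreg s i \<le> rreg s j"

datatype event = Tick | Output "nat ugraph"

definition reported_graph :: "(nat \<Rightarrow> nat) \<Rightarrow> nat list \<Rightarrow> (nat \<times> nat) list \<Rightarrow> nat ugraph" where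
  "reported_graph r vs es = \<lparr>verts = r ` set vs, edges = (\<lambda>(a, b). {r a, r b}) ` set es\<rparr>"

text \<open>\<open>exec w c s t s'\<close>: started in \<open>s\<close>, \<open>c\<close> terminates in \<open>s'\<close> with the trace \<open>t\<close>, in which every
  \<open>Tick\<close> is one unit of time.\<close>

inductive exec :: "nat \<Rightarrow> com \<Rightarrow> state \<Rightarrow> event list \<Rightarrow> state \<Rightarrow> bool" for w :: nat where
  Skip: "exec w Skip s [Tick] s"
| Const: "exec w (Const i n) s [Tick] (s\<lparr>reg := (reg s)(i := n mod 2 ^ w)\<rparr>)"
| Op: "exec w (Op b i j k) s [Tick]
         (s\<lparr>reg := (reg s)(i := binop_fun b (reg s j) (reg s k) mod 2 ^ w)\<rparr>)"
| Load: "reg s j < length (words (mem s)) \<Longrightarrow>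
         exec w (Load i j) s [Tick] (s\<lparr>reg := (reg s)(i := words (mem s) ! reg s j)\<rparr>)"
| Store: "reg s i < length (words (mem s)) \<Longrightarrow>
         exec w (Store i j) s [Tick]
           (s\<lparr>mem := (mem s)\<lparr>words := (words (mem s))[reg s i := reg s j]\<rparr>\<rparr>)"
| RealMove: "exec w (RealMove i j) s [Tick] (s\<lparr>rreg := (rreg s)(i := rreg s j)\<rparr>)"
| RealLoad: "reg s j < length (reals (mem s)) \<Longrightarrow>
         exec w (RealLoad i j) s [Tick] (s\<lparr>rreg := (rreg s)(i := reals (mem s) ! reg s j)\<rparr>)"
| RealStore: "reg s i < length (reals (mem s)) \<Longrightarrow>
         exec w (RealStore i j) s [Tick]
           (s\<lparr>mem := (mem s)\<lparr>reals := (reals (mem s))[reg s i := rreg s j]\<rparr>\<rparr>)"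
| Report: "exec w (Report vs es) s [Tick, Output (reported_graph (reg s) vs es)] s"
| Seq: "exec w c1 s t1 s1 \<Longrightarrow> exec w c2 s1 t2 s2 \<Longrightarrow> exec w (Seq c1 c2) s (t1 @ t2) s2"
| CondTrue: "test_holds b s \<Longrightarrow> exec w c1 s t s1 \<Longrightarrow> exec w (Cond b c1 c2) s (Tick # t) s1"
| CondFalse: "\<not> test_holds b s \<Longrightarrow> exec w c2 s t s1 \<Longrightarrow> exec w (Cond b c1 c2) s (Tick # t) s1"
| WhileFalse: "\<not> test_holds b s \<Longrightarrow> exec w (While b c) s [Tick] s"
| WhileTrue: "test_holds b s \<Longrightarrow> exec w c s t1 s1 \<Longrightarrow> exec w (While b c) s1 t2 s2 \<Longrightarrow>
         exec w (While b c) s (Tick # t1 @ t2) s2"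

inductive_cases exec_elims:
  "exec w Skip s t s'" "exec w (Const i n) s t s'" "exec w (Op b i j k) s t s'"
  "exec w (Load i j) s t s'" "exec w (Store i j) s t s'" "exec w (RealMove i j) s t s'"
  "exec w (RealLoad i j) s t s'" "exec w (RealStore i j) s t s'" "exec w (Report vs es) s t s'"
  "exec w (Seq c1 c2) s t s'" "exec w (Cond b c1 c2) s t s'"

inductive_cases exec_WhileE: "exec w (While b c) s t s'"

lemma exec_deterministic:
  "exec w c s t s' \<Longrightarrow> exec w c s u s'' \<Longrightarrow> t = u \<and> s' = s''"
proof (induction arbitrary: u s'' rule: exec.induct)
  case (Seq c1 s t1 s1 c2 t2 s2)
  obtain u1 v u2 where "u = u1 @ u2" "exec w c1 s u1 v" "exec w c2 v u2 s''"
    using Seq.prems by (rule exec_elims(10)) metis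
  then show ?case using Seq.IH by metis
next
  case (CondTrue b s c1 t s1 c2)
  obtain u' where "u = Tick # u'" "exec w c1 s u' s''"
    using CondTrue.prems CondTrue.hyps(1) by (metis exec_elims(11))
  then show ?case using CondTrue.IH by metis
next
  case (CondFalse b s c2 t s1 c1)
  obtain u' where "u = Tick # u'" "exec w c2 s u' s''"
    using CondFalse.prems CondFalse.hyps(1) by (metis exec_elims(11))
  then show ?case using CondFalse.IH by metis
next
  case (WhileFalse b s c)
  then show ?case by (metis exec_WhileE)
next
  case (WhileTrue b s c t1 s1 t2 s2)
  obtain u1 v u2 where "u = Tick # u1 @ u2" "exec w c s u1 v" "exec w (While b c) v u2 s''"
    using WhileTrue.prems WhileTrue.hyps(1) by (metis exec_WhileE)
  then show ?case using WhileTrue.IH by metis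
qed (elim exec_elims; simp)+

definition outputs :: "event list \<Rightarrow> nat ugraph list" where
  "outputs t = [H. Output H \<leftarrow> t]"

text \<open>Every output-free stretch of the trace is covered: from the start to the first output, between
  consecutive outputs, and from the last output to termination, by which the program declares that
  there are no more occurrences.\<close>

definition delay_at_most :: "real \<Rightarrow> event list \<Rightarrow> bool" where
  "delay_at_most D t \<longleftrightarrow>
     (\<forall>t1 t2 t3. t = t1 @ t2 @ t3 \<and> set t2 \<subseteq> {Tick} \<longrightarrow> real (length t2) \<le> D)"


section \<open>Range subgraph listing\<close>

definition query_state :: "nat \<Rightarrow> memory \<Rightarrow> real \<Rightarrow> real \<Rightarrow> state" where
  "query_state entry M x1 x2 =
     \<lparr>reg = (\<lambda>_. 0)(0 := entry), rreg = (\<lambda>_. 0)(0 := x1, 1 := x2), mem = M\<rparr>"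

definition answers_query ::
  "nat \<Rightarrow> com \<Rightarrow> nat \<Rightarrow> 'a ugraph \<Rightarrow> nat ugraph \<Rightarrow> (nat \<Rightarrow> real) \<Rightarrow>
   real \<Rightarrow> memory \<Rightarrow> real \<Rightarrow> real \<Rightarrow> memory \<Rightarrow> bool" where
  "answers_query w P entry Q G A D M x1 x2 M' \<longleftrightarrow>
     (\<exists>t s'. exec w P (query_state entry M x1 x2) t s' \<and> mem s' = M' \<and>
        distinct (outputs t) \<and>
        set (outputs t) = occurrences Q (range_subgraph G A x1 x2) \<and>
        delay_at_most D t)"

definition space_used :: "memory \<Rightarrow> nat" where
  "space_used M = length (words M) + length (reals M)"

text \<open>\<open>\<M>\<close> is the set of memory contents that represent \<open>(G, A)\<close>. Queries may use the
  memory as working space, but must leave behind another representation, so that the structure can be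
  queried any number of times; \<open>entry\<close> is the word through which the query program accesses it.\<close>

definition range_listing_structure ::
  "nat \<Rightarrow> com \<Rightarrow> 'a ugraph \<Rightarrow> nat ugraph \<Rightarrow> (nat \<Rightarrow> real) \<Rightarrow> real \<Rightarrow> real \<Rightarrow>
   nat \<Rightarrow> memory set \<Rightarrow> bool" where
  "range_listing_structure w P Q G A S D entry \<M> \<longleftrightarrow>
     entry < 2 ^ w \<and> \<M> \<noteq> {} \<and>
     (\<forall>M\<in>\<M>. (\<forall>x\<in>set (words M). x < 2 ^ w) \<and> real (space_used M) \<le> S \<and>
        (\<forall>x1 x2. x1 \<le> x2 \<longrightarrow> (\<exists>M'\<in>\<M>. answers_query w P entry Q G A D M x1 x2 M')))"

end

theory Submission
  imports Defs
begin

text \<open>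
  Rank the non-isolated vertices by attribute. Every occurrence is represented by one labelling of the
  vertices of \<open>Q\<close> with ranks, chosen by symmetry breaking, and is charged to the vertex \<open>a\<close> of \<open>Q\<close> with
  the least rank. For each \<open>a\<close>, order the vertices of \<open>Q\<close> connectedly from \<open>a\<close> and search for labellings
  position by position, always running through the shortest adjacency list of an earlier neighbour. By
  Hoelder's inequality the AGM weights of the extensions of a prefix add up to at most the weight of the
  prefix, and the weight dominates the list that is run through; so the search takes \<open>O(m powr \<rho>)\<close>
  steps. Cutting the search tree by halving yields boxes of cost \<open>O(\<Delta>)\<close> each,
  up to logarithms \<open>O(m + m powr \<rho> / \<Delta>)\<close> in total, that are described by \<open>O(1)\<close> words. Only boxes that contain
  an accepted labelling are stored, keyed by the least possible maximal rank: a box has an answer with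
  maximum at most \<open>x2\<close> iff its key is in range. Such lists of boxes, sorted by key, are kept for
  the right halves of a binary search tree over the first rank. A query follows the search path of \<open>x1\<close>
  and scans the list of each right half until the keys exceed \<open>x2\<close>, so every searched box
  yields an output. The memory is never modified.\<close>

section \<open>Weakest preconditions and delays\<close>

text \<open>Rooting at the least rank separates the two ends of a query: \<open>x1\<close> restricts
  the root rank alone, \<open>x2\<close> only the maximal rank. For boxes whose root ranks lie in a
  stored range above \<open>x1\<close>, a single comparison then tells whether there is an answer.
  Answers cannot be stored themselves, as there may be about \<open>m powr \<rho>\<close> of them; a
  box merely promises one answer for search cost \<open>O(\<Delta>)\<close>, and the query repeats
  the search. So it is the running time of the search, not the number of answers, that must obey the
  AGM bound, in a form that is additive when candidate lists are cut. Two logarithms enter each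
  bound. In space, a root rank lies in at most \<open>L\<close> stored ranges, and a unit of cost
  takes part in logarithmically many halvings. In the delay, each root visits at most
  \<open>L\<close> lists, any of which may be silent, and an adjacency test is a binary search among
  the arcs. The word length has to accommodate arc codes and sums of two addresses.\<close>

definition wp :: "nat \<Rightarrow> com \<Rightarrow> state \<Rightarrow> (event list \<Rightarrow> state \<Rightarrow> bool) \<Rightarrow> bool" where
  "wp w c s Q \<longleftrightarrow> (\<exists>t s'. exec w c s t s' \<and> Q t s')"

lemma wp_mono: "wp w c s Q \<Longrightarrow> (\<And>t s'. Q t s' \<Longrightarrow> R t s') \<Longrightarrow> wp w c s R"
  unfolding wp_def by blast

lemma wp_Skip [simp]: "wp w Skip s Q = Q [Tick] s"
  unfolding wp_def by (auto intro: exec.intros elim: exec_elims)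

lemma wp_Const [simp]: "wp w (Const i n) s Q = Q [Tick] (s\<lparr>reg := (reg s)(i := n mod 2 ^ w)\<rparr>)"
  unfolding wp_def by (auto intro: exec.intros elim: exec_elims)

lemma wp_Op [simp]: "wp w (Op b i j l) s Q =
    Q [Tick] (s\<lparr>reg := (reg s)(i := binop_fun b (reg s j) (reg s l) mod 2 ^ w)\<rparr>)"
  unfolding wp_def by (auto intro: exec.intros elim: exec_elims)

lemma wp_Load [simp]: "wp w (Load i j) s Q \<longleftrightarrow> reg s j < length (words (mem s)) \<and>
    Q [Tick] (s\<lparr>reg := (reg s)(i := words (mem s) ! reg s j)\<rparr>)"
  unfolding wp_def by (auto intro: exec.intros elim: exec_elims)

lemma wp_RealLoad [simp]: "wp w (RealLoad i j) s Q \<longleftrightarrow> reg s j < length (reals (mem s)) \<and>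
    Q [Tick] (s\<lparr>rreg := (rreg s)(i := reals (mem s) ! reg s j)\<rparr>)"
  unfolding wp_def by (auto intro: exec.intros elim: exec_elims)

lemma wp_Report [simp]: "wp w (Report vs es) s Q \<longleftrightarrow>
    Q [Tick, Output (reported_graph (reg s) vs es)] s"
  unfolding wp_def by (auto intro: exec.intros elim: exec_elims)

lemma wp_Seq [simp]: "wp w (Seq c1 c2) s Q \<longleftrightarrow>
    wp w c1 s (\<lambda>t1 s1. wp w c2 s1 (\<lambda>t2 s2. Q (t1 @ t2) s2))"
  unfolding wp_def by (auto elim!: exec_elims intro: exec.Seq)

lemma wp_Cond [simp]: "wp w (Cond b c1 c2) s Q \<longleftrightarrow>
    wp w (if test_holds b s then c1 else c2) s (\<lambda>t. Q (Tick # t))"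
  unfolding wp_def by (auto elim!: exec_elims intro: exec.CondTrue exec.CondFalse)

lemma wp_While: "wp w (While b c) s Q \<longleftrightarrow>
    (if test_holds b s then wp w c s (\<lambda>t1 s1. wp w (While b c) s1 (\<lambda>t2. Q (Tick # t1 @ t2)))
     else Q [Tick] s)"
proof (cases "test_holds b s")
  case True
  have "exec w (While b c) s t s' \<longleftrightarrow>
      (\<exists>t1 s1 t2. t = Tick # t1 @ t2 \<and> exec w c s t1 s1 \<and> exec w (While b c) s1 t2 s')" for t s'
    using True exec.WhileTrue[OF True] by (metis exec_WhileE)
  then show ?thesis using True unfolding wp_def by (simp only: if_True) blast
next
  case False
  have "exec w (While b c) s t s' \<longleftrightarrow> t = [Tick] \<and> s' = s" for t s'
    using False by (auto elim: exec_WhileE intro: exec.WhileFalse)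
  then show ?thesis using False unfolding wp_def by auto
qed

lemma outputs_simps [simp]:
  "outputs [] = []" "outputs (Tick # t) = outputs t" "outputs (Output H # t) = H # outputs t"
  "outputs (t @ u) = outputs t @ outputs u"
  by (simp_all add: outputs_def)

text \<open>For a loop whose number of rounds is known on entry. Outputs and time are functions of
  the round, because the candidates of one search level differ widely in cost and a uniform bound
  per round would spoil the cost estimate.\<close>

lemma wp_While_for:
  assumes "I 0 s"
    and "\<And>i s. i < N \<Longrightarrow> I i s \<Longrightarrow> test_holds b s \<and>
           wp w c s (\<lambda>t s'. outputs t = os i \<and> length t \<le> T i \<and> I (Suc i) s')"
    and "\<And>s. I N s \<Longrightarrow> \<not> test_holds b s"
  shows "wp w (While b c) s (\<lambda>t s'. outputs t = concat (map os [0..<N]) \<and>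
           length t \<le> 1 + (\<Sum>i\<leftarrow>[0..<N]. T i + 1) \<and> I N s')"
proof -
  have "wp w (While b c) s (\<lambda>t s'. outputs t = concat (map os [j..<N]) \<and>
           length t \<le> 1 + (\<Sum>i\<leftarrow>[j..<N]. T i + 1) \<and> I N s')" if "j \<le> N" "I j s" for j s
    using that
  proof (induction j arbitrary: s rule: inc_induct)
    case base
    then show ?case using assms(3) by (subst wp_While) auto
  next
    case (step j)
    have b: "test_holds b s"
      and c: "wp w c s (\<lambda>t s'. outputs t = os j \<and> length t \<le> T j \<and> I (Suc j) s')"
      using assms(2)[OF step.hyps(2) step.prems] by auto
    show ?case
      apply (subst wp_While)
      apply (simp only: b if_True)
      apply (rule wp_mono[OF c], elim conjE)
      apply (rule wp_mono[OF step.IH], assumption)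
      using step.hyps(2) by (auto simp: upt_conv_Cons)
  qed
  from this[OF _ assms(1)] show ?thesis by simp
qed

text \<open>For binary search, whose number of rounds depends on the data: \<open>d\<close> only
  bounds the remaining rounds, and an earlier exit is allowed.\<close>

lemma wp_While_silent:
  assumes "I d s"
    and "\<And>d s. I d s \<Longrightarrow> test_holds b s \<Longrightarrow> 0 < d \<and>
           wp w c s (\<lambda>t s'. outputs t = [] \<and> length t \<le> T \<and> I (d - 1) s')"
  shows "wp w (While b c) s (\<lambda>t s'. outputs t = [] \<and> length t \<le> 1 + d * (T + 1) \<and>
           (\<exists>d. I d s') \<and> \<not> test_holds b s')"
  using assms(1)
proof (induction d arbitrary: s)
  case 0
  then show ?case using assms(2)[of 0 s] by (subst wp_While) auto
next
  case (Suc d)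
  show ?case
  proof (cases "test_holds b s")
    case True
    have c: "wp w c s (\<lambda>t s'. outputs t = [] \<and> length t \<le> T \<and> I d s')"
      using assms(2)[OF Suc.prems True] by simp
    show ?thesis
      apply (subst wp_While)
      apply (simp only: True if_True)
      apply (rule wp_mono[OF c], elim conjE)
      apply (rule wp_mono[OF Suc.IH], assumption)
      by auto
  qed (use Suc.prems in \<open>subst wp_While, auto\<close>)
qed

text \<open>An output-free stretch across the seam is an output-free end of \<open>t1\<close>
  followed by an output-free beginning of \<open>t2\<close>. Nothing is assumed about outputs, so
  the bounds add up; this is affordable only for few pieces, such as the roots and the levels of the
  search tree.\<close>

lemma delay_append:
  assumes "delay_at_most D1 t1" "delay_at_most D2 t2"
  shows "delay_at_most (D1 + D2) (t1 @ t2)"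
  unfolding delay_at_most_def
proof (intro allI impI)
  \<comment> \<open>The empty stretch forces both bounds to be nonnegative.\<close>
  have nn: "0 \<le> D1" "0 \<le> D2"
    using assms unfolding delay_at_most_def
    by (metis append_Nil empty_set empty_subsetI list.size(3) of_nat_0)+
  fix u1 u2 u3 assume a: "t1 @ t2 = u1 @ u2 @ u3 \<and> set u2 \<subseteq> {Tick}"
  then consider (1) us where "t1 = u1 @ us" "us @ t2 = u2 @ u3"
    | (2) us where "t2 = us @ u2 @ u3"
    by (auto simp: append_eq_append_conv2)
  then show "real (length u2) \<le> D1 + D2"
  proof cases
    case 1
    then consider (3) vs where "us = u2 @ vs" | (4) vs where "u2 = us @ vs" "t2 = vs @ u3"
      by (auto simp: append_eq_append_conv2)
    then show ?thesis
    proof cases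
      case 3
      then have "real (length u2) \<le> D1" using 1 a assms(1) unfolding delay_at_most_def by blast
      then show ?thesis using nn by simp
    next
      case 4
      have "t1 = u1 @ us @ []" "t2 = [] @ vs @ u3" "set us \<subseteq> {Tick}" "set vs \<subseteq> {Tick}"
        using 1 4 a by auto
      then have "real (length us) \<le> D1" "real (length vs) \<le> D2"
        using assms unfolding delay_at_most_def by blast+
      then show ?thesis using 4 by simp
    qed
  next
    case 2
    then have "real (length u2) \<le> D2" using a assms(2) unfolding delay_at_most_def by blast
    then show ?thesis using nn by simp
  qed
qed

lemma delay_length: "real (length t) \<le> D \<Longrightarrow> delay_at_most D t"
  unfolding delay_at_most_def by auto

lemma delay_mono: "delay_at_most D t \<Longrightarrow> D \<le> D' \<Longrightarrow> delay_at_most D' t"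
  unfolding delay_at_most_def by (blast intro: order_trans)

text \<open>Blocks of length at most \<open>\<tau>\<close>, each with an output except possibly the
  last. In contrast to \<open>delay_append\<close>, the resulting delay does not grow with the
  number of blocks, as a scan of arbitrarily many boxes requires.\<close>

inductive paced :: "nat \<Rightarrow> event list \<Rightarrow> bool" for \<tau> where
  paced_short: "length t \<le> \<tau> \<Longrightarrow> paced \<tau> t"
| paced_append: "length t \<le> \<tau> \<Longrightarrow> outputs t \<noteq> [] \<Longrightarrow> paced \<tau> u \<Longrightarrow> paced \<tau> (t @ u)"

lemma outputs_silent: "set t \<subseteq> {Tick} \<Longrightarrow> outputs t = []"
  by (induction t) auto

text \<open>A block with an output cannot lie inside an output-free stretch, so such a stretch meets
  at most two consecutive blocks.\<close>

lemma paced_delay: "paced \<tau> t \<Longrightarrow> delay_at_most (2 * real \<tau>) t"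
proof -
  have "paced \<tau> t \<Longrightarrow>
    (\<forall>t1 t2. t = t1 @ t2 \<and> set t1 \<subseteq> {Tick} \<longrightarrow> length t1 \<le> \<tau>) \<and>
    (\<forall>t1 t2 t3. t = t1 @ t2 @ t3 \<and> set t2 \<subseteq> {Tick} \<longrightarrow> length t2 \<le> 2 * \<tau>)"
  proof (induction rule: paced.induct)
    case (paced_append t u)
    have pre: "length t1 \<le> \<tau>" if a: "t @ u = t1 @ t2" "set t1 \<subseteq> {Tick}" for t1 t2
    proof -
      from a(1) consider (1) us where "t = t1 @ us" | (2) us where "t1 = t @ us"
        by (auto simp: append_eq_append_conv2)
      then show ?thesis
      proof cases
        case 1 then show ?thesis using paced_append.hyps(1) by auto
      next
        case 2 then have "outputs t = []" using a(2) by (intro outputs_silent) auto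
        then show ?thesis using paced_append.hyps(2) by simp
      qed
    qed
    have "length t2 \<le> 2 * \<tau>" if a: "t @ u = t1 @ t2 @ t3" "set t2 \<subseteq> {Tick}" for t1 t2 t3
    proof -
      from a(1) consider (1) us where "t = t1 @ us" "us @ u = t2 @ t3" | (2) us where "u = us @ t2 @ t3"
        by (auto simp: append_eq_append_conv2)
      then show ?thesis
      proof cases
        case 1
        then consider (3) vs where "us = t2 @ vs" | (4) vs where "t2 = us @ vs" "u = vs @ t3"
          by (auto simp: append_eq_append_conv2)
        then show ?thesis
        proof cases
          case 3 then show ?thesis using 1 paced_append.hyps(1) by auto
        next
          case 4
          then have "length vs \<le> \<tau>" using paced_append.IH a(2) by auto
          moreover have "length us \<le> \<tau>" using 1 paced_append.hyps(1) by auto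
          ultimately show ?thesis using 4 by auto
        qed
      next
        case 2 then show ?thesis using paced_append.IH a(2) by blast
      qed
    qed
    with pre show ?case by blast
  qed auto
  then show "paced \<tau> t \<Longrightarrow> delay_at_most (2 * real \<tau>) t"
    unfolding delay_at_most_def using of_nat_mono by fastforce
qed

section \<open>The search program\<close>

text \<open>Offsets such as \<open>t + 1\<close> stay arithmetic terms, in the shape produced by
  adding the register that holds 1.\<close>

declare One_nat_def [simp del]

text \<open>Level \<open>i\<close> of the search owns three registers: the current vertex, the address of the next candidate
  and the end of the candidates. Registers 20 to 39 are scratch. Registers 1 to 8 and 15 are constants
  (see \<open>env\<close> below), 9 to 14 hold the table of box lists, the current and the final address of the
  scanned list, and the bounds and midpoint of the binary search.\<close>

abbreviation "rv i \<equiv> 40 + 3 * i"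
abbreviation "rs i \<equiv> 41 + 3 * i"
abbreviation "re i \<equiv> 42 + 3 * i"

text \<open>Frame condition; \<open>b\<close> is the first register above the scratch area that may
  change. With \<open>b = 40 + 3 * length p\<close> the registers of the levels that carry the
  prefix \<open>p\<close> survive. Real registers 0 and 1 hold the query bounds.\<close>

definition same :: "nat \<Rightarrow> state \<Rightarrow> state \<Rightarrow> bool" where
  "same b s s' \<longleftrightarrow> mem s' = mem s \<and> rreg s' 0 = rreg s 0 \<and> rreg s' 1 = rreg s 1 \<and>
     (\<forall>r. r < 20 \<or> 40 \<le> r \<and> r < b \<longrightarrow> reg s' r = reg s r)"

lemma same_refl [simp]: "same b s s"
  by (simp add: same_def)

lemma same_trans: "same b s s' \<Longrightarrow> same b s' s'' \<Longrightarrow> same b s s''"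
  by (simp add: same_def)

lemma same_mono: "same b s s' \<Longrightarrow> b' \<le> b \<Longrightarrow> same b' s s'"
  by (simp add: same_def)

text \<open>Checks are written in continuation passing style: the check runs its argument if it succeeds.\<close>

definition is_check :: "nat \<Rightarrow> (state \<Rightarrow> bool) \<Rightarrow> nat \<Rightarrow> (com \<Rightarrow> com) \<Rightarrow> bool \<Rightarrow> nat \<Rightarrow> bool" where
  "is_check w P b c ok T \<longleftrightarrow> (\<forall>body s os T'. P s \<longrightarrow>
     (ok \<longrightarrow> (\<forall>s1. same b s s1 \<longrightarrow>
        wp w body s1 (\<lambda>t s'. outputs t = os \<and> length t \<le> T' \<and> same b s1 s'))) \<longrightarrow>
     wp w (c body) s (\<lambda>t s'. outputs t = (if ok then os else []) \<and>
        length t \<le> T + (if ok then T' else 0) \<and> same b s s'))"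

lemma is_checkD:
  assumes "is_check w P b c ok T" "P s"
    "\<And>s1. ok \<Longrightarrow> same b s s1 \<Longrightarrow>
        wp w body s1 (\<lambda>t s'. outputs t = os \<and> length t \<le> T' \<and> same b s1 s')"
  shows "wp w (c body) s (\<lambda>t s'. outputs t = (if ok then os else []) \<and>
        length t \<le> T + (if ok then T' else 0) \<and> same b s s')"
  using assms unfolding is_check_def by blast

lemma is_check_comp:
  assumes P: "\<And>s s'. P s \<Longrightarrow> same b s s' \<Longrightarrow> P s'"
    and c: "is_check w P b c ok T" and d: "is_check w P b d ok' T'"
  shows "is_check w P b (\<lambda>body. c (d body)) (ok \<and> ok') (T + T')"
  unfolding is_check_def
proof (intro allI impI)
  fix body s os T'' assume Ps: "P s" and body: "ok \<and> ok' \<longrightarrow> (\<forall>s1. same b s s1 \<longrightarrow>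
        wp w body s1 (\<lambda>t s'. outputs t = os \<and> length t \<le> T'' \<and> same b s1 s'))"
  show "wp w (c (d body)) s (\<lambda>t s'. outputs t = (if ok \<and> ok' then os else []) \<and>
        length t \<le> T + T' + (if ok \<and> ok' then T'' else 0) \<and> same b s s')"
  proof (rule wp_mono[OF is_checkD[OF c Ps,
          where os = "if ok' then os else []" and T' = "T' + (if ok' then T'' else 0)"]])
    fix s1 assume "ok" "same b s s1"
    with body Ps show "wp w (d body) s1 (\<lambda>t s'. outputs t = (if ok' then os else []) \<and>
        length t \<le> T' + (if ok' then T'' else 0) \<and> same b s1 s')"
      by (intro is_checkD[OF d]) (auto intro: P same_trans)
  qed auto
qed

lemma is_check_foldr:
  assumes P: "\<And>s s'. P s \<Longrightarrow> same b s s' \<Longrightarrow> P s'"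
    and f: "\<And>x. x \<in> set xs \<Longrightarrow> is_check w P b (f x) (ok x) T"
  shows "is_check w P b (foldr f xs) (\<forall>x\<in>set xs. ok x) (length xs * T)"
  using f
proof (induction xs)
  case Nil
  then show ?case by (auto simp: is_check_def)
next
  case (Cons x xs)
  have "is_check w P b (\<lambda>body. f x (foldr f xs body)) (ok x \<and> (\<forall>x\<in>set xs. ok x)) (T + length xs * T)"
    by (rule is_check_comp[OF P]) (use Cons in auto)
  then show ?case by (simp add: comp_def)
qed

lemma is_check_weaken:
  assumes c: "is_check w P b c ok T" and le: "T \<le> T'"
  shows "is_check w P b c ok T'"
  unfolding is_check_def
proof (intro allI impI)
  fix body s os T'' assume "P s" and "ok \<longrightarrow> (\<forall>s1. same b s s1 \<longrightarrow>
        wp w body s1 (\<lambda>t s'. outputs t = os \<and> length t \<le> T'' \<and> same b s1 s'))"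
  then have "wp w (c body) s (\<lambda>t s'. outputs t = (if ok then os else []) \<and>
        length t \<le> T + (if ok then T'' else 0) \<and> same b s s')"
    by (intro is_checkD[OF c]) auto
  then show "wp w (c body) s (\<lambda>t s'. outputs t = (if ok then os else []) \<and>
        length t \<le> T' + (if ok then T'' else 0) \<and> same b s s')"
    by (rule wp_mono) (use le in auto)
qed

section \<open>The commands of the search\<close>

locale pattern =
  fixes k :: nat and nb :: "nat \<Rightarrow> nat list" and ne le :: "(nat \<times> nat) list"
begin

abbreviation "rid i \<equiv> 40 + 3 * k + i"

definition edge_list :: "(nat \<times> nat) list" where
  "edge_list = concat (map (\<lambda>i. map (\<lambda>j. (j, i)) (nb i)) [0..<k])"

text \<open>Binary search for the arc code in the whole sorted segment. It stops at the first cell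
  that is not below the code, or at the end, so that one comparison decides.\<close>

definition adj_check :: "nat \<Rightarrow> nat \<Rightarrow> com \<Rightarrow> com" where
  "adj_check i j body =
     Seq (Op Plus 20 (rv j) 2) (Seq (Op Times 20 20 4) (Seq (Op Plus 20 20 (rv i))
     (Seq (Op Plus 21 5 1) (Seq (Op Plus 22 6 1) (Seq
       (While (Less 21 22)
         (Seq (Op Plus 23 21 22) (Seq (Op Div 23 23 3) (Seq (Load 24 23)
           (Cond (Less 24 20) (Op Plus 21 23 2) (Op Plus 22 23 1))))))
       (Cond (Less 21 6) (Seq (Load 24 21) (Cond (Equal 24 20) body Skip)) Skip))))))"

definition shorter_row :: "nat \<Rightarrow> nat \<Rightarrow> com" where
  "shorter_row i j =
     Seq (Op Plus 20 7 (rv j)) (Seq (Load 21 20) (Seq (Op Plus 20 20 2) (Seq (Load 22 20)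
     (Seq (Op Minus 23 22 21) (Seq (Op Minus 24 (re i) (rs i))
     (Cond (Less 23 24) (Seq (Op Plus (rs i) 21 1) (Op Plus (re i) 22 1)) Skip))))))"

text \<open>The whole segment serves as an initial value longer than every row; the first neighbour
  replaces it.\<close>

definition choose_row :: "nat \<Rightarrow> com" where
  "choose_row i = Seq (Op Plus (rs i) 5 1) (Seq (Op Plus (re i) 6 1)
     (foldr (\<lambda>j. Seq (shorter_row i j)) (nb i) Skip))"

definition level :: "nat \<Rightarrow> com \<Rightarrow> com" where
  "level i body =
     Seq (Const 20 (1 + 2 * i)) (Seq (Op Plus 20 20 10) (Seq (Load (rs i) 20)
     (Seq (Op Plus 20 20 2) (Seq (Load (re i) 20)
     (Seq (Cond (Less (rs i) (re i)) Skip (choose_row i))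
     (While (Less (rs i) (re i))
       (Seq (Load 20 (rs i)) (Seq (Op Mod (rv i) 20 4)
         (Seq (foldr (adj_check i) (nb i) body) (Op Plus (rs i) (rs i) 2))))))))))"

definition report_embedding :: com where
  "report_embedding = foldr (\<lambda>i. Seq (Seq (Op Plus 20 8 (rv i)) (Load (rid i) 20))) [0..<k]
     (Report (map (\<lambda>i. rid i) [0..<k]) (map (\<lambda>(j, i). (rid j, rid i)) edge_list))"

text \<open>Of the query bounds only \<open>x2\<close> is tested here. The bound \<open>x1\<close>
  concerns the root rank and is enforced by the choice of the lists that are scanned.\<close>

definition final :: com where
  "final = foldr (\<lambda>(i, j) c. Cond (Equal (rv i) (rv j)) Skip c) ne
     (foldr (\<lambda>(i, j) c. Cond (Less (rv i) (rv j)) c Skip) le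
     (foldr (\<lambda>i c. Seq (RealLoad 2 (rv i)) (Cond (RealLeq 2 1) c Skip)) [0..<k]
     report_embedding))"

primrec enum :: "nat \<Rightarrow> com" where
  "enum 0 = final"
| "enum (Suc r) = level (k - Suc r) (enum r)"

end

text \<open>Vertices are ranks below \<open>n\<close>. The cells \<open>EB\<close> to \<open>EE\<close> hold the ranks in order and then the codes
  \<open>(u + 1) * n + v\<close> of all arcs in increasing order, so that \<open>v\<close> is the cell modulo \<open>n\<close> in both cases;
  \<open>val\<close> abstracts this, and \<open>off u\<close> is where the arcs of \<open>u\<close> begin. Position \<open>i\<close> of
  the pattern is adjacent to the earlier positions \<open>nb i\<close>.\<close>

locale search = pattern +
  fixes n EB EE L :: nat and off val :: "nat \<Rightarrow> nat" and adj :: "nat \<Rightarrow> nat \<Rightarrow> bool"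
  assumes k_pos: "0 < k"
    and nb_less: "\<And>i j. j \<in> set (nb i) \<Longrightarrow> j < i" and nb_length: "\<And>i. i < k \<Longrightarrow> length (nb i) \<le> k"
    and nb_nonempty: "\<And>i. 0 < i \<Longrightarrow> i < k \<Longrightarrow> nb i \<noteq> []"
    and n_pos: "0 < n"
    and adj_less: "\<And>u v. adj u v \<Longrightarrow> u < n \<and> v < n"
    and E_range: "EB + n \<le> EE" "EE - EB < 2 ^ L"
    and off_range: "\<And>u. u \<le> n \<Longrightarrow> EB + n \<le> off u \<and> off u \<le> EE"
    and off_mono: "\<And>u. u < n \<Longrightarrow> off u \<le> off (Suc u)"
    and val_less [simp]: "\<And>t. val t < n"
    and val_ident: "\<And>v. v < n \<Longrightarrow> val (EB + v) = v"
    and row: "\<And>u. u < n \<Longrightarrow> distinct (map val [off u..<off (Suc u)])"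
      "\<And>u. u < n \<Longrightarrow> set (map val [off u..<off (Suc u)]) = {v. adj u v}"
    and deg_pos: "\<And>u. u < n \<Longrightarrow> \<exists>v. adj u v"
begin

definition shorter :: "nat list \<Rightarrow> nat \<Rightarrow> nat \<times> nat \<Rightarrow> nat \<times> nat" where
  "shorter p j se = (if off (Suc (p ! j)) - off (p ! j) < snd se - fst se
     then (off (p ! j), off (Suc (p ! j))) else se)"

definition dyn :: "nat list \<Rightarrow> nat \<times> nat" where
  "dyn p = fold (shorter p) (nb (length p)) (EB, EE)"

text \<open>A box is a list of address ranges for the candidates at the first positions; later positions use
  the shortest row.\<close>

definition rng :: "(nat \<times> nat) list \<Rightarrow> nat list \<Rightarrow> nat \<times> nat" where
  "rng b p = (if length p < length b then b ! length p else dyn p)"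

definition okv :: "nat list \<Rightarrow> nat \<Rightarrow> bool" where
  "okv p v \<longleftrightarrow> (\<forall>j\<in>set (nb (length p)). adj (p ! j) v)"

primrec leaves :: "(nat \<times> nat) list \<Rightarrow> nat \<Rightarrow> nat list \<Rightarrow> nat list list" where
  "leaves b 0 p = [p]"
| "leaves b (Suc r) p = concat (map (\<lambda>t. if okv p (val t) then leaves b r (p @ [val t]) else [])
     [fst (rng b p)..<snd (rng b p)])"

text \<open>A candidate costs one even if it is rejected. At a fixed prefix the cost is thus a sum
  over candidate addresses, so that cutting an address range cuts the cost.\<close>

primrec steps :: "(nat \<times> nat) list \<Rightarrow> nat \<Rightarrow> nat list \<Rightarrow> nat" where
  "steps b 0 p = 1"
| "steps b (Suc r) p = 1 + (\<Sum>t\<leftarrow>[fst (rng b p)..<snd (rng b p)].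
     1 + (if okv p (val t) then steps b r (p @ [val t]) else 0))"

definition accepted :: "nat list \<Rightarrow> bool" where
  "accepted p \<longleftrightarrow> (\<forall>(i, j)\<in>set ne. p ! i \<noteq> p ! j) \<and> (\<forall>(i, j)\<in>set le. p ! i < p ! j)"

text \<open>Empty ranges are excluded because an empty range in memory stands for a position at
  which the program has to choose the row itself.\<close>

definition box_ok :: "(nat \<times> nat) list \<Rightarrow> bool" where
  "box_ok b \<longleftrightarrow> length b \<le> k \<and> (\<forall>(s, e)\<in>set b. EB \<le> s \<and> s < e \<and> e \<le> EE)"

end

text \<open>The factor two in \<open>words_bound\<close> keeps the sum of two addresses, as in a
  midpoint computation, from wrapping around. \<open>code_bound\<close> does the same for arc
  codes.\<close>

locale graph_memory = search +
  fixes w :: nat and M :: memory and OFF VID :: nat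
    and vid :: "nat \<Rightarrow> nat" and att :: "nat \<Rightarrow> real" and x1 x2 :: real
  assumes k_bound: "2 * k + 1 < 2 ^ w" and three: "3 < (2::nat) ^ w"
    and ne_less: "\<And>i j. (i, j) \<in> set ne \<Longrightarrow> i < k \<and> j < k"
    and le_less: "\<And>i j. (i, j) \<in> set le \<Longrightarrow> i < k \<and> j < k"
    and words_bound: "2 * length (words M) < 2 ^ w"
    and code_bound: "(n + 1) * n < 2 ^ w"
    and E_len: "EE \<le> length (words M)"
    and E_sorted: "\<And>s t. EB \<le> s \<Longrightarrow> s < t \<Longrightarrow> t < EE \<Longrightarrow> words M ! s < words M ! t"
    and E_adj: "\<And>u v. u < n \<Longrightarrow> v < n \<Longrightarrow>
      adj u v \<longleftrightarrow> (\<exists>t. EB \<le> t \<and> t < EE \<and> words M ! t = (u + 1) * n + v)"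
    and E_val: "\<And>t. EB \<le> t \<Longrightarrow> t < EE \<Longrightarrow> words M ! t mod n = val t"
    and OFF: "\<And>u. u \<le> n \<Longrightarrow> OFF + u < length (words M) \<and> words M ! (OFF + u) = off u"
    and VID: "\<And>u. u < n \<Longrightarrow> VID + u < length (words M) \<and> words M ! (VID + u) = vid u"
    and reals: "length (reals M) = n" "\<And>u. u < n \<Longrightarrow> reals M ! u = att u"
begin

definition in_range :: "nat list \<Rightarrow> bool" where
  "in_range p \<longleftrightarrow> (\<forall>i<k. att (p ! i) \<le> x2)"

definition rep :: "nat list \<Rightarrow> nat ugraph" where
  "rep p = \<lparr>verts = (\<lambda>i. vid (p ! i)) ` {..<k},
     edges = (\<lambda>(j, i). {vid (p ! j), vid (p ! i)}) ` set edge_list\<rparr>"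

text \<open>In memory a box is padded with empty ranges, which tell the program to choose the row itself; the
  cell at \<open>a\<close> is left to the key.\<close>

definition box_at :: "nat \<Rightarrow> (nat \<times> nat) list \<Rightarrow> bool" where
  "box_at a b \<longleftrightarrow> box_ok b \<and> a + 2 * k < length (words M) \<and>
     (\<forall>i<k. words M ! (a + 1 + 2 * i) = (if i < length b then fst (b ! i) else 0) \<and>
            words M ! (a + 2 + 2 * i) = (if i < length b then snd (b ! i) else 0))"

definition env :: "state \<Rightarrow> bool" where
  "env s \<longleftrightarrow> mem s = M \<and> rreg s 0 = x1 \<and> rreg s 1 = x2 \<and> reg s 1 = 0 \<and> reg s 2 = 1 \<and>
     reg s 3 = 2 \<and> reg s 4 = n \<and> reg s 5 = EB \<and> reg s 6 = EE \<and> reg s 7 = OFF \<and> reg s 8 = VID \<and>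
     reg s 15 = 2 * k + 1"

section \<open>Correctness of the search commands\<close>

lemma env_same: "env s \<Longrightarrow> same b s s' \<Longrightarrow> env s'"
  by (simp add: env_def same_def)

lemma word_small: "a \<le> 2 * length (words M) \<Longrightarrow> a mod 2 ^ w = a"
  using words_bound by simp

definition prefix_at :: "nat list \<Rightarrow> state \<Rightarrow> bool" where
  "prefix_at p s \<longleftrightarrow> env s \<and> (\<forall>i<length p. reg s (rv i) = p ! i)"

lemma prefix_at_same: "prefix_at p s \<Longrightarrow> same (40 + 3 * length p) s s' \<Longrightarrow> prefix_at p s'"
  unfolding prefix_at_def by (auto simp: env_same) (simp add: same_def)

lemma code_small:
  assumes "u < n" "v < n" shows "(u + 1) * n + v < 2 ^ w"
proof -
  have "(u + 1) * n + v < (u + 1) * n + n" using assms by simp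
  also have "\<dots> = (u + 2) * n" by (simp add: algebra_simps)
  also have "\<dots> \<le> (n + 1) * n" using assms by (intro mult_right_mono) auto
  finally show ?thesis using code_bound by simp
qed

lemma adj_search:
  assumes s: "env s" "reg s 20 = c" "reg s 21 = EB" "reg s 22 = EE"
  shows "wp w (While (Less 21 22)
         (Seq (Op Plus 23 21 22) (Seq (Op Div 23 23 3) (Seq (Load 24 23)
           (Cond (Less 24 20) (Op Plus 21 23 2) (Op Plus 22 23 1)))))) s
      (\<lambda>t s'. outputs t = [] \<and> length t \<le> 1 + 6 * L \<and> same b s s' \<and> reg s' 20 = c \<and>
         EB \<le> reg s' 21 \<and> reg s' 21 \<le> EE \<and>
         (reg s' 21 < EE \<and> words M ! reg s' 21 = c \<longleftrightarrow> (\<exists>t. EB \<le> t \<and> t < EE \<and> words M ! t = c)))"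
    (is "wp w (While ?b ?c) s ?Q")
proof -
  \<comment> \<open>Cells before register 21 are below the code, cells from register 22 on are not,
    and the gap is less than \<open>2 ^ d\<close>; hence \<open>L\<close> rounds suffice.\<close>
  define I where "I d s' \<longleftrightarrow> same b s s' \<and> reg s' 20 = c \<and> EB \<le> reg s' 21 \<and>
      reg s' 21 \<le> reg s' 22 \<and> reg s' 22 \<le> EE \<and> reg s' 22 - reg s' 21 < 2 ^ d \<and>
      (\<forall>t. EB \<le> t \<and> t < reg s' 21 \<longrightarrow> words M ! t < c) \<and>
      (\<forall>t. reg s' 22 \<le> t \<and> t < EE \<longrightarrow> c \<le> words M ! t)" for d s'
  have "I L s" using s E_range E_len by (auto simp: I_def)
  moreover have "0 < d \<and> wp w ?c s' (\<lambda>t s'. outputs t = [] \<and> length t \<le> 5 \<and> I (d - 1) s')"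
    if I: "I d s'" and t: "test_holds ?b s'" for d s'
  proof -
    have d: "0 < d" using I t by (cases d) (auto simp: I_def)
    have e: "env s'" using I s(1) env_same by (auto simp: I_def)
    define lo hi where "lo = reg s' 21" and "hi = reg s' 22"
    have lh: "EB \<le> lo" "lo < hi" "hi \<le> EE" "hi - lo < 2 ^ d" "reg s' 20 = c"
      using I t by (auto simp: I_def lo_def hi_def)
    define mid where "mid = (lo + hi) div 2"
    have mid: "lo \<le> mid" "mid < hi" using lh by (auto simp: mid_def)
    have pw: "(2::nat) ^ d = 2 * 2 ^ (d - 1)" using d by (simp add: power_eq_if)
    have md: "mid - lo < 2 ^ (d - 1)" "hi - (mid + 1) < 2 ^ (d - 1)"
      using lh pw unfolding mid_def by linarith+
    have len: "mid < length (words M)" using mid lh E_range E_len by linarith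
    have m1: "(lo + hi) mod 2 ^ w = lo + hi" "mid mod 2 ^ w = mid" "(mid + 1) mod 2 ^ w = mid + 1"
      using lh E_range E_len len by (intro word_small; linarith)+
    have srt: "words M ! t < c" if "EB \<le> t" "t < mid + 1" "words M ! mid < c" for t
      using E_sorted[of t mid] that mid lh by (cases "t = mid") force+
    have srt2: "c \<le> words M ! t" if "mid \<le> t" "t < EE" "\<not> words M ! mid < c" for t
      using E_sorted[of mid t] that mid lh by (cases "t = mid") force+
    have frame: "\<And>f. (\<forall>r. r < 20 \<or> 40 \<le> r \<longrightarrow> f r = reg s' r) \<Longrightarrow> same b s (s'\<lparr>reg := f\<rparr>)"
      using I by (auto simp: I_def same_def)
    have r: "reg s' 21 = lo" "reg s' 22 = hi" by (simp_all add: lo_def hi_def)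
    have post: "(\<forall>t. EB \<le> t \<and> t < lo \<longrightarrow> words M ! t < c)" "(\<forall>t. hi \<le> t \<and> t < EE \<longrightarrow> c \<le> words M ! t)"
      using I by (auto simp: I_def lo_def hi_def)
    show ?thesis
    proof (intro conjI)
      have e': "mem s' = M" "reg s' 1 = 0" "reg s' 2 = 1" "reg s' 3 = 2" using e by (auto simp: env_def)
      have p: "EB \<le> mid" "mid + 1 \<le> hi" "mid \<le> EE" "EB \<le> mid + 1" "mid + 1 \<le> EE" using mid lh by auto
      show "wp w ?c s' (\<lambda>t s'. outputs t = [] \<and> length t \<le> 5 \<and> I (d - 1) s')"
        apply (simp only: wp_Seq wp_Op wp_Load wp_Cond)
        apply (simp add: e' r m1 len mid_def[symmetric] lh(5))
        apply (intro conjI impI)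
         apply (simp add: I_def lh r p md srt srt2 post frame mid)
        apply (simp add: I_def lh r p md srt srt2 post frame mid)
        done
    qed (rule d)
  qed
  ultimately have "wp w (While ?b ?c) s (\<lambda>t s'. outputs t = [] \<and> length t \<le> 1 + L * (5 + 1) \<and>
           (\<exists>d. I d s') \<and> \<not> test_holds ?b s')"
    by (rule wp_While_silent)
  then show ?thesis
    apply (rule wp_mono)
    subgoal for t s'
    proof -
      assume H: "outputs t = [] \<and> length t \<le> 1 + L * (5 + 1) \<and>
           (\<exists>d. I d s') \<and> \<not> test_holds ?b s'"
      then obtain d where H': "I d s'" by blast
      then have a: "\<not> reg s' 21 < reg s' 22" "reg s' 21 \<le> reg s' 22"
        "\<forall>t. EB \<le> t \<and> t < reg s' 21 \<longrightarrow> words M ! t < reg s' 20"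
        "\<forall>t. reg s' 22 \<le> t \<and> t < EE \<longrightarrow> reg s' 20 \<le> words M ! t"
        "EB \<le> reg s' 21" "reg s' 22 \<le> EE" and c: "reg s' 20 = c" "same b s s'"
        using H by (auto simp: I_def)
      \<comment> \<open>The cells increase strictly, so the code can occur only where the search
        stopped.\<close>
      have "t = reg s' 21" if "EB \<le> t" "t < EE" "words M ! t = reg s' 20" for t
      proof (rule ccontr)
        assume "t \<noteq> reg s' 21"
        then consider "t < reg s' 21" | "reg s' 21 < t" by linarith
        then show False
        proof cases
          case 2
          then have "words M ! reg s' 21 < words M ! t" using E_sorted a(5) that by blast
          moreover have "reg s' 20 \<le> words M ! reg s' 21" using a 2 that by auto
          ultimately show False using that by simp
        qed (use a(3) that in auto)
      qed
      then have "reg s' 21 < EE \<and> words M ! reg s' 21 = reg s' 20 \<longleftrightarrow>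
            (\<exists>t. EB \<le> t \<and> t < EE \<and> words M ! t = reg s' 20)"
        using a by auto
      with a c H show ?thesis by simp
    qed
    done
qed

end

context search
begin

lemma shorter_range:
  assumes "EB \<le> fst se" "fst se \<le> snd se" "snd se \<le> EE" "p ! j < n"
  shows "EB \<le> fst (shorter p j se) \<and> fst (shorter p j se) \<le> snd (shorter p j se) \<and> snd (shorter p j se) \<le> EE"
  using assms off_range[of "p ! j"] off_range[of "Suc (p ! j)"] off_mono[of "p ! j"]
  by (auto simp: shorter_def)

lemma dyn_range:
  assumes "set p \<subseteq> {..<n}"
  shows "EB \<le> fst (dyn p) \<and> fst (dyn p) \<le> snd (dyn p) \<and> snd (dyn p) \<le> EE"
proof -
  have "EB \<le> fst (fold (shorter p) js se) \<and> fst (fold (shorter p) js se) \<le> snd (fold (shorter p) js se) \<and>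
      snd (fold (shorter p) js se) \<le> EE"
    if "set js \<subseteq> {..<length p}" "EB \<le> fst se" "fst se \<le> snd se" "snd se \<le> EE" for js se
    using that
  proof (induction js arbitrary: se)
    case (Cons j js)
    then have "p ! j < n" using assms by (auto simp: subset_iff)
    then show ?case using Cons shorter_range[of se p j] by simp
  qed simp
  from this[of "nb (length p)" "(EB, EE)"] show ?thesis
    using nb_less E_range unfolding dyn_def by (simp add: subset_iff)
qed

end

context graph_memory
begin

lemma prefix_atD: "prefix_at p s \<Longrightarrow> i < length p \<Longrightarrow> reg s (rv i) = p ! i"
  by (simp add: prefix_at_def)

lemma envD:
  assumes "env s"
  shows "mem s = M" "reg s 1 = 0" "reg s 2 = 1" "reg s 3 = 2" "reg s 4 = n" "reg s 5 = EB"
    "reg s 6 = EE" "reg s 7 = OFF" "reg s 8 = VID" "reg s 15 = 2 * k + 1"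
    "rreg s 0 = x1" "rreg s 1 = x2"
  using assms by (auto simp: env_def)

lemma prefix_env: "prefix_at p s \<Longrightarrow> env s"
  by (simp add: prefix_at_def)

lemma is_check_adj:
  assumes p: "set p \<subseteq> {..<n}" "v < n" and j: "j < length p"
  shows "is_check w (prefix_at (p @ [v])) (43 + 3 * length p) (adj_check (length p) j)
           (adj (p ! j) v) (20 + 6 * L)"
  unfolding is_check_def
proof (intro allI impI)
  let ?i = "length p" let ?b = "43 + 3 * length p" let ?a = "adj (p ! j) v"
  fix body s os T' assume at: "prefix_at (p @ [v]) s" and body: "?a \<longrightarrow> (\<forall>s1. same ?b s s1 \<longrightarrow>
        wp w body s1 (\<lambda>t s'. outputs t = os \<and> length t \<le> T' \<and> same ?b s1 s'))"
  note e = envD[OF prefix_env[OF at]]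
  have r: "reg s (rv j) = p ! j" "reg s (rv ?i) = v"
    using prefix_atD[OF at, of j] prefix_atD[OF at, of ?i] j by (simp_all add: nth_append)
  have pj: "p ! j < n" using p j by (auto simp: subset_iff)
  let ?c = "(p ! j + 1) * n + v"
  have small: "(p ! j + 1) mod 2 ^ w = p ! j + 1" "(p ! j + 1) * n mod 2 ^ w = (p ! j + 1) * n"
    "?c mod 2 ^ w = ?c" "EB mod 2 ^ w = EB" "EE mod 2 ^ w = EE"
  proof -
    have 1: "?c < 2 ^ w" using code_small[OF pj p(2)] .
    have 2: "(p ! j + 1) * n < 2 ^ w" using 1 by linarith
    have "(p ! j + 1) * 1 \<le> (p ! j + 1) * n" using n_pos by (intro mult_left_mono) auto
    then have "p ! j + 1 < 2 ^ w" using 2 by (simp only: mult_1_right)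
    then show "(p ! j + 1) mod 2 ^ w = p ! j + 1" "(p ! j + 1) * n mod 2 ^ w = (p ! j + 1) * n"
      "?c mod 2 ^ w = ?c" using 1 2 by simp_all
    show "EB mod 2 ^ w = EB" "EE mod 2 ^ w = EE" using E_range E_len by (auto intro!: word_small)
  qed
  define s1 where "s1 = s\<lparr>reg := (reg s)(20 := ?c, 21 := EB, 22 := EE)\<rparr>"
  have s1: "env s1" "reg s1 20 = ?c" "reg s1 21 = EB" "reg s1 22 = EE" "same ?b s s1"
    using e by (auto simp: s1_def env_def same_def)
  have adj: "?a \<longleftrightarrow> (\<exists>t. EB \<le> t \<and> t < EE \<and> words M ! t = ?c)"
    by (rule E_adj[OF pj p(2)])
  let ?w = "While (Less 21 22)
         (Seq (Op Plus 23 21 22) (Seq (Op Div 23 23 3) (Seq (Load 24 23)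
           (Cond (Less 24 20) (Op Plus 21 23 2) (Op Plus 22 23 1)))))"
  let ?f = "Cond (Less 21 6) (Seq (Load 24 21) (Cond (Equal 24 20) body Skip)) Skip"
  \<comment> \<open>The five ticks are the assignments that lead from \<open>s\<close> to
    \<open>s1\<close>.\<close>
  have W: "wp w (Seq ?w ?f) s1 (\<lambda>t s2. outputs (Tick # Tick # Tick # Tick # Tick # t) = (if ?a then os else []) \<and>
        length (Tick # Tick # Tick # Tick # Tick # t) \<le> 20 + 6 * L + (if ?a then T' else 0) \<and> same ?b s s2)"
    unfolding wp_Seq[of _ ?w]
  proof (rule wp_mono[OF adj_search[OF s1(1-4), where b = ?b]], elim conjE)
    fix t s2 assume t: "outputs t = []" "length t \<le> 1 + 6 * L" and s2: "same ?b s1 s2" "reg s2 20 = ?c"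
      "EB \<le> reg s2 21" "reg s2 21 \<le> EE"
      and iff: "(reg s2 21 < EE \<and> words M ! reg s2 21 = ?c) =
        (\<exists>t. EB \<le> t \<and> t < EE \<and> words M ! t = ?c)"
    note e2 = envD[OF env_same[OF s1(1) s2(1)]]
    have len: "reg s2 21 < length (words M)" if "reg s2 21 < EE" using that E_range E_len by linarith
    have ss: "same ?b s s2" using s1(5) s2(1) by (rule same_trans)
    let ?s3 = "s2\<lparr>reg := (reg s2)(24 := words M ! reg s2 21)\<rparr>"
    have ss3: "same ?b s ?s3" using ss by (auto simp: same_def)
    show "wp w (Cond (Less 21 6) (Seq (Load 24 21) (Cond (Equal 24 20) body Skip)) Skip) s2
          (\<lambda>t2 s2. outputs (Tick # Tick # Tick # Tick # Tick # t @ t2) = (if ?a then os else []) \<and>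
                length (Tick # Tick # Tick # Tick # Tick # t @ t2)
                \<le> 20 + 6 * L + (if ?a then T' else 0) \<and> same ?b s s2)"
    proof (cases "reg s2 21 < EE \<and> words M ! reg s2 21 = ?c")
      case True
      then have ?a using iff adj by blast
      with body ss3 have "wp w body ?s3 (\<lambda>t s'. outputs t = os \<and> length t \<le> T' \<and> same ?b ?s3 s')"
        by blast
      then have "wp w body ?s3 (\<lambda>t2 s2. outputs t2 = os \<and> length t2 + length t + 8 \<le> 20 + 6 * L + T' \<and>
          same ?b s s2)"
        by (rule wp_mono) (use t ss3 same_trans in auto)
      with True \<open>?a\<close> t s2 e2 len show ?thesis by (auto intro: wp_mono)
    next
      case False
      then have na: "\<not> ?a" using iff adj by blast
      show ?thesis
      proof (cases "reg s2 21 < EE")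
        case True
        then show ?thesis using False na t s2(2) ss3 e2 len by (auto)
      qed (use na t ss e2 in auto)
    qed
  qed
  then show "wp w (adj_check ?i j body) s (\<lambda>t s'. outputs t = (if ?a then os else []) \<and>
           length t \<le> 20 + 6 * L + (if ?a then T' else 0) \<and> same ?b s s')"
    unfolding adj_check_def wp_Seq[of _ "Op _ _ _ _"] wp_Op
    by (simp add: e r small s1_def split del: if_split del: wp_Cond wp_Seq)
qed

lemma is_check_adjs:
  assumes p: "set p \<subseteq> {..<n}" "v < n" and i: "length p < k"
  shows "is_check w (prefix_at (p @ [v])) (43 + 3 * length p)
     (foldr (adj_check (length p)) (nb (length p))) (okv p v) (k * (20 + 6 * L))"
  unfolding okv_def
proof (rule is_check_weaken[OF is_check_foldr])
  show "prefix_at (p @ [v]) s \<Longrightarrow> same (43 + 3 * length p) s s' \<Longrightarrow> prefix_at (p @ [v]) s'" for s s'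
    using prefix_at_same[of "p @ [v]"] by (simp add: algebra_simps)
  show "length (nb (length p)) * (20 + 6 * L) \<le> k * (20 + 6 * L)"
    using nb_length[OF i] by (rule mult_right_mono) simp
qed (use is_check_adj[OF p] nb_less in blast)

definition all_ok :: "nat list \<Rightarrow> bool" where
  "all_ok p \<longleftrightarrow> accepted p \<and> in_range p"

lemma report_loads:
  assumes "prefix_at p s" "length p = k" "set p \<subseteq> {..<n}"
  shows "j \<le> k \<Longrightarrow> (\<forall>i<j. reg s (rid i) = vid (p ! i)) \<Longrightarrow>
    wp w (foldr (\<lambda>i. Seq (Seq (Op Plus 20 8 (rv i)) (Load (rid i) 20))) [j..<k]
       (Report (map (\<lambda>i. rid i) [0..<k]) (map (\<lambda>(j, i). (rid j, rid i)) edge_list))) s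
     (\<lambda>t s'. outputs t = [rep p] \<and> length t \<le> 2 * (k - j) + 2 \<and> same (40 + 3 * k) s s')"
  using assms(1)
proof (induction "k - j" arbitrary: j s)
  case 0
  then have [simp]: "j = k" by simp
  have el: "a < k \<and> b < k" if "(a, b) \<in> set edge_list" for a b
    using that nb_less by (force simp: edge_list_def)
  have "reported_graph (reg s) (map (\<lambda>i. rid i) [0..<k]) (map (\<lambda>(j, i). (rid j, rid i)) edge_list) = rep p"
  proof -
    have "(\<lambda>(a, b). {reg s a, reg s b}) ` (\<lambda>(j, i). (rid j, rid i)) ` set edge_list =
        (\<lambda>(j, i). {vid (p ! j), vid (p ! i)}) ` set edge_list"
      unfolding image_image using 0 el by (intro image_cong) auto
    moreover have "reg s ` (\<lambda>i. rid i) ` {0..<k} = (\<lambda>i. vid (p ! i)) ` {..<k}"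
      unfolding image_image using 0 by (intro image_cong) auto
    ultimately show ?thesis by (simp add: reported_graph_def rep_def)
  qed
  then show ?case by simp
next
  case (Suc m)
  then have j: "j < k" by simp
  note e = envD[OF prefix_env[OF Suc.prems(3)]]
  have r: "reg s (rv j) = p ! j" using prefix_atD[OF Suc.prems(3)] j assms by simp
  have pj: "p ! j < n" using j assms by (auto simp: subset_iff)
  have V: "VID + p ! j < length (words M)" "words M ! (VID + p ! j) = vid (p ! j)"
    using VID[OF pj] by auto
  have sm: "(VID + p ! j) mod 2 ^ w = VID + p ! j" using V by (intro word_small) simp
  let ?s = "s\<lparr>reg := (reg s)(20 := VID + p ! j, rid j := vid (p ! j))\<rparr>"
  have ss: "same (40 + 3 * k) s ?s" by (auto simp: same_def)
  have at: "prefix_at p ?s" using prefix_at_same[of p s ?s] Suc.prems(3) ss assms by simp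
  have reg: "\<forall>i<Suc j. reg ?s (rid i) = vid (p ! i)"
    using Suc.prems(2) by (auto simp: less_Suc_eq)
  have "wp w (foldr (\<lambda>i. Seq (Seq (Op Plus 20 8 (rv i)) (Load (rid i) 20))) [Suc j..<k]
       (Report (map (\<lambda>i. rid i) [0..<k]) (map (\<lambda>(j, i). (rid j, rid i)) edge_list))) ?s
     (\<lambda>t s'. outputs t = [rep p] \<and> length t \<le> 2 * (k - Suc j) + 2 \<and> same (40 + 3 * k) ?s s')"
    using Suc.hyps(2) j by (intro Suc.hyps(1)[OF _ _ reg at]) auto
  then have "wp w (foldr (\<lambda>i. Seq (Seq (Op Plus 20 8 (rv i)) (Load (rid i) 20))) [Suc j..<k]
       (Report (map (\<lambda>i. rid i) [0..<k]) (map (\<lambda>(j, i). (rid j, rid i)) edge_list))) ?s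
     (\<lambda>t s'. outputs t = [rep p] \<and> length t + 2 \<le> 2 * (k - j) + 2 \<and> same (40 + 3 * k) s s')"
    by (rule wp_mono) (use j ss same_trans in auto)
  then show ?case
    using j by (simp add: upt_conv_Cons e r V sm)
qed

lemma is_check_test:
  assumes "\<And>s. P s \<Longrightarrow> test_holds tt s \<longleftrightarrow> ok"
  shows "is_check w P b (\<lambda>c. Cond tt c Skip) ok 2" "is_check w P b (\<lambda>c. Cond tt Skip c) (\<not> ok) 2"
proof -
  have *: "wp w body s (\<lambda>t s'. outputs (Tick # t) = os \<and> length (Tick # t) \<le> 2 + T' \<and> same b s s')"
    if "\<forall>s1. same b s s1 \<longrightarrow> wp w body s1 (\<lambda>t s'. outputs t = os \<and> length t \<le> T' \<and> same b s1 s')"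
    for body s os T'
    by (rule wp_mono[OF that[rule_format, OF same_refl]]) auto
  show "is_check w P b (\<lambda>c. Cond tt c Skip) ok 2" "is_check w P b (\<lambda>c. Cond tt Skip c) (\<not> ok) 2"
    unfolding is_check_def using assms * by auto
qed

lemma final_correct:
  assumes at: "prefix_at p s" and p: "length p = k" "set p \<subseteq> {..<n}"
  shows "wp w final s (\<lambda>t s'. outputs t = (if all_ok p then [rep p] else []) \<and>
     length t \<le> 2 * length ne + 2 * length le + 5 * k + 2 \<and> same (40 + 3 * k) s s')"
proof -
  let ?P = "prefix_at p" let ?b = "40 + 3 * k"
  have P: "?P s \<Longrightarrow> same ?b s s' \<Longrightarrow> ?P s'" for s s'
    using prefix_at_same[of p] p by simp
  have ne: "is_check w ?P ?b (foldr (\<lambda>(i, j) c. Cond (Equal (rv i) (rv j)) Skip c) ne)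
      (\<forall>(i, j)\<in>set ne. p ! i \<noteq> p ! j) (length ne * 2)"
    apply (rule is_check_foldr[OF P], assumption+)
    subgoal for x
      by (cases x, simp) (rule is_check_test(2), use ne_less p in \<open>auto simp: prefix_atD\<close>)
    done
  have le: "is_check w ?P ?b (foldr (\<lambda>(i, j) c. Cond (Less (rv i) (rv j)) c Skip) le)
      (\<forall>(i, j)\<in>set le. p ! i < p ! j) (length le * 2)"
    apply (rule is_check_foldr[OF P], assumption+)
    subgoal for x
      by (cases x, simp) (rule is_check_test(1), use le_less p in \<open>auto simp: prefix_atD\<close>)
    done
  have ra: "is_check w ?P ?b (foldr (\<lambda>i c. Seq (RealLoad 2 (rv i)) (Cond (RealLeq 2 1) c Skip)) [0..<k])
      (\<forall>i\<in>set [0..<k]. att (p ! i) \<le> x2) (length [0..<k] * 3)"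
  proof (rule is_check_foldr[OF P], assumption+)
    fix i assume "i \<in> set [0..<k]"
    then have i: "i < k" by simp
    then have pi: "p ! i < n" using p by (auto simp: subset_iff)
    show "is_check w ?P ?b (\<lambda>c. Seq (RealLoad 2 (rv i)) (Cond (RealLeq 2 1) c Skip)) (att (p ! i) \<le> x2) 3"
      unfolding is_check_def
    proof (intro allI impI)
      fix body s os T'
      assume s: "?P s" and body: "att (p ! i) \<le> x2 \<longrightarrow> (\<forall>s1. same ?b s s1 \<longrightarrow>
        wp w body s1 (\<lambda>t s'. outputs t = os \<and> length t \<le> T' \<and> same ?b s1 s'))"
      note e = envD[OF prefix_env[OF s]]
      have r: "reg s (rv i) = p ! i" using prefix_atD[OF s] i p by simp
      let ?s = "s\<lparr>rreg := (rreg s)(2 := att (p ! i))\<rparr>"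
      have ss: "same ?b s ?s" by (simp add: same_def)
      have "wp w body ?s (\<lambda>t s'. outputs t = os \<and> length t \<le> T' \<and> same ?b s s')"
        if "att (p ! i) \<le> x2" 
        by (rule wp_mono[OF body[rule_format, OF that ss]]) (use ss same_trans in auto)
      then show "wp w (Seq (RealLoad 2 (rv i)) (Cond (RealLeq 2 1) body Skip)) s
        (\<lambda>t s'. outputs t = (if att (p ! i) \<le> x2 then os else []) \<and>
          length t \<le> 3 + (if att (p ! i) \<le> x2 then T' else 0) \<and> same ?b s s')"
        using ss by (auto simp: e r pi reals intro: wp_mono)
    qed
  qed
  have all: "all_ok p \<longleftrightarrow> (\<forall>(i, j)\<in>set ne. p ! i \<noteq> p ! j) \<and> (\<forall>(i, j)\<in>set le. p ! i < p ! j) \<and>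
     (\<forall>i\<in>set [0..<k]. att (p ! i) \<le> x2)"
    by (auto simp: all_ok_def accepted_def in_range_def)
  note chk = is_check_comp[OF P ne is_check_comp[OF P le ra]]
  have "wp w final s (\<lambda>t s'. outputs t = (if all_ok p then [rep p] else []) \<and>
      length t \<le> length ne * 2 + (length le * 2 + length [0..<k] * 3) +
        (if all_ok p then 2 * k + 2 else 0) \<and> same ?b s s')"
    unfolding final_def all
    apply (rule is_checkD[OF chk at], assumption+)
    unfolding report_embedding_def
    by (rule wp_mono[OF report_loads[OF P[OF at] p, where j = 0]]) auto
  then show ?thesis by (rule wp_mono) (auto split: if_splits)
qed

lemma shorter_row_correct:
  assumes at: "prefix_at p s" and p: "set p \<subseteq> {..<n}" and j: "j < length p"
    and se: "reg s (rs (length p)) = fst se" "reg s (re (length p)) = snd se"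
      "EB \<le> fst se" "fst se \<le> snd se" "snd se \<le> EE"
  shows "wp w (shorter_row (length p) j) s (\<lambda>t s'. outputs t = [] \<and> length t \<le> 9 \<and>
     same (40 + 3 * length p) s s' \<and> reg s' (rs (length p)) = fst (shorter p j se) \<and>
     reg s' (re (length p)) = snd (shorter p j se))"
proof -
  note e = envD[OF prefix_env[OF at]]
  have r: "reg s (rv j) = p ! j" using prefix_atD[OF at j] .
  have pj: "p ! j < n" using p j by (auto simp: subset_iff)
  have O: "OFF + p ! j < length (words M)" "words M ! (OFF + p ! j) = off (p ! j)"
      "OFF + p ! j + 1 < length (words M)" "words M ! (OFF + p ! j + 1) = off (Suc (p ! j))"
    using OFF[of "p ! j"] OFF[of "Suc (p ! j)"] pj by (auto simp: One_nat_def)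
  have R: "off (p ! j) \<le> EE" "off (Suc (p ! j)) \<le> EE"
    using off_range[of "p ! j"] off_range[of "Suc (p ! j)"] pj by auto
  have sm: "(OFF + p ! j) mod 2 ^ w = OFF + p ! j" "(OFF + p ! j + 1) mod 2 ^ w = OFF + p ! j + 1"
    "(off (Suc (p ! j)) - off (p ! j)) mod 2 ^ w = off (Suc (p ! j)) - off (p ! j)"
    "(snd se - fst se) mod 2 ^ w = snd se - fst se"
    "off (p ! j) mod 2 ^ w = off (p ! j)" "off (Suc (p ! j)) mod 2 ^ w = off (Suc (p ! j))"
    using O R se E_range E_len by (intro word_small; linarith)+
  show ?thesis unfolding shorter_row_def
    by (simp add: e r O sm se shorter_def) (simp add: same_def)
qed

lemma choose_row_correct:
  assumes at: "prefix_at p s" and p: "set p \<subseteq> {..<n}" and i: "length p < k"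
  shows "wp w (choose_row (length p)) s (\<lambda>t s'. outputs t = [] \<and> length t \<le> 9 * k + 3 \<and>
     same (40 + 3 * length p) s s' \<and> reg s' (rs (length p)) = fst (dyn p) \<and>
     reg s' (re (length p)) = snd (dyn p))"
proof -
  let ?i = "length p" let ?b = "40 + 3 * length p"
  have fold: "wp w (foldr (\<lambda>j. Seq (shorter_row ?i j)) js Skip) s (\<lambda>t s'. outputs t = [] \<and>
      length t \<le> 9 * length js + 1 \<and> same ?b s s' \<and>
      reg s' (rs ?i) = fst (fold (shorter p) js se) \<and> reg s' (re ?i) = snd (fold (shorter p) js se))"
    if "set js \<subseteq> {..<?i}" "prefix_at p s" "reg s (rs ?i) = fst se" "reg s (re ?i) = snd se"
      "EB \<le> fst se" "fst se \<le> snd se" "snd se \<le> EE" for js s se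
    using that
  proof (induction js arbitrary: s se)
    case (Cons j js)
    then have j: "j < ?i" by simp
    then have pj: "p ! j < n" using p by (auto simp: subset_iff)
    show ?case
      apply (simp del: fold_simps)
      apply (rule wp_mono[OF shorter_row_correct[OF Cons.prems(2) p j Cons.prems(3-7)]])
      apply (elim conjE)
      subgoal for t s1
        apply (rule wp_mono[OF Cons.IH[where s = s1 and se = "shorter p j se"]])
        using Cons.prems shorter_range[OF Cons.prems(5-7) pj] by (auto intro: prefix_at_same same_trans)
      done
  qed auto
  note e = envD[OF prefix_env[OF at]]
  let ?s = "s\<lparr>reg := (reg s)(rs ?i := EB, re ?i := EE)\<rparr>"
  have ss: "same ?b s ?s" by (simp add: same_def)
  have sm: "EB mod 2 ^ w = EB" "EE mod 2 ^ w = EE" using E_range E_len by (auto intro!: word_small)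
  have js: "set (nb ?i) \<subseteq> {..<?i}" using nb_less by auto
  have nbl: "length (nb ?i) \<le> k" using nb_length[OF i] .
  show ?thesis
    unfolding choose_row_def
    apply (simp add: e sm)
    apply (rule wp_mono[OF fold[OF js prefix_at_same[OF at ss], where se = "(EB, EE)"]])
    using nbl E_range E_len ss by (auto simp: dyn_def intro: same_trans)
qed

text \<open>The time paid by one unit of \<open>steps\<close>: it covers a candidate with its at
  most \<open>k\<close> adjacency tests, the choice of a row at an inner node, and the final tests
  with the report at a leaf.\<close>

definition unit_time :: nat where
  "unit_time = (20 + 6 * L) * (k + 1) + 20 * k + 2 * length ne + 2 * length le + 20"

lemma rng_range:
  assumes "box_ok b" "set p \<subseteq> {..<n}"
  shows "EB \<le> fst (rng b p) \<and> fst (rng b p) \<le> snd (rng b p) \<and> snd (rng b p) \<le> EE"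
proof (cases "length p < length b")
  case True
  then have "b ! length p \<in> set b" by simp
  then show ?thesis using assms(1) True unfolding box_ok_def rng_def by fastforce
qed (simp add: rng_def dyn_range assms(2))

lemma load_range:
  assumes at: "prefix_at p s" and p: "set p \<subseteq> {..<n}" and i: "length p < k" and b: "box_at (reg s 10) b"
  shows "wp w (Seq (Const 20 (1 + 2 * length p)) (Seq (Op Plus 20 20 10) (Seq (Load (rs (length p)) 20)
     (Seq (Op Plus 20 20 2) (Seq (Load (re (length p)) 20)
     (Cond (Less (rs (length p)) (re (length p))) Skip (choose_row (length p)))))))) s
     (\<lambda>t s'. outputs t = [] \<and> length t \<le> 9 * k + 9 \<and>
     same (40 + 3 * length p) s s' \<and> reg s' (rs (length p)) = fst (rng b p) \<and>
     reg s' (re (length p)) = snd (rng b p))"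
proof -
  note e = envD[OF prefix_env[OF at]]
  let ?i = "length p" let ?a = "reg s 10"
  define c f0 f1 where "c = 1 + 2 * ?i" and "f0 = (if ?i < length b then fst (b ! ?i) else 0)"
    and "f1 = (if ?i < length b then snd (b ! ?i) else 0)"
  have A: "words M ! (c + ?a) = f0" "words M ! (c + ?a + 1) = f1"
  proof -
    have "c + ?a = ?a + 1 + 2 * ?i" "c + ?a + 1 = ?a + 2 + 2 * ?i" by (simp_all add: c_def)
    then show "words M ! (c + ?a) = f0" "words M ! (c + ?a + 1) = f1"
      using b i unfolding box_at_def f0_def f1_def by presburger+
  qed
  have "?a + 2 * k < length (words M)" using b by (simp add: box_at_def)
  then have len: "c + ?a < length (words M)" "c + ?a + 1 < length (words M)"
    using i unfolding c_def by linarith+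
  then have sm: "c mod 2 ^ w = c" "(c + ?a) mod 2 ^ w = c + ?a" "(c + ?a + 1) mod 2 ^ w = c + ?a + 1"
    by (intro word_small; linarith)+
  define s1 where "s1 = s\<lparr>reg := (reg s)(20 := c + ?a + 1, rs ?i := f0, re ?i := f1)\<rparr>"
  have ss: "same (40 + 3 * ?i) s s1" by (simp add: same_def s1_def)
  note at1 = prefix_at_same[OF at ss]
  have "wp w (Cond (Less (rs ?i) (re ?i)) Skip (choose_row ?i)) s1
     (\<lambda>t s'. outputs t = [] \<and> length t + 5 \<le> 9 * k + 9 \<and>
     same (40 + 3 * ?i) s s' \<and> reg s' (rs ?i) = fst (rng b p) \<and> reg s' (re ?i) = snd (rng b p))"
  proof (cases "?i < length b")
    case True
    then have "b ! ?i \<in> set b" by simp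
    then have "fst (b ! ?i) < snd (b ! ?i)"
      using b True unfolding box_at_def box_ok_def by fastforce
    then show ?thesis using True ss by (simp add: rng_def s1_def f0_def f1_def)
  next
    case False
    have "wp w (choose_row ?i) s1 (\<lambda>t s'. outputs (Tick # t) = [] \<and> length (Tick # t) + 5 \<le> 9 * k + 9 \<and>
     same (40 + 3 * ?i) s s' \<and> reg s' (rs ?i) = fst (rng b p) \<and> reg s' (re ?i) = snd (rng b p))"
      by (rule wp_mono[OF choose_row_correct[OF at1 p i]])
        (use False ss in \<open>auto simp: rng_def intro: same_trans\<close>)
    then show ?thesis using False by (simp add: s1_def f0_def f1_def)
  qed
  then have "wp w (Cond (Less (rs ?i) (re ?i)) Skip (choose_row ?i)) s1
     (\<lambda>t s'. outputs (Tick # Tick # Tick # Tick # Tick # t) = [] \<and>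
      length (Tick # Tick # Tick # Tick # Tick # t) \<le> 9 * k + 9 \<and>
     same (40 + 3 * ?i) s s' \<and> reg s' (rs ?i) = fst (rng b p) \<and> reg s' (re ?i) = snd (rng b p))"
    by (rule wp_mono) auto
  then show ?thesis
    unfolding c_def[symmetric]
    by (simp add: e sm len A s1_def fun_upd_twist[of 20 "41 + 3 * length p"] del: wp_Cond)
qed

lemma enum_correct:
  assumes "prefix_at p s" "set p \<subseteq> {..<n}" "length p + r = k" "box_at (reg s 10) b"
  shows "wp w (enum r) s (\<lambda>t s'. outputs t = map rep (filter all_ok (leaves b r p)) \<and>
     length t \<le> unit_time * steps b r p \<and> same (40 + 3 * length p) s s')"
  using assms
proof (induction r arbitrary: p s)
  case 0
  then have p: "length p = k" by simp
  show ?case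
    unfolding enum.simps leaves.simps steps.simps
    by (rule wp_mono[OF final_correct[OF 0(1) p 0(2)]]) (auto simp: unit_time_def p)
next
  case (Suc r)
  let ?i = "length p" let ?b = "40 + 3 * length p" let ?U = unit_time
  have i: "k - Suc r = ?i" "?i < k" using Suc.prems(3) by linarith+
  define s0 e0 where "s0 = fst (rng b p)" and "e0 = snd (rng b p)"
  have bok: "box_ok b" using Suc.prems(4) by (simp add: box_at_def)
  have se: "EB \<le> s0" "s0 \<le> e0" "e0 \<le> EE"
    using rng_range[OF bok Suc.prems(2)] by (auto simp: s0_def e0_def)
  define v where "v t = val (s0 + t)" for t
  define os where "os t = (if okv p (v t) then map rep (filter all_ok (leaves b r (p @ [v t]))) else [])" for t
  define T where "T t = (4 + k * (20 + 6 * L)) + (if okv p (v t) then ?U * steps b r (p @ [v t]) else 0)" for t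
  define body where "body = Seq (Load 20 (rs ?i)) (Seq (Op Mod (rv ?i) 20 4)
         (Seq (foldr (adj_check ?i) (nb ?i) (enum r)) (Op Plus (rs ?i) (rs ?i) 2)))"
  define I where "I t s' \<longleftrightarrow> same ?b s s' \<and> reg s' (rs ?i) = s0 + t \<and> reg s' (re ?i) = e0 \<and> t \<le> e0 - s0" for t s'
  have loop: "wp w (While (Less (rs ?i) (re ?i)) body) s1
     (\<lambda>t s'. outputs t = concat (map os [0..<e0 - s0]) \<and>
           length t \<le> 1 + (\<Sum>t\<leftarrow>[0..<e0 - s0]. T t + 1) \<and> I (e0 - s0) s')"
    if "I 0 s1" for s1
  proof (rule wp_While_for[where I = I, OF that])
    fix t s' assume t: "t < e0 - s0" and I: "I t s'"
    then have ss: "same ?b s s'" and R: "reg s' (rs ?i) = s0 + t" "reg s' (re ?i) = e0"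
      by (auto simp: I_def)
    note at = prefix_at_same[OF Suc.prems(1) ss]
    note e = envD[OF prefix_env[OF at]]
    have len: "s0 + t < length (words M)" using t se E_range E_len by linarith
    have sm: "(s0 + t + 1) mod 2 ^ w = s0 + t + 1" "v t mod 2 ^ w = v t"
    proof -
      show "(s0 + t + 1) mod 2 ^ w = s0 + t + 1" using len by (intro word_small) linarith
      have "v t < length (words M)" using val_less[of "s0 + t"] E_range E_len unfolding v_def by linarith
      then show "v t mod 2 ^ w = v t" by (intro word_small) linarith
    qed
    define s2 where "s2 = s'\<lparr>reg := (reg s')(20 := words M ! (s0 + t), rv ?i := v t)\<rparr>"
    have s2: "same ?b s' s2" by (simp add: s2_def same_def)
    have at2: "prefix_at (p @ [v t]) s2"
      using prefix_at_same[OF at s2] by (auto simp: prefix_at_def nth_append s2_def)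
    have R2: "reg s2 (rs ?i) = s0 + t" "reg s2 (re ?i) = e0" using R by (simp_all add: s2_def)
    have pv: "set (p @ [v t]) \<subseteq> {..<n}" using Suc.prems(2) by (simp add: v_def)
    have chk: "wp w (foldr (adj_check ?i) (nb ?i) (enum r)) s2 (\<lambda>t' s'. outputs t' = os t \<and>
        length t' \<le> k * (20 + 6 * L) + (if okv p (v t) then ?U * steps b r (p @ [v t]) else 0) \<and>
        same (43 + 3 * ?i) s2 s')"
      unfolding os_def
    proof (rule is_checkD[OF is_check_adjs[OF Suc.prems(2) _ i(2)] at2])
      show "v t < n" by (simp add: v_def)
      fix s3 assume s3: "same (43 + 3 * ?i) s2 s3"
      have b3: "40 + 3 * length (p @ [v t]) = 43 + 3 * ?i" by simp
      have at3: "prefix_at (p @ [v t]) s3" using prefix_at_same[OF at2] s3 b3 by metis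
      have "reg s3 10 = reg s 10" using s3 s2 ss by (simp add: same_def)
      then have bx: "box_at (reg s3 10) b" using Suc.prems(4) by simp
      have l: "length (p @ [v t]) + r = k" using Suc.prems(3) by simp
      show "wp w (enum r) s3 (\<lambda>t' s'. outputs t' = map rep (filter all_ok (leaves b r (p @ [v t]))) \<and>
         length t' \<le> ?U * steps b r (p @ [v t]) \<and> same (43 + 3 * ?i) s3 s')"
        using Suc.IH[OF at3 pv l bx] by (simp add: b3)
    qed
    have fin: "wp w (Seq (foldr (adj_check ?i) (nb ?i) (enum r)) (Op Plus (rs ?i) (rs ?i) 2)) s2
      (\<lambda>t' s'. outputs t' = os t \<and> length t' + 2 \<le> T t \<and> I (Suc t) s')"
      unfolding wp_Seq
    proof (rule wp_mono[OF chk], elim conjE)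
      fix t' s3 assume a: "outputs t' = os t"
        "length t' \<le> k * (20 + 6 * L) + (if okv p (v t) then ?U * steps b r (p @ [v t]) else 0)"
        "same (43 + 3 * ?i) s2 s3"
      have "same ?b s2 s3" using a(3) by (rule same_mono) simp
      then have "same ?b s s3" using ss s2 same_trans by blast
      moreover have "reg s3 (rs ?i) = s0 + t" "reg s3 (re ?i) = e0" using a(3) R2 by (simp_all add: same_def)
      moreover have "reg s3 2 = 1" using a(3) e s2 by (simp add: same_def)
      ultimately show "wp w (Op Plus (rs ?i) (rs ?i) 2) s3
          (\<lambda>t2 s2. outputs (t' @ t2) = os t \<and> length (t' @ t2) + 2 \<le> T t \<and> I (Suc t) s2)"
        using a t sm by (auto simp: I_def T_def) (simp add: same_def)
    qed
    have vt: "words M ! (s0 + t) mod n = v t" using E_val[of "s0 + t"] t se by (simp add: v_def)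
    have fin': "wp w (Seq (foldr (adj_check ?i) (nb ?i) (enum r)) (Op Plus (rs ?i) (rs ?i) 2)) s2
      (\<lambda>t' s'. outputs (Tick # Tick # t') = os t \<and> length (Tick # Tick # t') \<le> T t \<and> I (Suc t) s')"
      by (rule wp_mono[OF fin]) simp
    have "wp w body s' (\<lambda>t' s'. outputs t' = os t \<and> length t' \<le> T t \<and> I (Suc t) s')"
      unfolding body_def wp_Seq[of _ "Load _ _"] wp_Seq[of _ "Op _ _ _ _"] wp_Load wp_Op
      using fin' by (simp add: e R len sm(2) vt s2_def del: wp_Seq wp_Op)
    then show "test_holds (Less (rs ?i) (re ?i)) s' \<and>
           wp w body s' (\<lambda>t' s'. outputs t' = os t \<and> length t' \<le> T t \<and> I (Suc t) s')"
      using t R by simp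
  next
    show "I (e0 - s0) s' \<Longrightarrow> \<not> test_holds (Less (rs ?i) (re ?i)) s'" for s'
      using se by (simp add: I_def)
  qed
  \<comment> \<open>The loop counts rounds from zero, \<open>leaves\<close> and \<open>steps\<close>
    run over addresses.\<close>
  have shift: "map (\<lambda>t. f (s0 + t)) [0..<e0 - s0] = map f [s0..<e0]" for f :: "nat \<Rightarrow> 'z"
    using se by (intro nth_equalityI) auto
  have outs: "concat (map os [0..<e0 - s0]) = map rep (filter all_ok (leaves b (Suc r) p))"
  proof -
    have "concat (map os [0..<e0 - s0]) =
       concat (map (\<lambda>t. map rep (filter all_ok (if okv p (val t) then leaves b r (p @ [val t]) else []))) [s0..<e0])"
      unfolding shift[symmetric] by (intro arg_cong[where f = concat] map_cong) (auto simp: os_def v_def)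
    then show ?thesis
      by (simp add: s0_def e0_def map_concat filter_concat comp_def)
  qed
  have U: "9 * k + 9 + 1 \<le> ?U" "4 + k * (20 + 6 * L) + 1 \<le> ?U"
    by (auto simp: unit_time_def algebra_simps)
  have "(\<Sum>t\<leftarrow>[0..<e0 - s0]. T t + 1) \<le>
     (\<Sum>t\<leftarrow>[0..<e0 - s0]. ?U * (1 + (if okv p (v t) then steps b r (p @ [v t]) else 0)))"
    by (intro sum_list_mono) (use U in \<open>auto simp: T_def distrib_left\<close>)
  also have "\<dots> = ?U * (\<Sum>t\<leftarrow>[s0..<e0]. 1 + (if okv p (val t) then steps b r (p @ [val t]) else 0))"
    unfolding shift[of "\<lambda>t. 1 + (if okv p (val t) then steps b r (p @ [val t]) else 0)", symmetric]
      sum_list_const_mult v_def ..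
  finally have time: "9 * k + 9 + (1 + (\<Sum>t\<leftarrow>[0..<e0 - s0]. T t + 1)) \<le> ?U * steps b (Suc r) p"
    using U(1) by (simp add: s0_def e0_def algebra_simps)
  have lev: "wp w (level ?i (enum r)) s Q \<longleftrightarrow>
    wp w (Seq (Const 20 (1 + 2 * length p)) (Seq (Op Plus 20 20 10) (Seq (Load (rs (length p)) 20)
     (Seq (Op Plus 20 20 2) (Seq (Load (re (length p)) 20)
     (Cond (Less (rs (length p)) (re (length p))) Skip (choose_row (length p)))))))) s
      (\<lambda>t s1. wp w (While (Less (rs ?i) (re ?i)) body) s1 (\<lambda>t' s'. Q (t @ t') s'))" for Q
    by (simp only: level_def body_def wp_Seq append_assoc)
  show ?case
    unfolding enum.simps i(1) lev
  proof (rule wp_mono[OF load_range[OF Suc.prems(1,2) i(2) Suc.prems(4)]], elim conjE)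
    fix t s1 assume a: "outputs t = []" "length t \<le> 9 * k + 9" "same ?b s s1"
      "reg s1 (rs ?i) = fst (rng b p)" "reg s1 (re ?i) = snd (rng b p)"
    then have "I 0 s1" by (simp add: I_def s0_def e0_def)
    show "wp w (While (Less (rs ?i) (re ?i)) body) s1
         (\<lambda>t' s'. outputs (t @ t') = map rep (filter all_ok (leaves b (Suc r) p)) \<and>
            length (t @ t') \<le> ?U * steps b (Suc r) p \<and> same ?b s s')"
      by (rule wp_mono[OF loop[OF \<open>I 0 s1\<close>]]) (use a time outs in \<open>auto simp: I_def simp del: leaves.simps steps.simps\<close>)
  qed
qed

end

section \<open>Scanning the boxes\<close>

text \<open>The upper bound of a binary search on \<open>[lo, hi)\<close> at the moment its midpoint is \<open>r\<close>; the list stored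
  for \<open>r\<close> covers the first ranks from \<open>r\<close> to this bound.\<close>

fun bound_in :: "nat \<Rightarrow> nat \<Rightarrow> nat \<Rightarrow> nat \<Rightarrow> nat" where
  "bound_in 0 lo hi r = hi"
| "bound_in (Suc d) lo hi r =
    (let mid = (lo + hi) div 2 in
     if r < mid then bound_in d lo mid r else if r = mid then hi else bound_in d (mid + 1) hi r)"

context pattern
begin

text \<open>Keys are sorted, so an out-of-range key ends the whole list: register 10 jumps to the
  end.\<close>

definition scan :: com where
  "scan = While (Less 10 11) (Seq (Load 20 10) (Seq (RealLoad 2 20)
     (Cond (RealLeq 2 1) (Seq (enum k) (Op Plus 10 10 15)) (Op Plus 10 11 1))))"

text \<open>When the midpoint qualifies, all ranks from it to the current upper bound qualify and
  are served by the one list stored for the midpoint; the search continues to its left. The ranks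
  with attribute at least \<open>x1\<close> thus become a disjoint union of stored ranges.\<close>

definition walk :: com where
  "walk = While (Less 12 13)
     (Seq (Op Plus 14 12 13) (Seq (Op Div 14 14 3) (Seq (RealLoad 2 14) (Cond (RealLeq 0 2)
       (Seq (Op Plus 20 9 14) (Seq (Load 10 20) (Seq (Op Plus 20 20 2) (Seq (Load 11 20)
         (Seq scan (Op Plus 13 14 1))))))
       (Op Plus 12 14 2)))))"

definition list_from :: "nat \<Rightarrow> com" where
  "list_from a = Seq (Const 20 a) (Seq (Load 9 20) (Seq (Op Plus 12 1 1) (Seq (Op Plus 13 4 1) walk)))"

end

text \<open>The coarser frame of the outer loops: the search may have overwritten any register from
  20 on, and \<open>X\<close> lists the control registers that may change.\<close>

definition same_outer :: "nat set \<Rightarrow> state \<Rightarrow> state \<Rightarrow> bool" where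
  "same_outer X s s' \<longleftrightarrow> mem s' = mem s \<and> rreg s' 0 = rreg s 0 \<and> rreg s' 1 = rreg s 1 \<and>
     (\<forall>r. r < 20 \<and> r \<notin> X \<longrightarrow> reg s' r = reg s r)"

lemma same_outer_refl [simp]: "same_outer X s s"
  by (simp add: same_outer_def)

lemma same_outer_trans: "same_outer X s s' \<Longrightarrow> same_outer X s' s'' \<Longrightarrow> same_outer X s s''"
  by (simp add: same_outer_def)

lemma same_outer_mono: "same_outer X s s' \<Longrightarrow> X \<subseteq> Y \<Longrightarrow> same_outer Y s s'"
  by (auto simp: same_outer_def)

lemma same_outerD: "same_outer X s s' \<Longrightarrow> r < 20 \<Longrightarrow> r \<notin> X \<Longrightarrow> reg s' r = reg s r"
  by (simp add: same_outer_def)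

section \<open>Cutting at the root rank; correctness of the scan and of the walk\<close>

context search
begin

definition root_leaves :: "nat \<Rightarrow> nat \<Rightarrow> nat list list" where
  "root_leaves l h = leaves [(EB + l, EB + h)] k []"

lemma leaves_beyond: "length b \<le> length p \<Longrightarrow> leaves b r p = leaves [] r p"
  by (induction r arbitrary: p) (simp_all add: rng_def cong: map_cong if_cong)

lemma steps_beyond: "length b \<le> length p \<Longrightarrow> steps b r p = steps [] r p"
  by (induction r arbitrary: p) (simp_all add: rng_def cong: map_cong if_cong)

lemma root_leaves_append: "l \<le> m \<Longrightarrow> m \<le> h \<Longrightarrow> root_leaves l h = root_leaves l m @ root_leaves m h"
proof -
  assume a: "l \<le> m" "m \<le> h"
  obtain r where r: "k = Suc r" using k_pos by (cases k) auto
  have "[EB + l..<EB + h] = [EB + l..<EB + m] @ [EB + m..<EB + h]"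
    using a by (metis add_le_cancel_left le_add_diff_inverse upt_add_eq_append)
  then show ?thesis
    unfolding root_leaves_def unfolding r by (simp add: rng_def leaves_beyond[of "[x]" for x] cong: map_cong if_cong)
qed

lemma root_leaves_empty [simp]: "root_leaves l l = []"
proof -
  obtain r where r: "k = Suc r" using k_pos by (cases k) auto
  show ?thesis unfolding root_leaves_def unfolding r by (simp add: rng_def)
qed

end

context graph_memory
begin

lemma env_outer: "env s \<Longrightarrow> same_outer X s s' \<Longrightarrow> X \<subseteq> {9..14} \<Longrightarrow> env s'"
proof -
  assume a: "env s" "same_outer X s s'" "X \<subseteq> {9..14}"
  have "r \<notin> X" if "r < 9 \<or> r = 15" for r using a(3) that by auto
  then have "reg s' r = reg s r" if "r < 9 \<or> r = 15" for r
    using a(2) that unfolding same_outer_def by auto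
  then show ?thesis using a(1,2) unfolding env_def same_outer_def by simp
qed

definition found :: "(nat \<times> nat) list \<Rightarrow> nat list list" where
  "found b = filter all_ok (leaves b k [])"

definition boxes_at :: "nat \<Rightarrow> (nat \<times> (nat \<times> nat) list) list \<Rightarrow> bool" where
  "boxes_at a bs \<longleftrightarrow> a + (2 * k + 1) * length bs \<le> length (words M) \<and>
     (\<forall>i<length bs. words M ! (a + (2 * k + 1) * i) = fst (bs ! i) \<and> fst (bs ! i) < n \<and>
        box_at (a + (2 * k + 1) * i) (snd (bs ! i)))"

lemma boxes_at_Cons: "boxes_at a (x # bs) \<longleftrightarrow>
    words M ! a = fst x \<and> fst x < n \<and> box_at a (snd x) \<and> boxes_at (a + (2 * k + 1)) bs"
  unfolding boxes_at_def length_Cons All_less_Suc2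
  by (auto simp: algebra_simps)

text \<open>The equivalence between a nonempty box and a key in range is used in both directions: a
  searched box has an output, which paces the trace, and the first failing key shows, by sortedness,
  that the remaining boxes are empty for this query.\<close>

lemma scan_correct:
  assumes "env s" "reg s 10 = a" "reg s 11 = a + (2 * k + 1) * length bs" "boxes_at a bs"
    and "sorted_wrt (\<lambda>x y. att (fst x) \<le> att (fst y)) bs"
    and "\<And>x. x \<in> set bs \<Longrightarrow> (found (snd x) \<noteq> [] \<longleftrightarrow> att (fst x) \<le> x2) \<and> steps (snd x) k [] \<le> B"
  shows "wp w scan s (\<lambda>t s'. outputs t = map rep (concat (map (\<lambda>x. found (snd x)) bs)) \<and>
     paced (unit_time * B + 10) t \<and> same_outer {10, 11} s s')"
  using assms
proof (induction bs arbitrary: a s)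
  case Nil
  then show ?case unfolding scan_def by (subst wp_While) (auto intro: paced_short)
next
  case (Cons x bs)
  note e = envD[OF Cons.prems(1)]
  have x: "words M ! a = fst x" "fst x < n" "box_at a (snd x)" "boxes_at (a + (2 * k + 1)) bs"
    using Cons.prems(4) by (auto simp: boxes_at_Cons)
  have len: "a < length (words M)" "a + (2 * k + 1) * length (x # bs) \<le> length (words M)"
    using Cons.prems(4) x(3) by (auto simp: boxes_at_def box_at_def)
  then have sm: "(a + (2 * k + 1) * length (x # bs)) mod 2 ^ w = a + (2 * k + 1) * length (x # bs)"
    "(a + (2 * k + 1)) mod 2 ^ w = a + (2 * k + 1)"
    by (intro word_small, simp)+
  have lt: "a < a + (2 * k + 1) * length (x # bs)" by simp
  define s1 where "s1 = s\<lparr>reg := (reg s)(20 := fst x), rreg := (rreg s)(2 := att (fst x))\<rparr>"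
  have s1: "env s1" "reg s1 10 = a" "reg s1 11 = a + (2 * k + 1) * length (x # bs)"
    "same_outer {10, 11} s s1" "rreg s1 2 = att (fst x)" "rreg s1 1 = x2"
    using Cons.prems(1-3) by (auto simp: s1_def env_def same_outer_def)
  let ?body = "Seq (Load 20 10) (Seq (RealLoad 2 20)
     (Cond (RealLeq 2 1) (Seq (enum k) (Op Plus 10 10 15)) (Op Plus 10 11 1)))"
  have step: "wp w scan s Q \<longleftrightarrow> wp w (Cond (RealLeq 2 1) (Seq (enum k) (Op Plus 10 10 15)) (Op Plus 10 11 1)) s1
      (\<lambda>t s2. wp w scan s2 (\<lambda>t' s'. Q (Tick # Tick # Tick # t @ t') s'))" for Q
    unfolding scan_def
    apply (subst wp_While)
    apply (simp only: wp_Seq[of _ "Load _ _"] wp_Seq[of _ "RealLoad _ _"] wp_Load wp_RealLoad)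
    apply (simp add: Cons.prems(2,3) e len x reals lt s1_def del: wp_Cond wp_Seq)
    done
  show ?case
  proof (cases "att (fst x) \<le> x2")
    case True
    have at: "prefix_at [] s1" using s1(1) by (simp add: prefix_at_def)
    have bx: "box_at (reg s1 10) (snd x)" using x(3) s1(2) by simp
    have fnd: "found (snd x) \<noteq> []" "steps (snd x) k [] \<le> B" using Cons.prems(6)[of x] True by auto
    have "wp w (enum k) s1 (\<lambda>t s'. outputs t = map rep (found (snd x)) \<and> length t \<le> unit_time * B \<and> same 40 s1 s')"
      using enum_correct[OF at _ _ bx, of k]
      by (rule wp_mono) (use fnd in \<open>auto simp: found_def elim!: order_trans\<close>)
    then have en: "wp w (Seq (enum k) (Op Plus 10 10 15)) s1 (\<lambda>t s'. outputs t = map rep (found (snd x)) \<and>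
        length t \<le> unit_time * B + 1 \<and> same_outer {10, 11} s1 s' \<and> reg s' 10 = a + (2 * k + 1) \<and>
        reg s' 11 = a + (2 * k + 1) * length (x # bs))"
      unfolding wp_Seq
    proof (rule wp_mono, elim conjE)
      fix t s' assume a: "outputs t = map rep (found (snd x))" "length t \<le> unit_time * B" "same 40 s1 s'"
      then have "reg s' 10 = a" "reg s' 15 = 2 * k + 1" "reg s' 11 = a + (2 * k + 1) * length (x # bs)"
        using s1(2,3) envD(10)[OF s1(1)] by (simp_all add: same_def)
      then show "wp w (Op Plus 10 10 15) s' (\<lambda>t2 s2. outputs (t @ t2) = map rep (found (snd x)) \<and>
        length (t @ t2) \<le> unit_time * B + 1 \<and> same_outer {10, 11} s1 s2 \<and> reg s2 10 = a + (2 * k + 1) \<and>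
        reg s2 11 = a + (2 * k + 1) * length (x # bs))"
        using a sm by (simp add: same_def same_outer_def)
    qed
    show ?thesis
      unfolding step
      apply (simp only: wp_Cond)
      apply (simp only: test_holds.simps s1(5,6) True if_True)
      apply (rule wp_mono[OF en], elim conjE)
    proof -
      fix t s' assume a: "outputs t = map rep (found (snd x))" "length t \<le> unit_time * B + 1"
        "same_outer {10, 11} s1 s'" "reg s' 10 = a + (2 * k + 1)"
        "reg s' 11 = a + (2 * k + 1) * length (x # bs)"
      have 1: "env s'" using env_outer[OF s1(1) a(3)] by simp
      have 2: "reg s' 11 = a + (2 * k + 1) + (2 * k + 1) * length bs" using a(5) by simp
      have 3: "sorted_wrt (\<lambda>x y. att (fst x) \<le> att (fst y)) bs" using Cons.prems(5) by simp
      show "wp w scan s' (\<lambda>t' s'. outputs (Tick # Tick # Tick # (Tick # t) @ t') =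
             map rep (concat (map (\<lambda>x. found (snd x)) (x # bs))) \<and>
             paced (unit_time * B + 10) (Tick # Tick # Tick # (Tick # t) @ t') \<and> same_outer {10, 11} s s')"
      proof (rule wp_mono[OF Cons.IH[OF 1 a(4) 2 x(4) 3]])
        show "y \<in> set bs \<Longrightarrow> (found (snd y) \<noteq> [] \<longleftrightarrow> att (fst y) \<le> x2) \<and> steps (snd y) k [] \<le> B" for y
          using Cons.prems(6) by simp
        fix t' s'' assume b: "outputs t' = map rep (concat (map (\<lambda>x. found (snd x)) bs)) \<and>
          paced (unit_time * B + 10) t' \<and> same_outer {10, 11} s' s''"
        \<comment> \<open>\<open>found (snd x)\<close> is nonempty, so this block contains an
          output.\<close>
        have "paced (unit_time * B + 10) ((Tick # Tick # Tick # Tick # t) @ t')"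
          by (rule paced_append) (use a b fnd in auto)
        then show "outputs (Tick # Tick # Tick # (Tick # t) @ t') =
             map rep (concat (map (\<lambda>x. found (snd x)) (x # bs))) \<and>
             paced (unit_time * B + 10) (Tick # Tick # Tick # (Tick # t) @ t') \<and> same_outer {10, 11} s s''"
          using a b s1(4) same_outer_trans by auto
      qed
    qed
  next
    case False
    have "found (snd y) = []" if "y \<in> set (x # bs)" for y
    proof -
      have "att (fst x) \<le> att (fst y)" using that Cons.prems(5) by auto
      then show ?thesis using False Cons.prems(6)[OF that] by auto
    qed
    then have nil: "concat (map (\<lambda>x. found (snd x)) (x # bs)) = []" by auto
    have end_scan: "wp w scan s2 Q = Q [Tick] s2" if "reg s2 10 = reg s2 11" for s2 Q
      unfolding scan_def using that by (subst wp_While) simp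
    show ?thesis
      unfolding step nil
      apply (simp only: wp_Cond)
      apply (simp only: test_holds.simps s1(5,6) False if_False wp_Op)
      apply (subst end_scan)
      subgoal using s1(3) sm envD(2)[OF s1(1)] by simp
      subgoal using s1(4) by (auto simp: same_outer_def intro: paced_short)
      done
  qed
qed

text \<open>The delays of the rounds add up because the list of a round may report nothing. The
  premise on \<open>bound\<close> ties the stored ranges to the current interval: the list of the
  midpoint must end exactly at the present upper bound.\<close>

lemma walk_correct:
  assumes LST: "LST + n < length (words M)" "\<And>r. r < n \<Longrightarrow> boxes_at (words M ! (LST + r)) (bx r) \<and>
      words M ! (LST + r + 1) = words M ! (LST + r) + (2 * k + 1) * length (bx r)"
    and bx: "\<And>r. r < n \<Longrightarrow> sorted_wrt (\<lambda>x y. att (fst x) \<le> att (fst y)) (bx r)"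
      "\<And>r x. r < n \<Longrightarrow> x \<in> set (bx r) \<Longrightarrow>
        (found (snd x) \<noteq> [] \<longleftrightarrow> att (fst x) \<le> x2) \<and> steps (snd x) k [] \<le> B"
      "\<And>r. r < n \<Longrightarrow> mset (concat (map (\<lambda>x. found (snd x)) (bx r))) =
         mset (filter all_ok (root_leaves r (bound r)))"
    and j0: "\<And>r. r < n \<Longrightarrow> att r < x1 \<longleftrightarrow> r < j0"
  shows "env s \<Longrightarrow> reg s 9 = LST \<Longrightarrow> reg s 12 = lo \<Longrightarrow> reg s 13 = hi \<Longrightarrow> hi - lo < 2 ^ d \<Longrightarrow>
    lo \<le> j0 \<Longrightarrow> j0 \<le> hi \<Longrightarrow> hi \<le> n \<Longrightarrow> (\<And>r. lo \<le> r \<Longrightarrow> r < hi \<Longrightarrow> bound r = bound_in d lo hi r) \<Longrightarrow>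
    wp w walk s (\<lambda>t s'. mset (outputs t) = mset (map rep (filter all_ok (root_leaves j0 hi))) \<and>
      delay_at_most (1 + d * (2 * real (unit_time * B + 10) + 10)) t \<and> same_outer {10..14} s s')"
proof (induction d arbitrary: lo hi s)
  case 0
  then have "lo = hi" "j0 = hi" by auto
  then show ?case using 0 unfolding walk_def
    by (subst wp_While) (auto intro: delay_length)
next
  case (Suc d)
  show ?case
  proof (cases "lo < hi")
    case False
    then have "lo = hi" "j0 = hi" using Suc.prems by auto
    then show ?thesis using Suc.prems unfolding walk_def
      by (subst wp_While) (auto intro!: delay_length)
  next
    case True
    note e = envD[OF Suc.prems(1)]
    define mid where "mid = (lo + hi) div 2"
    have mid: "lo \<le> mid" "mid < hi" "mid < n" using True Suc.prems(8) by (auto simp: mid_def)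
    have half: "mid - lo < 2 ^ d" "hi - (mid + 1) < 2 ^ d"
      using Suc.prems(5) by (auto simp: mid_def One_nat_def)
    have nl: "n \<le> length (words M)" using E_range E_len by linarith
    have sm: "(lo + hi) mod 2 ^ w = lo + hi" "mid mod 2 ^ w = mid" "(mid + 1) mod 2 ^ w = mid + 1"
      "(LST + mid) mod 2 ^ w = LST + mid" "(LST + mid + 1) mod 2 ^ w = LST + mid + 1"
      using mid nl LST(1) Suc.prems(8) by (intro word_small; linarith)+
    have sb: "bound_in (Suc d) lo hi r = (if r < mid then bound_in d lo mid r else if r = mid then hi else
        bound_in d (mid + 1) hi r)" for r
      by (simp add: mid_def Let_def)
    have bm: "bound mid = hi" using Suc.prems(9)[of mid] mid sb[of mid] by simp
    define s1 where "s1 = s\<lparr>reg := (reg s)(14 := mid), rreg := (rreg s)(2 := att mid)\<rparr>"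
    have s1: "env s1" "reg s1 9 = LST" "reg s1 12 = lo" "reg s1 13 = hi" "reg s1 14 = mid"
      "same_outer {10..14} s s1" "rreg s1 2 = att mid" "rreg s1 0 = x1"
      using Suc.prems(1-4) by (auto simp: s1_def env_def same_outer_def)
    let ?scan = "Seq (Op Plus 20 9 14) (Seq (Load 10 20) (Seq (Op Plus 20 20 2) (Seq (Load 11 20)
         (Seq scan (Op Plus 13 14 1)))))"
    have step: "wp w walk s Q \<longleftrightarrow> wp w (Cond (RealLeq 0 2) ?scan (Op Plus 12 14 2)) s1
      (\<lambda>t s2. wp w walk s2 (\<lambda>t' s'. Q (Tick # Tick # Tick # Tick # t @ t') s'))" for Q
      unfolding walk_def
      apply (subst wp_While)
      apply (simp only: wp_Seq[of _ "Op _ _ 12 13"] wp_Seq[of _ "Op _ 14 14 3"] wp_Seq[of _ "RealLoad _ _"] wp_Op wp_RealLoad)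
      apply (simp add: Suc.prems(2-4) True e sm mid mid_def[symmetric] reals s1_def del: wp_Cond wp_Seq)
      done
    let ?t = "unit_time * B + 10"
    show ?thesis
    proof (cases "x1 \<le> att mid")
      case left: True
      then have jm: "j0 \<le> mid" using j0[OF mid(3)] by auto
      have len: "LST + mid < length (words M)" "LST + mid + 1 < length (words M)" using LST(1) mid by linarith+
      let ?s2 = "s1\<lparr>reg := (reg s1)(10 := words M ! (LST + mid), 20 := LST + mid + 1, 11 := words M ! (LST + mid + 1))\<rparr>"
      have ss2: "same_outer {10..14} s1 ?s2" by (simp add: same_outer_def)
      have s2: "env ?s2" "reg ?s2 10 = words M ! (LST + mid)"
        "reg ?s2 11 = words M ! (LST + mid) + (2 * k + 1) * length (bx mid)" "boxes_at (words M ! (LST + mid)) (bx mid)"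
        using env_outer[OF s1(1) ss2] LST(2)[OF mid(3)] by auto
      note sc = scan_correct[OF s2 bx(1)[OF mid(3)] bx(2)[OF mid(3)]]
      have sc2: "wp w scan ?s2 (\<lambda>t s'. outputs t = map rep (concat (map (\<lambda>x. found (snd x)) (bx mid))) \<and>
          delay_at_most (2 * real ?t) t \<and> same_outer {10..14} s1 s' \<and> reg s' 9 = LST \<and> reg s' 12 = lo \<and> reg s' 14 = mid)"
      proof (rule wp_mono[OF sc], assumption, elim conjE)
        fix t s' assume a: "outputs t = map rep (concat (map (\<lambda>x. found (snd x)) (bx mid)))"
          "paced ?t t" "same_outer {10, 11} ?s2 s'"
        have "same_outer {10..14} ?s2 s'" by (rule same_outer_mono[OF a(3)]) auto
        then show "outputs t = map rep (concat (map (\<lambda>x. found (snd x)) (bx mid))) \<and>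
          delay_at_most (2 * real ?t) t \<and> same_outer {10..14} s1 s' \<and> reg s' 9 = LST \<and> reg s' 12 = lo \<and> reg s' 14 = mid"
          using a(1) paced_delay[OF a(2)] same_outer_trans[OF ss2] same_outerD[OF a(3), of 9]
            same_outerD[OF a(3), of 12] same_outerD[OF a(3), of 14] s1(2,3,5)
          by (intro conjI) simp_all
      qed
      have en: "wp w ?scan s1 (\<lambda>t s'. outputs t = map rep (concat (map (\<lambda>x. found (snd x)) (bx mid))) \<and>
          delay_at_most (2 * real ?t + 5) t \<and> same_outer {10..14} s1 s' \<and> reg s' 9 = LST \<and> reg s' 12 = lo \<and> reg s' 13 = mid)"
        apply (simp only: wp_Seq[of _ "Op _ _ _ _"] wp_Seq[of _ "Load _ _"] wp_Op wp_Load)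
        apply (simp add: s1 envD[OF s1(1)] sm len fun_upd_twist[of 20 10] del: wp_Seq)
        apply (simp only: wp_Seq)
        apply (rule wp_mono[OF sc2], elim conjE)
        subgoal premises p for t s'
        proof -
          have "env s'" using env_outer[OF s1(1) p(3)] by auto
          then have "reg s' 1 = 0" by (rule envD)
          moreover have "delay_at_most (4 + (2 * real ?t + 1)) ([Tick, Tick, Tick, Tick] @ (t @ [Tick]))"
            by (intro delay_append p(2)) (auto intro: delay_length)
          then have "delay_at_most (2 * real ?t + 5) (Tick # Tick # Tick # Tick # t @ [Tick])"
            by (simp add: algebra_simps)
          ultimately show ?thesis using p sm by (simp add: same_outer_def)
        qed
        done
      show ?thesis
        unfolding step
        apply (simp only: wp_Cond)
        apply (simp only: test_holds.simps s1(7,8) left if_True)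
        apply (rule wp_mono[OF en], elim conjE)
        subgoal premises p for t s'
        proof -
          have 1: "env s'" using env_outer[OF s1(1) p(3)] by auto
          have 2: "bound r = bound_in d lo mid r" if "lo \<le> r" "r < mid" for r
            using Suc.prems(9)[of r] sb[of r] that mid by simp
          \<comment> \<open>The scanned list supplies the root ranks from \<open>mid\<close> up to
            \<open>hi\<close>, the rest of the walk those below \<open>mid\<close>.\<close>
          have eq: "mset (outputs t) + mset (map rep (filter all_ok (root_leaves j0 mid))) =
             mset (map rep (filter all_ok (root_leaves j0 hi)))"
          proof -
            have "mset (outputs t) = image_mset rep (mset (filter all_ok (root_leaves mid hi)))"
              using bx(3)[OF mid(3)] p(1) bm by simp
            then show ?thesis using root_leaves_append[OF jm, of hi] mid by simp
          qed
          show ?thesis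
            apply (rule wp_mono[OF Suc.IH[OF 1 p(4) p(5) p(6) half(1) Suc.prems(6) jm _ 2]])
               apply (use mid in simp)
              apply assumption
             apply assumption
            subgoal premises q for t' s''
            proof -
              have "delay_at_most (5 + ((2 * real ?t + 5) + (1 + d * (2 * real ?t + 10))))
                 ([Tick, Tick, Tick, Tick, Tick] @ (t @ t'))"
                using q p(2) by (intro delay_append) (auto intro: delay_length)
              then have "delay_at_most (1 + real (Suc d) * (2 * real ?t + 10)) (Tick # Tick # Tick # Tick # (Tick # t) @ t')"
                by (simp add: algebra_simps)
              moreover have "same_outer {10..14} s s''" using s1(6) p(3) q same_outer_trans by blast
              ultimately show ?thesis using q eq by simp
            qed
            done
        qed
        done
    next
      case False
      then have jm: "mid + 1 \<le> j0" using j0[OF mid(3)] by auto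
      let ?s2 = "s1\<lparr>reg := (reg s1)(12 := mid + 1)\<rparr>"
      have ss2: "same_outer {10..14} s1 ?s2" by (simp add: same_outer_def)
      have 1: "env ?s2" using env_outer[OF s1(1) ss2] by auto
      have 2: "reg ?s2 9 = LST" "reg ?s2 12 = mid + 1" "reg ?s2 13 = hi" using s1 by auto
      have 3: "bound r = bound_in d (mid + 1) hi r" if "mid + 1 \<le> r" "r < hi" for r
        using Suc.prems(9)[of r] sb[of r] that mid by simp
      show ?thesis
        unfolding step
        apply (simp only: wp_Cond)
        apply (simp only: test_holds.simps s1(7,8) False if_False wp_Op)
        apply (simp only: s1(5) envD(3)[OF s1(1)] binop_fun.simps sm)
        apply (rule wp_mono[OF Suc.IH[OF 1 2 half(2) jm Suc.prems(7,8) 3]])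
          apply assumption
         apply assumption
        subgoal premises q for t' s''
        proof -
          have "delay_at_most (6 + (1 + d * (2 * real ?t + 10)))
             ([Tick, Tick, Tick, Tick, Tick, Tick] @ t')"
            using q by (intro delay_append) (auto intro: delay_length)
          then have "delay_at_most (1 + real (Suc d) * (2 * real ?t + 10)) (Tick # Tick # Tick # Tick # [Tick, Tick] @ t')"
            unfolding append_Cons append_Nil by (rule delay_mono) (simp add: algebra_simps)
          moreover have "same_outer {10..14} s s''" using s1(6) ss2 q same_outer_trans by blast
          ultimately show ?thesis using q by simp
        qed
        done
    qed
  qed
qed

lemma list_from_correct:
  assumes a: "a < length (words M)"
    and LST: "words M ! a + n < length (words M)" "\<And>r. r < n \<Longrightarrow> boxes_at (words M ! (words M ! a + r)) (bx r) \<and>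
      words M ! (words M ! a + r + 1) = words M ! (words M ! a + r) + (2 * k + 1) * length (bx r)"
    and bx: "\<And>r. r < n \<Longrightarrow> sorted_wrt (\<lambda>x y. att (fst x) \<le> att (fst y)) (bx r)"
      "\<And>r x. r < n \<Longrightarrow> x \<in> set (bx r) \<Longrightarrow>
        (found (snd x) \<noteq> [] \<longleftrightarrow> att (fst x) \<le> x2) \<and> steps (snd x) k [] \<le> B"
      "\<And>r. r < n \<Longrightarrow> mset (concat (map (\<lambda>x. found (snd x)) (bx r))) =
         mset (filter all_ok (root_leaves r (bound_in L 0 n r)))"
    and j0: "j0 \<le> n" "\<And>r. r < n \<Longrightarrow> att r < x1 \<longleftrightarrow> r < j0"
    and s: "env s"
  shows "wp w (list_from a) s (\<lambda>t s'. mset (outputs t) = mset (map rep (filter all_ok (root_leaves j0 n))) \<and>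
      delay_at_most (5 + L * (2 * real (unit_time * B + 10) + 10)) t \<and> same_outer {9..14} s s')"
proof -
  note e = envD[OF s]
  have sm: "a mod 2 ^ w = a" "n mod 2 ^ w = n" using a E_range E_len by (auto intro!: word_small)
  have nL: "n - 0 < 2 ^ L" using E_range E_len by linarith
  let ?s = "s\<lparr>reg := (reg s)(20 := a, 9 := words M ! a, 12 := 0, 13 := n)\<rparr>"
  have ss: "same_outer {9..14} s ?s" by (simp add: same_outer_def)
  have 1: "env ?s" using env_outer[OF s ss] by auto
  show ?thesis
    unfolding list_from_def
    apply (simp add: e sm a)
    apply (rule wp_mono[OF walk_correct[OF LST bx j0(2) 1 _ _ _ nL _ j0(1)]], (assumption | simp)+)
    subgoal premises q for t' s'
    proof -
      have "delay_at_most (4 + (1 + L * (2 * real (unit_time * B + 10) + 10))) ([Tick, Tick, Tick, Tick] @ t')"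
        using q by (intro delay_append) (auto intro: delay_length)
      then have "delay_at_most (5 + L * (2 * real (unit_time * B + 10) + 10)) (Tick # Tick # Tick # Tick # t')"
        by (simp add: algebra_simps)
      moreover have "same_outer {9..14} ?s s'" using q by (auto intro: same_outer_mono)
      ultimately show ?thesis using q same_outer_trans[OF ss] by simp
    qed
    done
qed

end

section \<open>Cutting the search into boxes\<close>

lemma upt_one [simp]: "[s..<s + 1] = [s]"
  by (simp add: One_nat_def)

context search
begin

text \<open>A run is the part of the search below \<open>p\<close> whose next candidate lies in an
  address interval. It can be cut anywhere, with leaves and cost splitting exactly.\<close>

definition run_leaves :: "nat \<Rightarrow> nat list \<Rightarrow> nat \<Rightarrow> nat \<Rightarrow> nat list list" where
  "run_leaves r p s e =
     concat (map (\<lambda>t. if okv p (val t) then leaves [] r (p @ [val t]) else []) [s..<e])"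

definition run_cost :: "nat \<Rightarrow> nat list \<Rightarrow> nat \<Rightarrow> nat \<Rightarrow> nat" where
  "run_cost r p s e =
     (\<Sum>t\<leftarrow>[s..<e]. 1 + (if okv p (val t) then steps [] r (p @ [val t]) else 0))"

lemma upt_split: "s \<le> m \<Longrightarrow> m \<le> e \<Longrightarrow> [s..<e] = [s..<m] @ [m..<e]"
  by (metis le_add_diff_inverse upt_add_eq_append)

lemma run_leaves_append: "s \<le> m \<Longrightarrow> m \<le> e \<Longrightarrow> run_leaves r p s e = run_leaves r p s m @ run_leaves r p m e"
  by (simp add: run_leaves_def upt_split[of s m e])

lemma run_cost_append: "s \<le> m \<Longrightarrow> m \<le> e \<Longrightarrow> run_cost r p s e = run_cost r p s m + run_cost r p m e"
  by (simp add: run_cost_def upt_split[of s m e])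

text \<open>A box whose ranges are singletons spelling the prefix \<open>p\<close>: the search is forced down to \<open>p\<close>.\<close>

definition leads_to :: "(nat \<times> nat) list \<Rightarrow> nat list \<Rightarrow> bool" where
  "leads_to b p \<longleftrightarrow> length b = length p \<and> (\<forall>b'.
     leaves (b @ b') k [] = leaves (b @ b') (k - length p) p \<and>
     steps (b @ b') k [] \<le> steps (b @ b') (k - length p) p + 2 * length p)"

lemma leads_to_Nil: "leads_to [] []"
  by (simp add: leads_to_def)

lemma leads_to_snoc:
  assumes "leads_to b p" "length p < k" "okv p (val t)"
  shows "leads_to (b @ [(t, t + 1)]) (p @ [val t])"
proof -
  obtain r where r: "k - length p = Suc r" "k - Suc (length p) = r"
    using assms(2) by (metis Suc_diff_Suc)
  have rng: "rng (b @ (t, t + 1) # b') p = (t, t + 1)" for b'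
    using assms(1) by (simp add: leads_to_def rng_def nth_append)
  have l: "leaves (b @ (t, t + 1) # b') k [] = leaves (b @ (t, t + 1) # b') (Suc r) p"
    "steps (b @ (t, t + 1) # b') k [] \<le> steps (b @ (t, t + 1) # b') (Suc r) p + 2 * length p" for b'
    using assms(1) r by (simp_all add: leads_to_def del: leaves.simps steps.simps)
  \<comment> \<open>A forced position costs two steps, one for the node and one for its only
    candidate.\<close>
  have "leaves (b @ (t, t + 1) # b') (Suc r) p = leaves (b @ (t, t + 1) # b') r (p @ [val t])"
    "steps (b @ (t, t + 1) # b') (Suc r) p = 2 + steps (b @ (t, t + 1) # b') r (p @ [val t])" for b'
    using assms(3) by (simp_all add: rng)
  with l have "leaves (b @ (t, t + 1) # b') k [] = leaves (b @ (t, t + 1) # b') r (p @ [val t])"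
    "steps (b @ (t, t + 1) # b') k [] \<le>
       steps (b @ (t, t + 1) # b') r (p @ [val t]) + 2 * length (p @ [val t])" for b'
    by (simp_all add: add_le_mono algebra_simps)
  then show ?thesis
    using assms(1) r unfolding leads_to_def by simp
qed

lemma leads_to_run:
  assumes "leads_to b p" "length p + Suc r = k"
  shows "leaves (b @ [(s, e)]) k [] = run_leaves r p s e"
    and "steps (b @ [(s, e)]) k [] \<le> 1 + run_cost r p s e + 2 * length p"
proof -
  have r: "k - length p = Suc r" using assms(2) by linarith
  have b: "length b = length p" using assms(1) by (simp add: leads_to_def)
  have rng: "rng (b @ [(s, e)]) p = (s, e)" using b by (simp add: rng_def nth_append)
  have l: "leaves (b @ [(s, e)]) r (p @ [v]) = leaves [] r (p @ [v])"
    "steps (b @ [(s, e)]) r (p @ [v]) = steps [] r (p @ [v])" for v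
    using b by (simp_all add: leaves_beyond[of "b @ [(s, e)]"] steps_beyond[of "b @ [(s, e)]"])
  have "leaves (b @ [(s, e)]) k [] = leaves (b @ [(s, e)]) (Suc r) p"
    "steps (b @ [(s, e)]) k [] \<le> steps (b @ [(s, e)]) (Suc r) p + 2 * length p"
    using assms(1) r by (simp_all add: leads_to_def del: leaves.simps steps.simps)
  then show "leaves (b @ [(s, e)]) k [] = run_leaves r p s e"
    "steps (b @ [(s, e)]) k [] \<le> 1 + run_cost r p s e + 2 * length p"
    by (simp_all add: rng l run_leaves_def run_cost_def cong: map_cong if_cong)
qed

lemma one_box:
  fixes B :: real
  assumes "length p + Suc r = k" "box_ok b" "leads_to b p" "EB \<le> s" "s \<le> e" "e \<le> EE"
    and c: "real (run_cost r p s e) \<le> B"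
  shows "\<exists>bs. concat (map (\<lambda>b. leaves b k []) bs) = run_leaves r p s e \<and>
      (\<forall>b\<in>set bs. box_ok b \<and> real (steps b k []) \<le> B + 1 + 2 * k) \<and> length bs \<le> 1"
proof (cases "s = e")
  \<comment> \<open>An empty run must produce no box, since the ranges of a box are
    nonempty.\<close>
  case True
  then show ?thesis by (intro exI[of _ "[]"]) (simp add: run_leaves_def)
next
  case False
  note r = leads_to_run[OF assms(3,1), of s e]
  have "box_ok (b @ [(s, e)])"
    using assms False by (auto simp: box_ok_def leads_to_def)
  \<comment> \<open>The overhead \<open>1 + 2 * k\<close> is the node of the cut position plus the
    forced path to it.\<close>
  moreover have "real (steps (b @ [(s, e)]) k []) \<le> real (1 + run_cost r p s e + 2 * length p)"
    using r(2) by (simp only: of_nat_le_iff)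
  then have "real (steps (b @ [(s, e)]) k []) \<le> B + 1 + 2 * k" using c assms(1) by simp
  ultimately show ?thesis using r(1) by (intro exI[of _ "[b @ [(s, e)]]"]) simp
qed

text \<open>A heavy run is halved, and a heavy single address is replaced by the row below it. Each
  halving creates at most one more box and is paid for by the cost of the run, which exceeds
  \<open>B\<close>. A unit of cost takes part in at most \<open>h\<close> halvings on the present
  level and in at most \<open>L\<close> on each deeper one, which the factor
  \<open>h + r * (L + 1)\<close> covers.\<close>

lemma box_decomposition:
  fixes B :: real
  assumes B: "2 \<le> B"
  shows "length p + Suc r = k \<Longrightarrow> set p \<subseteq> {..<n} \<Longrightarrow> box_ok b \<Longrightarrow> leads_to b p \<Longrightarrow>
    EB \<le> s \<Longrightarrow> s \<le> e \<Longrightarrow> e \<le> EE \<Longrightarrow> e - s \<le> 2 ^ h \<Longrightarrow>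
    \<exists>bs. concat (map (\<lambda>b. leaves b k []) bs) = run_leaves r p s e \<and>
      (\<forall>b\<in>set bs. box_ok b \<and> real (steps b k []) \<le> B + 1 + 2 * k) \<and>
      real (length bs) \<le> 1 + real (h + r * (L + 1)) * real (run_cost r p s e) / B"
proof (induction r arbitrary: p b s e h rule: less_induct)
  case outer: (less r)
  show ?case using outer.prems
  proof (induction h arbitrary: s e rule: less_induct)
    case inner: (less h)
    let ?D = "\<lambda>h. real (h + r * (L + 1))"
    show ?case
    proof (cases "real (run_cost r p s e) \<le> B")
      case True
      from one_box[OF inner.prems(1,3,4,5,6,7) this] obtain bs where
        "concat (map (\<lambda>b. leaves b k []) bs) = run_leaves r p s e"
        "\<forall>b\<in>set bs. box_ok b \<and> real (steps b k []) \<le> B + 1 + 2 * k" "length bs \<le> 1" by blast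
      moreover have "0 \<le> ?D h * real (run_cost r p s e) / B" using B by simp
      ultimately show ?thesis by (intro exI[of _ bs]) (auto intro: order_trans[of _ 1])
    next
      case heavy: False
      show ?thesis
      proof (cases h)
        case 0
        then have "e = s \<or> e = s + 1" using inner.prems by auto
        then have e: "e = s + 1" using heavy B by (auto simp: run_cost_def)
        have rc: "run_cost r p s e = 1 + (if okv p (val s) then steps [] r (p @ [val s]) else 0)"
          by (simp add: e run_cost_def)
        \<comment> \<open>A rejected candidate costs 1 and an accepted leaf costs 2, neither of
          which exceeds \<open>B\<close>; this is where \<open>2 \<le> B\<close> enters. A heavy
          address therefore has a level below it.\<close>
        then have ok: "okv p (val s)" and "r \<noteq> 0" using heavy B by (cases "r = 0"; auto split: if_splits)+
        then obtain r' where r: "r = Suc r'" by (cases r) auto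
        let ?p = "p @ [val s]"
        have p: "length ?p + Suc r' = k" "set ?p \<subseteq> {..<n}"
          using inner.prems r by auto
        have b: "box_ok (b @ [(s, s + 1)])" using inner.prems e by (auto simp: box_ok_def leads_to_def)
        have "length p < k" using inner.prems(1) by simp
        note lead = leads_to_snoc[OF inner.prems(4) this ok]
        note dr = dyn_range[OF p(2)]
        \<comment> \<open>The halving budget restarts at \<open>L\<close> for the new row; the
          decrease of \<open>r\<close> makes up for it.\<close>
        have "snd (dyn ?p) - fst (dyn ?p) \<le> 2 ^ L" using dr E_range(2) by linarith
        with outer.IH[of r' ?p "b @ [(s, s + 1)]" "fst (dyn ?p)" "snd (dyn ?p)" L] r p b lead dr
        obtain bs where bs: "concat (map (\<lambda>b. leaves b k []) bs) = run_leaves r' ?p (fst (dyn ?p)) (snd (dyn ?p))"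
          "\<forall>b\<in>set bs. box_ok b \<and> real (steps b k []) \<le> B + 1 + 2 * k"
          "real (length bs) \<le> 1 + real (L + r' * (L + 1)) * real (run_cost r' ?p (fst (dyn ?p)) (snd (dyn ?p))) / B"
          by auto
        have "run_leaves r p s e = run_leaves r' ?p (fst (dyn ?p)) (snd (dyn ?p))"
          by (simp add: run_leaves_def e ok r rng_def)
        moreover have "run_cost r p s e = 2 + run_cost r' ?p (fst (dyn ?p)) (snd (dyn ?p))"
          by (simp add: run_cost_def e ok r rng_def)
        then have "real (L + r' * (L + 1)) * real (run_cost r' ?p (fst (dyn ?p)) (snd (dyn ?p))) / B
            \<le> ?D h * real (run_cost r p s e) / B"
          unfolding r using B by (intro divide_right_mono mult_mono) auto
        ultimately show ?thesis using bs by (intro exI[of _ bs]) auto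
      next
        case (Suc h')
        define m where "m = (s + e) div 2"
        have m: "s \<le> m" "m \<le> e" "m - s \<le> 2 ^ h'" "e - m \<le> 2 ^ h'" "EB \<le> m" "m \<le> EE" "h' < h"
          using inner.prems(5-8) Suc by (auto simp: m_def)
        from inner.IH[OF m(7) inner.prems(1-5) m(1) m(6) m(3)] obtain bs1 where bs1:
          "concat (map (\<lambda>b. leaves b k []) bs1) = run_leaves r p s m"
          "\<forall>b\<in>set bs1. box_ok b \<and> real (steps b k []) \<le> B + 1 + 2 * k"
          "real (length bs1) \<le> 1 + ?D h' * real (run_cost r p s m) / B" by blast
        from inner.IH[OF m(7) inner.prems(1-4) m(5) m(2) inner.prems(7) m(4)] obtain bs2 where bs2:
          "concat (map (\<lambda>b. leaves b k []) bs2) = run_leaves r p m e"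
          "\<forall>b\<in>set bs2. box_ok b \<and> real (steps b k []) \<le> B + 1 + 2 * k"
          "real (length bs2) \<le> 1 + ?D h' * real (run_cost r p m e) / B" by blast
        have c: "real (run_cost r p s e) = real (run_cost r p s m) + real (run_cost r p m e)"
          using run_cost_append[OF m(1,2)] by simp
        \<comment> \<open>The two halves bring two leading ones. The second is absorbed by the cost,
          since \<open>?D h\<close> exceeds \<open>?D h'\<close> by one.\<close>
        have "1 \<le> real (run_cost r p s e) / B" using heavy B by simp
        then have "real (length (bs1 @ bs2)) \<le> 1 + ?D h * real (run_cost r p s e) / B"
          using bs1(3) bs2(3) unfolding c Suc by (simp add: algebra_simps add_divide_distrib)
        then show ?thesis
          using bs1(1,2) bs2(1,2) run_leaves_append[OF m(1,2)] by (intro exI[of _ "bs1 @ bs2"]) auto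
      qed
    qed
  qed
qed

end

section \<open>The AGM bound\<close>

lemma of_nat_sum_list: "of_nat (sum_list xs) = sum_list (map of_nat xs)"
  by (induction xs) auto

text \<open>The exponents may add up to more than one, which is what a cover (as opposed to a partition of
  unity) requires; the normalised factors are at most one, so larger exponents only help.\<close>

lemma Hoelder_sum:
  fixes a :: "'e \<Rightarrow> 'v \<Rightarrow> real" and x :: "'e \<Rightarrow> real"
  assumes fin: "finite F" "finite V" and x: "\<And>e. e \<in> F \<Longrightarrow> 0 \<le> x e" "1 \<le> (\<Sum>e\<in>F. x e)"
    and a: "\<And>e v. e \<in> F \<Longrightarrow> v \<in> V \<Longrightarrow> 0 \<le> a e v"
  shows "(\<Sum>v\<in>V. \<Prod>e\<in>F. a e v powr x e) \<le> (\<Prod>e\<in>F. (\<Sum>v\<in>V. a e v) powr x e)"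
proof -
  define S where "S e = (\<Sum>v\<in>V. a e v)" for e
  have S0: "0 \<le> S e" if "e \<in> F" for e unfolding S_def using a that by (intro sum_nonneg) auto
  show ?thesis
  proof (cases "\<exists>e\<in>F. S e = 0")
    case True
    then obtain e where e: "e \<in> F" "S e = 0" by blast
    then have "a e v = 0" if "v \<in> V" for v
      using that a fin unfolding S_def by (subst (asm) sum_nonneg_eq_0_iff) auto
    \<comment> \<open>\<open>0 powr y = 0\<close> holds for every \<open>y\<close>, also for
      exponent zero.\<close>
    then have "(\<Prod>e\<in>F. a e v powr x e) = 0" if "v \<in> V" for v
      using that e fin by (intro prod_zero) auto
    then have "(\<Sum>v\<in>V. \<Prod>e\<in>F. a e v powr x e) = 0" by simp
    then show ?thesis by (simp add: prod_nonneg)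
  next
    case False
    then have Sp: "0 < S e" if "e \<in> F" for e using that S0[of e] by force
    define X where "X = (\<Sum>e\<in>F. x e)"
    have X: "1 \<le> X" using x by (simp add: X_def)
    define b where "b e v = a e v / S e" for e v
    have b: "0 \<le> b e v" "b e v \<le> 1" if "e \<in> F" "v \<in> V" for e v
    proof -
      have "a e v \<le> S e" unfolding S_def using that a fin by (intro member_le_sum) auto
      then show "0 \<le> b e v" "b e v \<le> 1" using Sp[OF that(1)] a[OF that] by (auto simp: b_def)
    qed
    \<comment> \<open>Weighted AM-GM with the exponents normalised by \<open>X\<close>, obtained
      from convexity of \<open>exp\<close> at the logarithms.\<close>
    have amgm: "(\<Prod>e\<in>F. b e v powr x e) \<le> (\<Sum>e\<in>F. x e / X * b e v)" if v: "v \<in> V" for v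
    proof (cases "\<exists>e\<in>F. b e v = 0")
      case True
      then have "(\<Prod>e\<in>F. b e v powr x e) = 0" using fin by (intro prod_zero) auto
      also have "0 \<le> (\<Sum>e\<in>F. x e / X * b e v)" using b v x X by (intro sum_nonneg) auto
      finally show ?thesis .
    next
      case False
      then have bp: "0 < b e v" if "e \<in> F" for e using that b[OF that v] by force
      have "(\<Prod>e\<in>F. b e v powr x e) = exp (\<Sum>e\<in>F. x e * ln (b e v))"
        using fin False by (subst exp_sum) (auto simp: powr_def intro!: prod.cong)
      also have "\<dots> \<le> exp (\<Sum>e\<in>F. (x e / X) * ln (b e v))"
      proof (subst exp_le_cancel_iff, intro sum_mono)
        fix e assume e: "e \<in> F"
        have "ln (b e v) \<le> 0" using bp[OF e] b(2)[OF e v] by simp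
        moreover have "x e / X \<le> x e" using x(1)[OF e] X by (simp add: divide_le_eq mult_left_le)
           (metis mult.right_neutral mult_left_mono)
        ultimately show "x e * ln (b e v) \<le> x e / X * ln (b e v)" by (rule mult_right_mono_neg[rotated])
      qed
      also have "\<dots> \<le> (\<Sum>e\<in>F. (x e / X) * exp (ln (b e v)))"
      proof -
        have "F \<noteq> {}" using x by auto
        moreover have "(\<Sum>e\<in>F. x e / X) = 1" using X by (simp add: X_def sum_divide_distrib[symmetric])
        ultimately show ?thesis
          using convex_on_sum[OF fin(1) _ exp_convex, of "\<lambda>e. x e / X" "\<lambda>e. ln (b e v)"] x(1) X by simp
      qed
      also have "\<dots> = (\<Sum>e\<in>F. x e / X * b e v)" using bp by (intro sum.cong) auto
      finally show ?thesis .
    qed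
    have "(\<Sum>v\<in>V. \<Prod>e\<in>F. b e v powr x e) \<le> (\<Sum>v\<in>V. \<Sum>e\<in>F. x e / X * b e v)"
      by (intro sum_mono amgm)
    also have "\<dots> = (\<Sum>e\<in>F. x e / X * (\<Sum>v\<in>V. b e v))"
      by (subst sum.swap) (simp add: sum_distrib_left)
    also have "\<dots> = (\<Sum>e\<in>F. x e / X)"
    proof (intro sum.cong refl)
      fix e assume "e \<in> F"
      then show "x e / X * (\<Sum>v\<in>V. b e v) = x e / X"
        using Sp[of e] by (simp add: b_def sum_divide_distrib[symmetric] S_def[symmetric])
    qed
    also have "\<dots> = 1" using X by (simp add: sum_divide_distrib[symmetric] X_def[symmetric])
    finally have le1: "(\<Sum>v\<in>V. \<Prod>e\<in>F. b e v powr x e) \<le> 1" .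
    have "(\<Prod>e\<in>F. a e v powr x e) = (\<Prod>e\<in>F. S e powr x e) * (\<Prod>e\<in>F. b e v powr x e)" if "v \<in> V" for v
      unfolding prod.distrib[symmetric]
    proof (intro prod.cong refl)
      fix e assume "e \<in> F"
      then show "a e v powr x e = S e powr x e * b e v powr x e"
        using Sp[of e] a[of e v] that by (simp add: b_def powr_divide)
    qed
    then have "(\<Sum>v\<in>V. \<Prod>e\<in>F. a e v powr x e) =
        (\<Prod>e\<in>F. S e powr x e) * (\<Sum>v\<in>V. \<Prod>e\<in>F. b e v powr x e)"
      by (simp add: sum_distrib_left)
    also have "\<dots> \<le> (\<Prod>e\<in>F. S e powr x e) * 1"
      using le1 by (intro mult_left_mono) (auto intro: prod_nonneg)
    finally show ?thesis by (simp add: S_def)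
  qed
qed

section \<open>Weights of prefixes and the cost of the complete search\<close>

context search
begin

definition deg :: "nat \<Rightarrow> nat" where
  "deg u = card {v. adj u v}"

lemma finite_nbs [simp]: "finite {v. adj u v}"
  by (rule finite_subset[of _ "{..<n}"]) (use adj_less in auto)

lemma row_length: "u < n \<Longrightarrow> off (Suc u) - off u = deg u"
  using distinct_card[OF row(1)[of u]] row(2)[of u] by (simp add: deg_def del: set_map)

lemma deg_less: "u < n \<Longrightarrow> deg u < EE - EB"
  using row_length[of u] off_range[of u] off_range[of "Suc u"] n_pos by linarith

lemma deg_ge1: "u < n \<Longrightarrow> 1 \<le> deg u"
  using deg_pos[of u] by (auto simp: deg_def Suc_le_eq card_gt_0_iff One_nat_def)

lemma dyn_row:
  assumes p: "set p \<subseteq> {..<n}" and i: "0 < length p" "length p < k"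
  shows "\<exists>j\<in>set (nb (length p)). dyn p = (off (p ! j), off (Suc (p ! j)))"
    and "\<And>j. j \<in> set (nb (length p)) \<Longrightarrow> snd (dyn p) - fst (dyn p) \<le> deg (p ! j)"
proof -
  have pj: "p ! j < n" if "j < length p" for j using p that by (auto simp: subset_iff)
  let ?R = "\<lambda>j. (off (p ! j), off (Suc (p ! j)))"
  have fold: "(fold (shorter p) js se = se \<or> (\<exists>j\<in>set js. fold (shorter p) js se = ?R j)) \<and>
      snd (fold (shorter p) js se) - fst (fold (shorter p) js se) \<le> snd se - fst se \<and>
      (\<forall>j\<in>set js. snd (fold (shorter p) js se) - fst (fold (shorter p) js se) \<le> deg (p ! j))"
    if "set js \<subseteq> {..<length p}" for js se
    using that
  proof (induction js arbitrary: se)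
    case (Cons j js)
    have d: "off (Suc (p ! j)) - off (p ! j) = deg (p ! j)" using row_length pj Cons.prems by simp
    have s: "snd (shorter p j se) - fst (shorter p j se) \<le> deg (p ! j)"
        "snd (shorter p j se) - fst (shorter p j se) \<le> snd se - fst se"
        "shorter p j se = se \<or> shorter p j se = ?R j"
      by (auto simp: shorter_def d)
    show ?case using Cons.IH[of "shorter p j se"] Cons.prems s
      by auto
  qed simp
  have sub: "set (nb (length p)) \<subseteq> {..<length p}" using nb_less by auto
  note f = fold[OF sub, of "(EB, EE)", folded dyn_def]
  show "\<And>j. j \<in> set (nb (length p)) \<Longrightarrow> snd (dyn p) - fst (dyn p) \<le> deg (p ! j)"
    using f by blast
  obtain j where j: "j \<in> set (nb (length p))" using nb_nonempty[OF i] by (cases "nb (length p)") auto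
  \<comment> \<open>Every row is strictly shorter than the whole segment, so the initial value does
    not survive.\<close>
  then have "dyn p \<noteq> (EB, EE)" using f deg_less[OF pj, of j] sub by force
  then show "\<exists>j\<in>set (nb (length p)). dyn p = ?R j" using f by blast
qed

definition valid :: "nat list \<Rightarrow> bool" where
  "valid p \<longleftrightarrow> set p \<subseteq> {..<n} \<and> (\<forall>i<length p. \<forall>j\<in>set (nb i). adj (p ! j) (p ! i))"

lemma valid_snoc: "valid p \<Longrightarrow> v < n \<Longrightarrow> okv p v \<Longrightarrow> valid (p @ [v])"
  using nb_less by (force simp: valid_def okv_def nth_append less_Suc_eq)

lemma valid_snocD: "valid (p @ [v]) \<Longrightarrow> valid p \<and> v < n \<and> okv p v"
  unfolding valid_def okv_def
  by (auto simp: nth_append dest: nb_less split: if_splits) (metis less_SucI less_trans nb_less nth_append_length less_irrefl lessI nth_append)+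

lemma edge_list_iff: "(j, i) \<in> set edge_list \<longleftrightarrow> i < k \<and> j \<in> set (nb i)"
  by (auto simp: edge_list_def)

lemma edge_less:
  "e \<in> set edge_list \<Longrightarrow> fst e < snd e \<and> snd e < k \<and> fst e \<in> set (nb (snd e))"
  by (auto simp: edge_list_def dest: nb_less)

end

locale weighted_search = search +
  fixes x :: "nat \<times> nat \<Rightarrow> real"
  assumes x_nonneg: "\<And>e. e \<in> set edge_list \<Longrightarrow> 0 \<le> x e"
    and x_cover: "\<And>i. i < k \<Longrightarrow> 1 \<le> (\<Sum>e\<in>{e \<in> set edge_list. fst e = i \<or> snd e = i}. x e)"
begin

definition total :: nat where
  "total = (\<Sum>u<n. deg u)"

text \<open>The number of arcs on which \<open>e\<close> can still be placed once \<open>p\<close>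
  is fixed: all arcs, those at the placed end, or the one that is already determined, if it is an
  arc. Only the first end can be placed alone, because \<open>fst e < snd e\<close>.\<close>

definition count :: "nat \<times> nat \<Rightarrow> nat list \<Rightarrow> real" where
  "count e p = (if snd e < length p then (if adj (p ! fst e) (p ! snd e) then 1 else 0)
     else if fst e < length p then real (deg (p ! fst e)) else real total)"

text \<open>Since \<open>0 powr 0 = 0\<close>, a prefix that violates an edge has weight zero even if the edge has exponent
  zero.\<close>

definition weight :: "nat list \<Rightarrow> real" where
  "weight p = (\<Prod>e\<in>set edge_list. count e p powr x e)"

lemma weight_nonneg: "0 \<le> weight p"
  by (simp add: weight_def prod_nonneg)

text \<open>Extending \<open>p\<close> changes only the factors of the edges at the new position,
  and for each of these the counts over all \<open>v\<close> add up to its count at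
  \<open>p\<close>. The cover condition at this position is the exponent condition of Hoelder's
  inequality.\<close>

lemma weight_split:
  assumes p: "set p \<subseteq> {..<n}" "length p < k"
  shows "(\<Sum>v<n. weight (p @ [v])) \<le> weight p"
proof -
  let ?i = "length p"
  define F where "F = {e \<in> set edge_list. fst e = ?i \<or> snd e = ?i}"
  define R where "R = set edge_list - F"
  have fin: "finite F" "finite R" "F \<inter> R = {}" "set edge_list = F \<union> R" by (auto simp: F_def R_def)
  have lt: "fst e < snd e" if "e \<in> set edge_list" for e
    using edge_less[OF that] by simp
  have w: "weight q = (\<Prod>e\<in>F. count e q powr x e) * (\<Prod>e\<in>R. count e q powr x e)" for q
    unfolding weight_def fin(4) using fin by (intro prod.union_disjoint) auto
  have R: "count e (p @ [v]) = count e p" if "e \<in> R" for e v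
  proof -
    have "fst e \<noteq> ?i" "snd e \<noteq> ?i" "fst e < snd e" using that lt by (auto simp: R_def F_def)
    then show ?thesis by (auto simp: count_def nth_append)
  qed
  have F: "(\<Sum>v<n. count e (p @ [v])) = count e p" if "e \<in> F" for e
  proof (cases "snd e = ?i")
    case True
    then have j: "fst e < ?i" using that lt[of e] by (auto simp: F_def)
    have "(\<Sum>v<n. count e (p @ [v])) = (\<Sum>v<n. if adj (p ! fst e) v then 1 else 0)"
      using True j by (intro sum.cong) (auto simp: count_def nth_append)
    also have "\<dots> = real (card {v \<in> {..<n}. adj (p ! fst e) v})"
      by (subst sum.If_cases) (auto simp: Int_def)
    also have "{v \<in> {..<n}. adj (p ! fst e) v} = {v. adj (p ! fst e) v}" using adj_less by auto
    finally show ?thesis using True j by (simp add: count_def deg_def)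
  next
    case False
    then have "fst e = ?i" "?i < snd e" using that lt[of e] by (auto simp: F_def)
    then show ?thesis by (simp add: count_def total_def)
  qed
  have "(\<Sum>v<n. weight (p @ [v])) = (\<Sum>v<n. \<Prod>e\<in>F. count e (p @ [v]) powr x e) * (\<Prod>e\<in>R. count e p powr x e)"
    by (simp add: w R sum_distrib_right cong: prod.cong)
  also have "\<dots> \<le> (\<Prod>e\<in>F. (\<Sum>v<n. count e (p @ [v])) powr x e) * (\<Prod>e\<in>R. count e p powr x e)"
  proof (intro mult_right_mono Hoelder_sum prod_nonneg)
    show "1 \<le> (\<Sum>e\<in>F. x e)" using x_cover[OF p(2)] by (simp add: F_def)
    show "0 \<le> count e q" for e q by (simp add: count_def)
  qed (use fin(1,2) x_nonneg in \<open>auto simp: F_def\<close>)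
  also have "\<dots> = weight p" by (simp add: w F cong: prod.cong)
  finally show ?thesis .
qed

lemma total_ge: "u < n \<Longrightarrow> deg u \<le> total"
  unfolding total_def by (rule member_le_sum) auto

text \<open>Ranked vertices are never isolated, so every degree is at least one; the edges with both
  ends placed are arcs by validity.\<close>

lemma count_ge1:
  assumes p: "valid p" and e: "e \<in> set edge_list"
  shows "1 \<le> count e p"
proof -
  obtain j i where ji: "e = (j, i)" "i < k" "j \<in> set (nb i)" "j < i"
    using edge_less[OF e] by (metis prod.collapse)
  have pn: "p ! a < n" if "a < length p" for a using p that by (auto simp: valid_def subset_iff)
  have "1 \<le> total" using total_ge[OF n_pos] deg_ge1[OF n_pos] by linarith
  moreover have "1 \<le> deg (p ! j)" if "j < length p" using deg_ge1 pn that by simp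
  ultimately show ?thesis using p ji by (auto simp: count_def valid_def)
qed

lemma powr_ge1: "1 \<le> a \<Longrightarrow> 0 \<le> b \<Longrightarrow> 1 \<le> a powr (b::real)"
  using ge_one_powr_ge_zero by blast

lemma weight_ge1: "valid p \<Longrightarrow> 1 \<le> weight p"
  unfolding weight_def using count_ge1 x_nonneg by (intro prod_ge_1 powr_ge1) auto

text \<open>The chosen row is at most as long as the count of every edge at the next position: for
  edges to earlier positions because it is a shortest row, for the others because no row is longer
  than \<open>total\<close>. The exponents of these edges add up to at least one, and the factors of
  all other edges are at least one.\<close>

lemma dyn_le_weight:
  assumes p: "valid p" "0 < length p" "length p < k"
  shows "real (snd (dyn p) - fst (dyn p)) \<le> weight p"
proof (cases "snd (dyn p) - fst (dyn p) = 0")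
  case True
  then show ?thesis using weight_nonneg by simp
next
  case False
  let ?i = "length p" let ?l = "snd (dyn p) - fst (dyn p)"
  define F where "F = {e \<in> set edge_list. fst e = ?i \<or> snd e = ?i}"
  have pn: "p ! a < n" if "a < length p" for a using p that by (auto simp: valid_def subset_iff)
  have p1: "set p \<subseteq> {..<n}" using p(1) by (simp add: valid_def)
  have l: "1 \<le> real ?l" using False by simp
  obtain j0 where j0: "j0 \<in> set (nb ?i)" "dyn p = (off (p ! j0), off (Suc (p ! j0)))"
    using dyn_row(1)[OF p1 p(2,3)] by blast
  have tot: "?l \<le> total"
    using dyn_row(2)[OF p1 p(2,3) j0(1)] total_ge[OF pn] nb_less[OF j0(1)] order_trans by blast
  have F: "real ?l \<le> count e p" if e: "e \<in> F" for e
  proof -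
    obtain j i where ji: "e = (j, i)" "j \<in> set (nb i)" "j < i"
      using edge_less[of e] e unfolding F_def by (metis (no_types, lifting) mem_Collect_eq prod.collapse)
    show ?thesis
    proof (cases "i = ?i")
      case True
      then show ?thesis using ji dyn_row(2)[OF p1 p(2,3), of j] by (simp add: count_def)
    next
      case False
      then have "j = ?i" using e ji by (auto simp: F_def)
      then show ?thesis using ji tot by (simp add: count_def)
    qed
  qed
  have "real ?l = real ?l powr 1" using l by simp
  also have "\<dots> \<le> real ?l powr (\<Sum>e\<in>F. x e)"
    using l x_cover[OF p(3)] by (intro powr_mono) (auto simp: F_def)
  also have "\<dots> = (\<Prod>e\<in>F. real ?l powr x e)"
    using l by (intro powr_sum) (auto simp: F_def)
  also have "\<dots> \<le> (\<Prod>e\<in>F. count e p powr x e)"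
    using F l x_nonneg by (intro prod_mono conjI powr_mono2) (auto simp: F_def)
  also have "\<dots> \<le> (\<Prod>e\<in>F. count e p powr x e) * (\<Prod>e\<in>set edge_list - F. count e p powr x e)"
  proof -
    have "1 \<le> (\<Prod>e\<in>set edge_list - F. count e p powr x e)"
      using count_ge1[OF p(1)] x_nonneg by (intro prod_ge_1 powr_ge1) auto
    moreover have "0 \<le> (\<Prod>e\<in>F. count e p powr x e)" by (simp add: prod_nonneg)
    ultimately show ?thesis using mult_left_mono by fastforce
  qed
  also have "\<dots> = weight p"
    unfolding weight_def by (subst prod.subset_diff[of F "set edge_list"]) (auto simp: F_def)
  finally show ?thesis .
qed

lemma sum_row_le:
  fixes f :: "nat \<Rightarrow> real"
  assumes "distinct (map val ts)" "\<And>v. 0 \<le> f v"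
  shows "(\<Sum>t\<leftarrow>ts. f (val t)) \<le> (\<Sum>v<n. f v)"
proof -
  have "(\<Sum>t\<leftarrow>ts. f (val t)) = sum_list (map f (map val ts))" by (simp add: comp_def)
  also have "\<dots> = (\<Sum>v\<in>set (map val ts). f v)" using assms(1) by (rule sum_list_distinct_conv_sum_set)
  also have "\<dots> \<le> (\<Sum>v<n. f v)" using assms(2) by (intro sum_mono2) auto
  finally show ?thesis .
qed

text \<open>Each level adds two weights, one for the node and one for the row that is run through;
  \<open>weight_split\<close> keeps the levels below within the weight of \<open>p\<close>.\<close>

lemma steps_le_weight:
  "valid p \<Longrightarrow> 0 < length p \<Longrightarrow> length p + r = k \<Longrightarrow> real (steps [] r p) \<le> (2 * real r + 1) * weight p"
proof (induction r arbitrary: p)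
  case 0
  then show ?case using weight_ge1 by simp
next
  case (Suc r)
  have lk: "length p < k" using Suc.prems by simp
  have p1: "set p \<subseteq> {..<n}" using Suc.prems(1) by (simp add: valid_def)
  let ?ts = "[fst (dyn p)..<snd (dyn p)]"
  obtain j0 where j0: "j0 \<in> set (nb (length p))" "dyn p = (off (p ! j0), off (Suc (p ! j0)))"
    using dyn_row(1)[OF p1 Suc.prems(2) lk] by blast
  have "p ! j0 < n" using nb_less[OF j0(1)] p1 by (auto simp: subset_iff)
  then have dist: "distinct (map val ?ts)" using row(1) j0(2) by simp
  define f where "f v = (if okv p v then real (steps [] r (p @ [v])) else 0)" for v
  have "f v \<le> (2 * real r + 1) * weight (p @ [v])" if "v < n" for v
    using Suc.IH[of "p @ [v]"] valid_snoc[OF Suc.prems(1) that] Suc.prems(3) weight_nonneg[of "p @ [v]"]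
    by (auto simp: f_def)
  then have "(\<Sum>v<n. f v) \<le> (\<Sum>v<n. (2 * real r + 1) * weight (p @ [v]))" by (intro sum_mono) auto
  also have "\<dots> \<le> (2 * real r + 1) * weight p"
    unfolding sum_distrib_left[symmetric] using weight_split[OF p1 lk] by (intro mult_left_mono) auto
  finally have f: "(\<Sum>v<n. f v) \<le> (2 * real r + 1) * weight p" .
  have "real (steps [] (Suc r) p) = 1 + (\<Sum>t\<leftarrow>?ts. 1 + f (val t))"
    by (simp add: rng_def f_def of_nat_sum_list comp_def if_distrib[of real] cong: map_cong if_cong)
  also have "\<dots> = 1 + real (snd (dyn p) - fst (dyn p)) + (\<Sum>t\<leftarrow>?ts. f (val t))"
    by (simp add: sum_list_addf sum_list_triv)
  also have "\<dots> \<le> weight p + weight p + (2 * real r + 1) * weight p"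
    using weight_ge1[OF Suc.prems(1)] dyn_le_weight[OF Suc.prems(1,2) lk] order_trans[OF sum_row_le[OF dist, of f] f]
    by (intro add_mono) (auto simp: f_def)
  finally show ?case by (simp add: algebra_simps)
qed

text \<open>The root runs through all ranks rather than through a row, hence the separate
  \<open>n\<close>. In the weight of the empty prefix every edge still has all arcs at its disposal,
  so the exponents simply add up.\<close>

lemma root_cost:
  assumes r: "k = Suc r"
  shows "real (run_cost r [] EB (EB + n)) \<le> real n + (2 * real r + 1) * real total powr (\<Sum>e\<in>set edge_list. x e)"
proof -
  have ts: "map val [EB..<EB + n] = [0..<n]" using val_ident by (intro nth_equalityI) auto
  have nb0: "nb 0 = []" using nb_less[of _ 0] by (cases "nb 0") auto
  have ok: "okv [] v" for v by (simp add: okv_def nb0)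
  have "real (run_cost r [] EB (EB + n)) = (\<Sum>t\<leftarrow>[EB..<EB + n]. 1 + real (steps [] r [val t]))"
    by (simp add: run_cost_def ok of_nat_sum_list comp_def)
  also have "\<dots> = sum_list (map (\<lambda>v. 1 + real (steps [] r [v])) (map val [EB..<EB + n]))"
    by (simp add: comp_def)
  also have "\<dots> = (\<Sum>v<n. 1 + real (steps [] r [v]))"
    unfolding ts by (simp add: interv_sum_list_conv_sum_set_nat atLeast0LessThan)
  also have "\<dots> \<le> (\<Sum>v<n. 1 + (2 * real r + 1) * weight ([] @ [v]))"
  proof (intro sum_mono add_left_mono)
    fix v assume "v \<in> {..<n}"
    then have "valid [v]" by (simp add: valid_def nb0 One_nat_def)
    then show "real (steps [] r [v]) \<le> (2 * real r + 1) * weight ([] @ [v])"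
      using steps_le_weight[of "[v]" r] assms by (simp add: One_nat_def)
  qed
  also have "\<dots> = real n + (2 * real r + 1) * (\<Sum>v<n. weight ([] @ [v]))"
    by (simp add: sum.distrib sum_distrib_left)
  also have "\<dots> \<le> real n + (2 * real r + 1) * weight []"
    using weight_split[of "[]"] k_pos by (intro add_left_mono mult_left_mono) auto
  also have "weight [] = real total powr (\<Sum>e\<in>set edge_list. x e)"
  proof -
    have "1 \<le> total" using total_ge[OF n_pos] deg_ge1[OF n_pos] by linarith
    then show ?thesis by (simp add: weight_def count_def powr_sum)
  qed
  finally show ?thesis .
qed

end

section \<open>Overlap of the stored ranges, completeness of the search, and the box lists\<close>

lemma distinct_concat_map:
  assumes "distinct ts" "\<And>t. t \<in> set ts \<Longrightarrow> distinct (f t)"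
    "\<And>t u. t \<in> set ts \<Longrightarrow> u \<in> set ts \<Longrightarrow> t \<noteq> u \<Longrightarrow> set (f t) \<inter> set (f u) = {}"
  shows "distinct (concat (map f ts))"
  using assms
proof (induction ts)
  case (Cons t ts)
  have "set (f t) \<inter> set (f u) = {}" if "u \<in> set ts" for u
    using Cons.prems(1) that by (intro Cons.prems(3)) auto
  moreover have "distinct (concat (map f ts))" using Cons by simp
  ultimately show ?case using Cons.prems(2)[of t] by auto
qed simp

lemma bound_in_range: "lo \<le> r \<Longrightarrow> r < hi \<Longrightarrow> hi - lo < 2 ^ d \<Longrightarrow> r < bound_in d lo hi r \<and> bound_in d lo hi r \<le> hi"
proof (induction d arbitrary: lo hi)
  case (Suc d)
  define mid where "mid = (lo + hi) div 2"
  have m: "lo \<le> mid" "mid < hi" "mid - lo < 2 ^ d" "hi - (mid + 1) < 2 ^ d"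
    using Suc.prems by (auto simp: mid_def One_nat_def)
  show ?case
    using Suc.IH[of lo mid] Suc.IH[of "mid + 1" hi] Suc.prems m by (auto simp: Let_def mid_def[symmetric])
qed simp

text \<open>On each level of the binary search tree the stored ranges are disjoint, so a level
  contributes at most \<open>c lo hi\<close>, and there are at most \<open>d\<close> levels.\<close>

lemma sum_bound_in:
  fixes c :: "nat \<Rightarrow> nat \<Rightarrow> nat"
  assumes c: "\<And>l m h. l \<le> m \<Longrightarrow> m \<le> h \<Longrightarrow> c l h = c l m + c m h"
  shows "lo \<le> hi \<Longrightarrow> hi - lo < 2 ^ d \<Longrightarrow> (\<Sum>r = lo..<hi. c r (bound_in d lo hi r)) \<le> d * c lo hi"
proof (induction d arbitrary: lo hi)
  case (Suc d)
  show ?case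
  proof (cases "lo = hi")
    case False
    define mid where "mid = (lo + hi) div 2"
    have m: "lo \<le> mid" "mid < hi" "mid - lo < 2 ^ d" "hi - (mid + 1) < 2 ^ d"
      using Suc.prems False by (auto simp: mid_def One_nat_def)
    let ?f = "\<lambda>r. c r (bound_in (Suc d) lo hi r)"
    have f: "?f r = (if r < mid then c r (bound_in d lo mid r) else if r = mid then c mid hi
        else c r (bound_in d (mid + 1) hi r))" for r
      by (simp add: Let_def mid_def[symmetric])
    have "{lo..<hi} = {lo..<mid} \<union> ({mid} \<union> {mid + 1..<hi})" using m by auto
    then have "(\<Sum>r = lo..<hi. ?f r) = (\<Sum>r = lo..<mid. ?f r) + (?f mid + (\<Sum>r = mid + 1..<hi. ?f r))"
      by (simp add: sum.union_disjoint del: bound_in.simps)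
    also have "\<dots> = (\<Sum>r = lo..<mid. c r (bound_in d lo mid r)) +
        (c mid hi + (\<Sum>r = mid + 1..<hi. c r (bound_in d (mid + 1) hi r)))"
      unfolding f by (intro arg_cong2[where f = "(+)"] sum.cong) auto
    also have "\<dots> \<le> d * c lo mid + (c mid hi + d * c (mid + 1) hi)"
      using Suc.IH[of lo mid] Suc.IH[of "mid + 1" hi] m by (intro add_mono) auto
    also have "\<dots> \<le> d * c lo mid + (c mid hi + d * c mid hi)"
      using c[of mid "mid + 1" hi] m by (intro add_mono mult_left_mono) auto
    also have "\<dots> \<le> Suc d * c lo hi"
      using c[of lo mid hi] m by (simp add: algebra_simps)
    finally show ?thesis .
  qed simp
qed simp

context search
begin

text \<open>The claim for longer prefixes is a premise, so that the lemma serves both the rows of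
  later positions and the ranks of the root.\<close>

lemma run_leaves_set:
  assumes p: "valid p" "length p + Suc r = k" and d: "distinct (map val [s..<e])"
    and IH: "\<And>v. valid (p @ [v]) \<Longrightarrow> distinct (leaves [] r (p @ [v])) \<and>
      set (leaves [] r (p @ [v])) = {q. length q = k \<and> valid q \<and> take (Suc (length p)) q = p @ [v]}"
  shows "distinct (run_leaves r p s e)"
    "set (run_leaves r p s e) =
      {q. length q = k \<and> valid q \<and> take (length p) q = p \<and> q ! length p \<in> val ` {s..<e}}"
proof -
  let ?f = "\<lambda>t. if okv p (val t) then leaves [] r (p @ [val t]) else []"
  have f: "distinct (?f t) \<and> set (?f t) = {q. length q = k \<and> valid q \<and> take (Suc (length p)) q = p @ [val t]}" for t
  proof (cases "okv p (val t)")
    case True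
    then show ?thesis using IH[OF valid_snoc[OF p(1) val_less True]] by simp
  next
    case False
    \<comment> \<open>A failed test loses nothing: validity passes to prefixes, so no valid
      labelling extends \<open>p\<close> by this rank.\<close>
    have "\<not> valid q" if "length q = k" "take (Suc (length p)) q = p @ [val t]" for q
    proof
      assume "valid q"
      then have "valid (take (Suc (length p)) q)"
        unfolding valid_def
      proof (intro conjI allI impI ballI)
        fix i j assume a: "i < length (take (Suc (length p)) q)" "j \<in> set (nb i)"
          "set q \<subseteq> {..<n} \<and> (\<forall>i<length q. \<forall>j\<in>set (nb i). adj (q ! j) (q ! i))"
        then show "adj (take (Suc (length p)) q ! j) (take (Suc (length p)) q ! i)"
          using nb_less[OF a(2)] by simp
      qed (auto dest: in_set_takeD)
      then show False using that False valid_snocD[of p] by simp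
    qed
    then show ?thesis using False by auto
  qed
  show "distinct (run_leaves r p s e)"
    unfolding run_leaves_def
  proof (rule distinct_concat_map)
    fix t u assume "t \<in> set [s..<e]" "u \<in> set [s..<e]" "t \<noteq> u"
    then have "val t \<noteq> val u" using d by (auto simp: distinct_map inj_on_def)
    then show "set (?f t) \<inter> set (?f u) = {}" using f by auto
  qed (use f in auto)
  have "set (run_leaves r p s e) = (\<Union>t\<in>{s..<e}. set (?f t))"
    unfolding run_leaves_def by (auto simp del: set_upt) auto
  also have "\<dots> = {q. length q = k \<and> valid q \<and> (\<exists>t\<in>{s..<e}. take (Suc (length p)) q = p @ [val t])}"
    using f by blast
  also have "\<dots> = {q. length q = k \<and> valid q \<and> take (length p) q = p \<and> q ! length p \<in> val ` {s..<e}}"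
  proof (intro Collect_cong conj_cong refl)
    fix q :: "nat list" assume "length q = k"
    then have "take (Suc (length p)) q = take (length p) q @ [q ! length p]"
      using p(2) by (simp add: take_Suc_conv_app_nth)
    then show "(\<exists>t\<in>{s..<e}. take (Suc (length p)) q = p @ [val t]) \<longleftrightarrow>
        take (length p) q = p \<and> q ! length p \<in> val ` {s..<e}" by auto
  qed
  finally show "set (run_leaves r p s e) =
      {q. length q = k \<and> valid q \<and> take (length p) q = p \<and> q ! length p \<in> val ` {s..<e}}" .
qed

lemma leaves_set:
  "valid p \<Longrightarrow> 0 < length p \<Longrightarrow> length p + r = k \<Longrightarrow> distinct (leaves [] r p) \<and>
    set (leaves [] r p) = {q. length q = k \<and> valid q \<and> take (length p) q = p}"
proof (induction r arbitrary: p)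
  case 0
  then show ?case by auto
next
  case (Suc r)
  have lk: "length p < k" using Suc.prems by simp
  have p1: "set p \<subseteq> {..<n}" using Suc.prems(1) by (simp add: valid_def)
  obtain j0 where j0: "j0 \<in> set (nb (length p))" "dyn p = (off (p ! j0), off (Suc (p ! j0)))"
    using dyn_row(1)[OF p1 Suc.prems(2) lk] by blast
  have pj: "p ! j0 < n" using nb_less[OF j0(1)] p1 by (auto simp: subset_iff)
  have d: "distinct (map val [fst (dyn p)..<snd (dyn p)])" using row(1)[OF pj] j0(2) by simp
  have IH: "distinct (leaves [] r (p @ [v])) \<and>
      set (leaves [] r (p @ [v])) = {q. length q = k \<and> valid q \<and> take (Suc (length p)) q = p @ [v]}"
    if "valid (p @ [v])" for v
    using Suc.IH[OF that] Suc.prems(3) by simp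
  note rl = run_leaves_set[OF Suc.prems(1,3) d IH]
  have eq: "leaves [] (Suc r) p = run_leaves r p (fst (dyn p)) (snd (dyn p))"
    by (simp add: run_leaves_def rng_def)
  \<comment> \<open>Running through a single row is complete, because a valid labelling is adjacent
    to all earlier neighbours, in particular to the one whose row was chosen.\<close>
  have "q ! length p \<in> val ` {fst (dyn p)..<snd (dyn p)}"
    if q: "length q = k" "valid q" "take (length p) q = p" for q
  proof -
    have "adj (q ! j0) (q ! length p)" using q lk j0(1) by (simp add: valid_def)
    moreover have "q ! j0 = p ! j0" using q(3) nb_less[OF j0(1)] by (metis nth_take)
    ultimately have "q ! length p \<in> set (map val [off (p ! j0)..<off (Suc (p ! j0))])"
      using row(2)[OF pj] by simp
    then show ?thesis using j0(2) by (simp del: set_upt) simp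
  qed
  then show ?case unfolding eq using rl by auto
qed

lemma root_leaves_run: "k = Suc r \<Longrightarrow> root_leaves l h = run_leaves r [] (EB + l) (EB + h)"
proof -
  assume r: "k = Suc r"
  have "leaves ([] @ [(EB + l, EB + h)]) k [] = run_leaves r [] (EB + l) (EB + h)"
    by (rule leads_to_run[OF leads_to_Nil]) (simp add: r)
  then show ?thesis by (simp add: root_leaves_def)
qed

lemma nb0 [simp]: "nb 0 = []"
  using nb_less[of _ 0] by (cases "nb 0") auto

lemma root_leaves_set:
  assumes "h \<le> n"
  shows "distinct (root_leaves l h)"
    "set (root_leaves l h) = {q. length q = k \<and> valid q \<and> l \<le> q ! 0 \<and> q ! 0 < h}"
proof -
  obtain r where r: "k = Suc r" using k_pos by (cases k) auto
  have v: "map val [EB + l..<EB + h] = [l..<h]"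
    using assms by (intro nth_equalityI) (auto simp: val_ident add.assoc)
  have im: "val ` {EB + l..<EB + h} = {l..<h}"
    using arg_cong[OF v, of set] by simp
  have IH: "distinct (leaves [] r ([] @ [v])) \<and>
      set (leaves [] r ([] @ [v])) = {q. length q = k \<and> valid q \<and> take (Suc (length [])) q = [] @ [v]}"
    if "valid ([] @ [v])" for v
    using leaves_set[of "[v]" r] that r by (simp add: One_nat_def)
  have d: "distinct (map val [EB + l..<EB + h])" unfolding v by simp
  have len: "length ([]::nat list) + Suc r = k" using r by simp
  show "distinct (root_leaves l h)"
    unfolding root_leaves_run[OF r] by (rule run_leaves_set(1)[OF _ len d IH]) (simp_all add: valid_def)
  have "set (root_leaves l h) = {q. length q = k \<and> valid q \<and> take (length ([]::nat list)) q = [] \<and>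
      q ! length ([]::nat list) \<in> val ` {EB + l..<EB + h}}"
    unfolding root_leaves_run[OF r] by (rule run_leaves_set(2)[OF _ len d IH]) (simp_all add: valid_def)
  then show "set (root_leaves l h) = {q. length q = k \<and> valid q \<and> l \<le> q ! 0 \<and> q ! 0 < h}"
    unfolding im by simp
qed

lemma leaf_ranks:
  assumes "box_ok b" "valid p" "length p + r = k" "q \<in> set (leaves b r p)"
  shows "length q = k \<and> set q \<subseteq> {..<n}"
  using assms(2-)
proof (induction r arbitrary: p)
  case 0
  then show ?case by (auto simp: valid_def)
next
  case (Suc r)
  then obtain t where "okv p (val t)" "q \<in> set (leaves b r (p @ [val t]))"
    by (auto split: if_splits)
  then show ?case using Suc.IH[of "p @ [val t]"] valid_snoc[OF Suc.prems(1) val_less] Suc.prems(2) by simp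
qed

text \<open>The key of a box is the least maximal rank of an accepted labelling in it; hence the box contains an
  answer to a query with upper bound \<open>x2\<close> iff the attribute of the key is at most \<open>x2\<close>.\<close>

definition keyed_boxes :: "real \<Rightarrow> (nat \<times> (nat \<times> nat) list) list \<Rightarrow> nat list list \<Rightarrow> bool" where
  "keyed_boxes T bs ps \<longleftrightarrow> sorted (map fst bs) \<and>
     (\<forall>(m, b)\<in>set bs. m < n \<and> box_ok b \<and> real (steps b k []) \<le> T \<and>
        (\<exists>p\<in>set (leaves b k []). accepted p \<and> Max (set p) = m) \<and>
        (\<forall>p\<in>set (leaves b k []). accepted p \<longrightarrow> m \<le> Max (set p))) \<and>
     mset (concat (map (\<lambda>(m, b). filter accepted (leaves b k [])) bs)) = mset (filter accepted ps)"

lemma keyed_boxes_exist: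
  assumes bs: "\<And>b. b \<in> set bs \<Longrightarrow> box_ok b \<and> real (steps b k []) \<le> T"
  shows "\<exists>bs'. keyed_boxes T bs' (concat (map (\<lambda>b. leaves b k []) bs)) \<and> length bs' \<le> length bs"
proof -
  let ?A = "\<lambda>b. {p \<in> set (leaves b k []). accepted p}"
  define key where "key b = Min ((\<lambda>p. Max (set p)) ` ?A b)" for b
  define xs where "xs = map (\<lambda>b. (key b, b)) (filter (\<lambda>b. ?A b \<noteq> {}) bs)"
  define ys where "ys = sort_key fst xs"
  have mxs: "mset ys = mset xs" by (simp add: ys_def)
  have "m < n \<and> box_ok b \<and> real (steps b k []) \<le> T \<and>
        (\<exists>p\<in>set (leaves b k []). accepted p \<and> Max (set p) = m) \<and>
        (\<forall>p\<in>set (leaves b k []). accepted p \<longrightarrow> m \<le> Max (set p))" if mb: "(m, b) \<in> set ys" for m b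
  proof -
    have "(m, b) \<in> set xs" using mb mxs by (metis set_mset_mset)
    then have b: "b \<in> set bs" "?A b \<noteq> {}" "m = key b" by (auto simp: xs_def)
    have fin: "finite ((\<lambda>p. Max (set p)) ` ?A b)" by simp
    have "key b \<in> (\<lambda>p. Max (set p)) ` ?A b" unfolding key_def using b fin by (intro Min_in) auto
    then obtain p where p: "p \<in> ?A b" "Max (set p) = m" using b(3) by auto
    have "length p = k" "set p \<subseteq> {..<n}"
      using leaf_ranks[of b "[]" k p] bs[OF b(1)] p by (auto simp: valid_def)
    then have "Max (set p) \<in> {..<n}" using k_pos Max_in[of "set p"] by (cases p) auto
    moreover have "m \<le> Max (set q)" if "q \<in> ?A b" for q
      unfolding b(3) key_def using fin that by (intro Min_le) auto
    ultimately show ?thesis using p bs[OF b(1)] by auto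
  qed
  moreover have "sorted (map fst ys)" by (simp add: ys_def)
  moreover have "mset (concat (map (\<lambda>(m, b). filter accepted (leaves b k [])) ys)) =
      mset (filter accepted (concat (map (\<lambda>b. leaves b k []) bs)))"
  proof -
    have "mset (concat (map (\<lambda>(m, b). filter accepted (leaves b k [])) ys)) =
       mset (concat (map (\<lambda>(m, b). filter accepted (leaves b k [])) xs))"
      unfolding mset_concat sum_mset_sum_list[symmetric] mset_map mxs ..
    also have "concat (map (\<lambda>(m, b). filter accepted (leaves b k [])) xs) =
        filter accepted (concat (map (\<lambda>b. leaves b k []) bs))"
      unfolding xs_def by (induction bs) (auto simp: filter_empty_conv)
    finally show ?thesis .
  qed
  moreover have "length ys \<le> length bs" by (simp add: ys_def xs_def)
  ultimately show ?thesis unfolding keyed_boxes_def by (intro exI[of _ ys]) auto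
qed

text \<open>The factor \<open>k * (L + 1)\<close> comes from cutting each stored range into boxes,
  the factor \<open>L\<close> from the overlap of the ranges, and the summand \<open>n\<close> from
  allowing one box per range regardless of its cost.\<close>

lemma box_lists_exist:
  fixes B :: real
  assumes B: "2 \<le> B" and r: "k = Suc r"
  shows "\<exists>bx. (\<forall>l<n. keyed_boxes (B + 1 + 2 * k) (bx l) (root_leaves l (bound_in L 0 n l))) \<and>
    real (\<Sum>l<n. length (bx l)) \<le> real n +
      real (k * (L + 1)) * real L * real (run_cost r [] EB (EB + n)) / B"
proof -
  have nL: "n - 0 < 2 ^ L" using E_range by linarith
  let ?bd = "bound_in L 0 n"
  let ?c = "\<lambda>l h. run_cost r [] (EB + l) (EB + h)"
  have "\<exists>bs. keyed_boxes (B + 1 + 2 * k) bs (root_leaves l (?bd l)) \<and>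
      real (length bs) \<le> 1 + real (k * (L + 1)) * real (?c l (?bd l)) / B" if l: "l < n" for l
  proof -
    have bd: "l < ?bd l" "?bd l \<le> n" using bound_in_range[OF _ l nL] by auto
    have bok: "box_ok []" by (simp add: box_ok_def)
    have "\<exists>bs. concat (map (\<lambda>b. leaves b k []) bs) = run_leaves r [] (EB + l) (EB + ?bd l) \<and>
      (\<forall>b\<in>set bs. box_ok b \<and> real (steps b k []) \<le> B + 1 + 2 * k) \<and>
      real (length bs) \<le> 1 + real (L + r * (L + 1)) * real (?c l (?bd l)) / B"
    proof (rule box_decomposition[OF B _ _ _ leads_to_Nil])
      have "EB + ?bd l - (EB + l) \<le> n" using bd by simp
      then show "EB + ?bd l - (EB + l) \<le> 2 ^ L" using nL by linarith
    qed (use bd E_range r bok in auto)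
    then obtain bs where bs: "concat (map (\<lambda>b. leaves b k []) bs) = root_leaves l (?bd l)"
      "\<And>b. b \<in> set bs \<Longrightarrow> box_ok b \<and> real (steps b k []) \<le> B + 1 + 2 * k"
      "real (length bs) \<le> 1 + real (L + r * (L + 1)) * real (?c l (?bd l)) / B"
      unfolding root_leaves_run[OF r] by blast
    have "real (L + r * (L + 1)) * real (?c l (?bd l)) / B \<le> real (k * (L + 1)) * real (?c l (?bd l)) / B"
      using B r by (intro divide_right_mono mult_right_mono) auto
    moreover obtain bs' where "keyed_boxes (B + 1 + 2 * k) bs' (root_leaves l (?bd l))"
      "length bs' \<le> length bs"
      using keyed_boxes_exist[of bs "B + 1 + 2 * k"] bs(1,2) by auto
    ultimately show ?thesis using bs(3) by (intro exI[of _ bs']) linarith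
  qed
  then obtain bx where bx: "\<And>l. l < n \<Longrightarrow> keyed_boxes (B + 1 + 2 * k) (bx l) (root_leaves l (?bd l))"
    "\<And>l. l < n \<Longrightarrow> real (length (bx l)) \<le> 1 + real (k * (L + 1)) * real (?c l (?bd l)) / B"
    by metis
  have "real (\<Sum>l<n. length (bx l)) \<le> (\<Sum>l<n. 1 + real (k * (L + 1)) * real (?c l (?bd l)) / B)"
    unfolding of_nat_sum by (intro sum_mono bx) auto
  also have "\<dots> = real n + real (k * (L + 1)) * real (\<Sum>l<n. ?c l (?bd l)) / B"
    by (simp add: sum.distrib sum_distrib_left sum_divide_distrib)
  also have "\<dots> \<le> real n + real (k * (L + 1)) * real (L * ?c 0 n) / B"
  proof -
    have "(\<Sum>l = 0..<n. ?c l (?bd l)) \<le> L * ?c 0 n"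
      by (rule sum_bound_in) (use nL in \<open>auto intro!: run_cost_append\<close>)
    then have "real (\<Sum>l<n. ?c l (?bd l)) \<le> real (L * ?c 0 n)"
      by (simp only: of_nat_le_iff atLeast0LessThan)
    then show ?thesis using B by (intro add_left_mono divide_right_mono mult_left_mono) auto
  qed
  finally show ?thesis using bx by (intro exI[of _ bx]) (auto simp: mult.assoc)
qed

end

context graph_memory
begin

lemma keyed_boxes_found:
  assumes kb: "keyed_boxes T bs ps" and att: "\<And>u v. u \<le> v \<Longrightarrow> v < n \<Longrightarrow> att u \<le> att v"
  shows "sorted_wrt (\<lambda>x y. att (fst x) \<le> att (fst y)) bs"
    and "y \<in> set bs \<Longrightarrow> found (snd y) \<noteq> [] \<longleftrightarrow> att (fst y) \<le> x2"
    and "mset (concat (map (\<lambda>y. found (snd y)) bs)) = mset (filter all_ok ps)"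
proof -
  have less: "fst y < n" if "y \<in> set bs" for y using kb that by (auto simp: keyed_boxes_def)
  have "sorted_wrt (\<lambda>x y. fst x \<le> fst y) bs" using kb by (simp add: keyed_boxes_def sorted_map)
  then show "sorted_wrt (\<lambda>x y. att (fst x) \<le> att (fst y)) bs"
    by (rule sorted_wrt_mono_rel[rotated]) (use att less in auto)
  have f: "filter all_ok qs = filter in_range (filter accepted qs)" for qs
    by (auto simp: all_ok_def conj_commute intro: filter_cong)
  show "found (snd y) \<noteq> [] \<longleftrightarrow> att (fst y) \<le> x2" if y: "y \<in> set bs"
  proof -
    have box: "box_ok (snd y)" "fst y < n" using kb y by (auto simp: keyed_boxes_def)
    \<comment> \<open>Attributes grow with ranks, so the vertex of maximal rank decides about
      \<open>x2\<close>.\<close>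
    have ir: "in_range p \<longleftrightarrow> att (Max (set p)) \<le> x2" if p: "p \<in> set (leaves (snd y) k [])" for p
    proof -
      have p: "length p = k" "set p \<subseteq> {..<n}"
        using leaf_ranks[OF box(1) _ _ p] by (auto simp: valid_def)
      have mx: "Max (set p) \<in> set p" using p k_pos by (intro Max_in) auto
      have "att u \<le> att (Max (set p))" if "u \<in> set p" for u
        using that mx p by (intro att) auto
      then show ?thesis using mx p unfolding in_range_def by (metis in_set_conv_nth order_trans)
    qed
    obtain p where p: "p \<in> set (leaves (snd y) k [])" "accepted p" "Max (set p) = fst y"
      using kb y by (fastforce simp: keyed_boxes_def)
    have min: "fst y \<le> Max (set q)" if "q \<in> set (leaves (snd y) k [])" "accepted q" for q
      using kb y that by (fastforce simp: keyed_boxes_def)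
    have mx: "Max (set q) < n" if "q \<in> set (leaves (snd y) k [])" for q
      using leaf_ranks[OF box(1) _ _ that] k_pos Max_in[of "set q"] by (cases q) (auto simp: valid_def)
    show ?thesis
    proof
      assume "found (snd y) \<noteq> []"
      then obtain q where q: "q \<in> set (leaves (snd y) k [])" "accepted q" "in_range q"
        by (auto simp: found_def filter_empty_conv all_ok_def)
      then show "att (fst y) \<le> x2" using att[OF min[OF q(1,2)] mx[OF q(1)]] ir[OF q(1)] by simp
    next
      assume "att (fst y) \<le> x2"
      then show "found (snd y) \<noteq> []" using p ir[OF p(1)] by (auto simp: found_def filter_empty_conv all_ok_def)
    qed
  qed
  let ?X = "concat (map (\<lambda>(m, b). filter accepted (leaves b k [])) bs)"
  have K: "mset ?X = mset (filter accepted ps)" using kb by (simp only: keyed_boxes_def)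
  have "concat (map (\<lambda>y. found (snd y)) bs) = filter in_range ?X"
    by (induction bs) (auto simp: found_def f)
  then show "mset (concat (map (\<lambda>y. found (snd y)) bs)) = mset (filter all_ok ps)"
    by (simp only: f mset_filter[of in_range] K)
qed

end

section \<open>The memory contents\<close>

lemma sorted_nth_less_iff:
  fixes xs :: "nat list"
  assumes "sorted_wrt (<) xs" "i < length xs"
  shows "xs ! i < x \<longleftrightarrow> i < card {c \<in> set xs. c < x}"
  using assms
proof (induction xs arbitrary: i)
  case (Cons y ys)
  show ?case
  proof (cases "y < x")
    case True
    have "{c \<in> set (y # ys). c < x} = insert y {c \<in> set ys. c < x}" using True by auto
    moreover have "y \<notin> {c \<in> set ys. c < x}" using Cons.prems by auto
    ultimately have "card {c \<in> set (y # ys). c < x} = Suc (card {c \<in> set ys. c < x})" by simp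
    then show ?thesis using Cons True by (cases i) auto
  next
    case False
    then have e: "{c \<in> set (y # ys). c < x} = {}" using Cons.prems by auto
    have "\<not> (y # ys) ! i < x" using False Cons.prems by (cases i) (auto dest!: nth_mem)
    then show ?thesis unfolding e by simp
  qed
qed simp

lemma concat_nth_const:
  assumes "\<And>x. length (f x) = l" "i < length xs" "j < l"
  shows "concat (map f xs) ! (l * i + j) = f (xs ! i) ! j"
  using assms(2)
proof (induction xs arbitrary: i)
  case (Cons x xs)
  then show ?case using assms(1,3)
    by (cases i) (auto simp: nth_append algebra_simps)
qed simp

lemma length_concat_const: "(\<And>x. length (f x) = l) \<Longrightarrow> length (concat (map f xs)) = l * length xs"
  by (induction xs) auto

lemma concat_nth_sum:
  "q < N \<Longrightarrow> i < length (f q) \<Longrightarrow>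
    concat (map f [0..<N]) ! ((\<Sum>q'<q. length (f q')) + i) = f q ! i \<and>
    (\<Sum>q'<q. length (f q')) + i < length (concat (map f [0..<N]))"
proof (induction N)
  case (Suc N)
  have l: "length (concat (map f [0..<N])) = (\<Sum>q'<N. length (f q'))" for N
    by (induction N) auto
  show ?case
  proof (cases "q = N")
    case True
    then show ?thesis using Suc.prems l[of N] by (simp add: nth_append)
  next
    case False
    then show ?thesis using Suc by (simp add: nth_append)
  qed
qed simp

lemma length_concat_sum: "length (concat (map f [0..<N])) = (\<Sum>q<N. length (f q))"
  by (induction N) auto

section \<open>Layout of ranks and arcs\<close>

locale ranked_graph =
  fixes k n L :: nat and adj :: "nat \<Rightarrow> nat \<Rightarrow> bool"
  assumes n_pos: "0 < n"
    and adj_less: "\<And>u v. adj u v \<Longrightarrow> u < n \<and> v < n"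
    and adj_sym: "\<And>u v. adj u v \<Longrightarrow> adj v u"
    and deg_pos: "\<And>u. u < n \<Longrightarrow> \<exists>v. adj u v"
    and L: "n + card {(u, v). adj u v} < 2 ^ L"
begin

definition codes :: "nat list" where
  "codes = sorted_list_of_set ((\<lambda>(u, v). (u + 1) * n + v) ` {(u, v). adj u v})"

abbreviation EB :: nat where "EB \<equiv> 4 + k"

text \<open>Codes start at \<open>(u + 1) * n\<close>, not at \<open>u * n\<close>, so that the
  ranks precede them and act as an extra row: the root runs through them as through an adjacency
  list, and a rank is never mistaken for an arc in the binary search.\<close>

definition E :: "nat list" where "E = [0..<n] @ codes"

definition EE :: nat where "EE = EB + length E"

text \<open>In a strictly sorted list the number of smaller entries is a position, so counting the
  codes below \<open>(u + 1) * n\<close> yields the address where row \<open>u\<close>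
  begins.\<close>

definition off :: "nat \<Rightarrow> nat" where
  "off u = EB + n + card {c \<in> set codes. c < (u + 1) * n}"

definition val :: "nat \<Rightarrow> nat" where
  "val t = E ! (t - EB) mod n"

lemma finite_arcs: "finite {(u, v). adj u v}"
  by (rule finite_subset[of _ "{..<n} \<times> {..<n}"]) (use adj_less in auto)

lemma set_codes: "set codes = {(u + 1) * n + v | u v. adj u v}"
  using finite_arcs by (auto simp: codes_def)

lemma code_inj:
  assumes "(u + 1) * n + v = (u' + 1) * n + v'" "v < n" "v' < n"
  shows "u = u' \<and> v = v'"
proof -
  have "((u + 1) * n + v) div n = u + 1" "((u' + 1) * n + v') div n = u' + 1"
    "((u + 1) * n + v) mod n = v" "((u' + 1) * n + v') mod n = v'"
    using assms(2,3) by auto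
  then show ?thesis using assms(1) by (metis add_right_cancel)
qed

lemma length_codes: "length codes = card {(u, v). adj u v}"
proof -
  have "inj_on (\<lambda>(u, v). (u + 1) * n + v) {(u, v). adj u v}"
  proof (rule inj_onI)
    fix a b assume "a \<in> {(u, v). adj u v}" "b \<in> {(u, v). adj u v}"
      "(\<lambda>(u, v). (u + 1) * n + v) a = (\<lambda>(u, v). (u + 1) * n + v) b"
    then show "a = b"
      using code_inj[of "fst a" "snd a" "fst b" "snd b"] adj_less by (auto simp: case_prod_unfold prod_eq_iff)
  qed
  then show ?thesis by (simp add: codes_def card_image)
qed

lemma codes_sorted: "sorted_wrt (<) codes"
  unfolding codes_def by (rule strict_sorted_list_of_set)

lemma codes_ge: "c \<in> set codes \<Longrightarrow> n \<le> c"
  by (auto simp: set_codes algebra_simps)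

lemma E_sorted: "sorted_wrt (<) E"
  using codes_sorted codes_ge by (auto simp: E_def sorted_wrt_append strict_sorted_iff intro: less_le_trans)

lemma E_nth_less: "s < t \<Longrightarrow> t < length E \<Longrightarrow> E ! s < E ! t"
  using E_sorted by (rule sorted_wrt_nth_less)

lemma EE_eq: "EE = EB + n + length codes"
  by (simp add: EE_def E_def)

lemma E_code: "u < n \<Longrightarrow> v < n \<Longrightarrow> adj u v \<longleftrightarrow> (\<exists>t<length E. E ! t = (u + 1) * n + v)"
proof -
  assume uv: "u < n" "v < n"
  have "adj u v \<longleftrightarrow> (u + 1) * n + v \<in> set codes"
  proof
    assume "(u + 1) * n + v \<in> set codes"
    then obtain u' v' where "(u + 1) * n + v = (u' + 1) * n + v'" "adj u' v'"
      unfolding set_codes by blast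
    then show "adj u v" using code_inj[of u v u' v'] uv adj_less by blast
  qed (auto simp: set_codes)
  also have "\<dots> \<longleftrightarrow> (u + 1) * n + v \<in> set E" using n_pos by (simp add: E_def algebra_simps)
  finally show ?thesis by (auto simp: in_set_conv_nth)
qed

lemma off_iff:
  assumes "t < length E"
  shows "E ! t < (u + 1) * n \<longleftrightarrow> EB + t < off u"
proof (cases "t < n")
  case True
  then show ?thesis by (auto simp: E_def off_def nth_append algebra_simps)
next
  case False
  then show ?thesis
    using sorted_nth_less_iff[OF codes_sorted, of "t - n" "(u + 1) * n"] assms
    by (auto simp: E_def off_def nth_append)
qed

lemma off_bounds: "EB + n \<le> off u" "off u \<le> EE" "off u \<le> off (Suc u)"
proof -
  show "EB + n \<le> off u" by (simp add: off_def)
  have "card {c \<in> set codes. c < (u + 1) * n} \<le> card (set codes)" by (intro card_mono) auto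
  also have "\<dots> \<le> length codes" by (rule card_length)
  finally show "off u \<le> EE" by (simp add: off_def EE_eq)
  have "(u + 1) * n \<le> (Suc u + 1) * n" by (intro mult_right_mono) auto
  then have "card {c \<in> set codes. c < (u + 1) * n} \<le> card {c \<in> set codes. c < (Suc u + 1) * n}"
    by (intro card_mono) auto
  then show "off u \<le> off (Suc u)" by (simp only: off_def add_left_mono)
qed

lemma row_code:
  assumes t: "off u \<le> t" "t < off (Suc u)"
  shows "\<exists>v. adj u v \<and> E ! (t - EB) = (u + 1) * n + v \<and> val t = v"
proof -
  have b: "EB + n \<le> t" "t < EE" using t off_bounds[of u] off_bounds[of "Suc u"] by linarith+
  then have t': "t - EB < length E" "EB + (t - EB) = t" "\<not> t - EB < n" by (auto simp: EE_def)
  then have "E ! (t - EB) \<in> set codes" by (auto simp: E_def nth_append)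
  then obtain u' v where c: "E ! (t - EB) = (u' + 1) * n + v" "adj u' v" unfolding set_codes by blast
  have v: "v < n" using adj_less c by blast
  have "\<not> E ! (t - EB) < (u + 1) * n" "E ! (t - EB) < (Suc u + 1) * n"
    using off_iff[OF t'(1), of u] off_iff[OF t'(1), of "Suc u"] t t'(2) by auto
  then have "(u + 1) * n \<le> (u' + 1) * n + v" "(u' + 1) * n + v < (u + 2) * n" using c by (auto simp: algebra_simps)
  then have "(u + 1) * n < (u' + 2) * n" "(u' + 1) * n < (u + 2) * n" using v by (auto simp: algebra_simps)
  \<comment> \<open>Cancelling \<open>n\<close> leaves \<open>u < u' + 1\<close> and
    \<open>u' < u + 1\<close>.\<close>
  then have "u' = u" by (metis (no_types) mult_less_cancel2 add_less_cancel_right One_nat_def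
      add_2_eq_Suc' less_Suc_eq less_antisym not_less_eq Suc_eq_plus1)
  then show ?thesis using c v by (auto simp: val_def)
qed

lemma search_axioms:
  assumes k: "0 < k"
    and "\<And>i j. j \<in> set (nb i) \<Longrightarrow> j < i" "\<And>i. i < k \<Longrightarrow> length (nb i) \<le> k"
    "\<And>i. 0 < i \<Longrightarrow> i < k \<Longrightarrow> nb i \<noteq> []"
  shows "search k nb n EB EE L off val adj"
proof
  show "EB + n \<le> EE" "EE - EB < 2 ^ L" using L by (simp_all add: EE_eq length_codes)
  show "val t < n" for t using n_pos by (simp add: val_def)
  show "val (EB + v) = v" if "v < n" for v using that by (simp add: val_def E_def nth_append)
  show "EB + n \<le> off u \<and> off u \<le> EE" for u using off_bounds by simp
  fix u assume u: "u < n"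
  show "off u \<le> off (Suc u)" by (rule off_bounds)
  have "inj_on val {off u..<off (Suc u)}"
  proof (rule inj_onI)
    fix s t assume st: "s \<in> {off u..<off (Suc u)}" "t \<in> {off u..<off (Suc u)}" "val s = val t"
    then have eq: "E ! (s - EB) = E ! (t - EB)" using row_code[of u s] row_code[of u t] by auto
    have b: "EB \<le> s" "EB \<le> t" "s < EE" "t < EE"
      using st off_bounds[of u] off_bounds[of "Suc u"] by auto
    then have "s - EB < length E" "t - EB < length E" by (auto simp: EE_def)
    then have "s - EB = t - EB" using E_nth_less[of "s - EB" "t - EB"] E_nth_less[of "t - EB" "s - EB"] eq
      by (metis less_irrefl nat_neq_iff)
    then show "s = t" using b by simp
  qed
  then show "distinct (map val [off u..<off (Suc u)])" by (simp add: distinct_map)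
  show "set (map val [off u..<off (Suc u)]) = {v. adj u v}"
  proof (intro equalityI subsetI)
    fix v assume "v \<in> set (map val [off u..<off (Suc u)])"
    then show "v \<in> {v. adj u v}" using row_code[of u] by auto
  next
    fix v assume "v \<in> {v. adj u v}"
    then have a: "adj u v" and v: "v < n" using adj_less by auto
    then obtain t where t: "t < length E" "E ! t = (u + 1) * n + v" using E_code[OF u v] by blast
    have "\<not> E ! t < (u + 1) * n" "E ! t < (Suc u + 1) * n" using t v by auto
    then have "EB + t \<in> {off u..<off (Suc u)}" using off_iff[OF t(1)] by (simp only: atLeastLessThan_iff not_less)
    moreover have "val (EB + t) = v" using t v by (simp add: val_def)
    ultimately show "v \<in> set (map val [off u..<off (Suc u)])" by force
  qed
qed (use assms n_pos adj_less deg_pos in auto)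

end

section \<open>The query program and the complete memory image\<close>

definition init :: "nat \<Rightarrow> com" where
  "init k = Seq (Const 2 1) (Seq (Const 3 2) (Seq (Const 15 (2 * k + 1)) (Seq (Const 5 (4 + k))
     (Seq (Const 20 0) (Seq (Load 4 20) (Seq (Load 6 2) (Seq (Load 7 3) (Seq (Const 20 3) (Load 8 20)))))))))"

text \<open>The entry word 0 stands for a graph without edges, whose memory is empty and must not be accessed.\<close>

definition listing_program ::
  "nat \<Rightarrow> (nat \<Rightarrow> nat \<Rightarrow> nat list) \<Rightarrow> (nat \<Rightarrow> (nat \<times> nat) list) \<Rightarrow> (nat \<Rightarrow> (nat \<times> nat) list) \<Rightarrow> com" where
  "listing_program k nb ne le = Cond (Equal 0 1) Skip (Seq (init k)
     (foldr (\<lambda>a. Seq (pattern.list_from k (nb a) (ne a) (le a) (4 + a))) [0..<k] Skip))"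

definition encode_box :: "nat \<Rightarrow> nat \<times> (nat \<times> nat) list \<Rightarrow> nat list" where
  "encode_box k mb = map (\<lambda>c. if c = 0 then fst mb
     else if (c - 1) div 2 < length (snd mb)
       then (if odd c then fst (snd mb ! ((c - 1) div 2)) else snd (snd mb ! ((c - 1) div 2))) else 0)
     [0..<2 * k + 1]"

lemma length_encode_box [simp]: "length (encode_box k mb) = 2 * k + 1"
  by (simp add: encode_box_def)

locale listing_data = ranked_graph +
  fixes nb :: "nat \<Rightarrow> nat \<Rightarrow> nat list" and ne le :: "nat \<Rightarrow> (nat \<times> nat) list"
    and vid :: "nat \<Rightarrow> nat" and att :: "nat \<Rightarrow> real" and T :: real and w :: nat
    and bx :: "nat \<Rightarrow> nat \<Rightarrow> (nat \<times> (nat \<times> nat) list) list"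
  assumes k_pos: "0 < k"
    and nb_less: "\<And>a i j. a < k \<Longrightarrow> j \<in> set (nb a i) \<Longrightarrow> j < i"
    and nb_length: "\<And>a i. a < k \<Longrightarrow> i < k \<Longrightarrow> length (nb a i) \<le> k"
    and nb_nonempty: "\<And>a i. a < k \<Longrightarrow> 0 < i \<Longrightarrow> i < k \<Longrightarrow> nb a i \<noteq> []"
    and ne_less: "\<And>a i j. a < k \<Longrightarrow> (i, j) \<in> set (ne a) \<Longrightarrow> i < k \<and> j < k"
    and le_less: "\<And>a i j. a < k \<Longrightarrow> (i, j) \<in> set (le a) \<Longrightarrow> i < k \<and> j < k"
    and att_mono: "\<And>u v. u \<le> v \<Longrightarrow> v < n \<Longrightarrow> att u \<le> att v"
    and vid_less: "\<And>u. u < n \<Longrightarrow> vid u < 2 ^ w"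
    and bx: "\<And>a l. a < k \<Longrightarrow> l < n \<Longrightarrow>
      search.keyed_boxes k (nb a) (ne a) (le a) n EB EE off val adj T (bx a l)
        (search.root_leaves k (nb a) EB EE off val adj l (bound_in L 0 n l))"
begin

definition box_list :: "nat \<Rightarrow> (nat \<times> (nat \<times> nat) list) list" where
  "box_list q = bx (q div n) (q mod n)"

definition box_base :: nat where
  "box_base = EE + 2 * n + k * n + 2"

text \<open>The start of slot \<open>q + 1\<close> doubles as the end of slot \<open>q\<close>,
  which is why \<open>k * n + 1\<close> starts are stored and the tables of consecutive roots share
  an entry.\<close>

definition box_start :: "nat \<Rightarrow> nat" where
  "box_start q = box_base + (2 * k + 1) * (\<Sum>q'<q. length (box_list q'))"

definition boxes :: "nat list" where
  "boxes = concat (map (encode_box k) (concat (map box_list [0..<k * n])))"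

text \<open>Cells 0 to 3 are read by \<open>init\<close>; cell \<open>4 + a\<close> holds the base
  of the table of root \<open>a\<close>, which \<open>list_from (4 + a)\<close> loads.\<close>

definition header :: "nat list" where
  "header = [n, EE, EE, EE + n + 1] @ map (\<lambda>a. EE + 2 * n + 1 + a * n) [0..<k]"

definition ws :: "nat list" where
  "ws = header @ E @ map off [0..<n + 1] @ map vid [0..<n] @ map box_start [0..<k * n + 1] @ boxes"

definition M :: memory where
  "M = \<lparr>words = ws, reals = map att [0..<n]\<rparr>"

lemma length_header [simp]: "length header = EB"
  by (simp add: header_def)

lemma length_boxes: "length boxes = (2 * k + 1) * (\<Sum>q<k * n. length (box_list q))"
  unfolding boxes_def by (subst length_concat_const) (auto simp: length_concat_sum)

lemma length_ws: "length ws = box_base + length boxes"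
  by (simp add: ws_def EE_def box_base_def)

lemma space_used_M: "space_used M = box_base + (2 * k + 1) * (\<Sum>q<k * n. length (box_list q)) + n"
  by (simp add: space_used_def M_def length_ws length_boxes)

lemma ws_header: "i < EB \<Longrightarrow> ws ! i = header ! i"
  by (simp add: ws_def nth_append)

lemma ws_E: "t < length E \<Longrightarrow> ws ! (EB + t) = E ! t"
  by (simp add: ws_def nth_append)

lemma nth_append_skip: "length xs = l \<Longrightarrow> (xs @ ys) ! (l + i) = ys ! i"
  by auto

lemma ws_off: "u \<le> n \<Longrightarrow> ws ! (EE + u) = off u"
proof -
  assume u: "u \<le> n"
  have "ws = (header @ E) @ (map off [0..<n + 1] @ map vid [0..<n] @ map box_start [0..<k * n + 1] @ boxes)"
    by (simp add: ws_def)
  moreover have "length (header @ E) = EE" by (simp add: EE_def)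
  ultimately have "ws ! (EE + u) = (map off [0..<n + 1] @ map vid [0..<n] @ map box_start [0..<k * n + 1] @ boxes) ! u"
    using nth_append_skip by metis
  then show ?thesis using u by (simp add: nth_append del: upt_Suc)
qed

lemma ws_vid: "u < n \<Longrightarrow> ws ! (EE + n + 1 + u) = vid u"
proof -
  assume u: "u < n"
  have "ws = (header @ E @ map off [0..<n + 1]) @ (map vid [0..<n] @ map box_start [0..<k * n + 1] @ boxes)"
    by (simp add: ws_def)
  moreover have "length (header @ E @ map off [0..<n + 1]) = EE + n + 1" by (simp add: EE_def)
  ultimately have "ws ! (EE + n + 1 + u) = (map vid [0..<n] @ map box_start [0..<k * n + 1] @ boxes) ! u"
    using nth_append_skip by metis
  then show ?thesis using u by (simp add: nth_append del: upt_Suc)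
qed

lemma ws_start: "q \<le> k * n \<Longrightarrow> ws ! (EE + 2 * n + 1 + q) = box_start q"
proof -
  assume q: "q \<le> k * n"
  have "ws = (header @ E @ map off [0..<n + 1] @ map vid [0..<n]) @ (map box_start [0..<k * n + 1] @ boxes)"
    by (simp add: ws_def)
  moreover have "length (header @ E @ map off [0..<n + 1] @ map vid [0..<n]) = EE + 2 * n + 1" by (simp add: EE_def)
  ultimately have "ws ! (EE + 2 * n + 1 + q) = (map box_start [0..<k * n + 1] @ boxes) ! q"
    using nth_append_skip by metis
  then show ?thesis using q by (simp add: nth_append del: upt_Suc)
qed

lemma ws_boxes: "ws ! (box_base + i) = boxes ! i"
proof -
  have "ws = (header @ E @ map off [0..<n + 1] @ map vid [0..<n] @ map box_start [0..<k * n + 1]) @ boxes"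
    by (simp add: ws_def)
  moreover have "length (header @ E @ map off [0..<n + 1] @ map vid [0..<n] @ map box_start [0..<k * n + 1]) = box_base"
    by (simp add: EE_def box_base_def)
  ultimately show ?thesis using nth_append_skip by metis
qed

lemma ws_box:
  assumes q: "q < k * n" and i: "i < length (box_list q)" and c: "c < 2 * k + 1"
  shows "ws ! (box_start q + (2 * k + 1) * i + c) = encode_box k (box_list q ! i) ! c"
    and "box_start q + (2 * k + 1) * i + c < length ws"
proof -
  let ?s = "(\<Sum>q'<q. length (box_list q')) + i"
  have s: "concat (map box_list [0..<k * n]) ! ?s = box_list q ! i" "?s < length (concat (map box_list [0..<k * n]))"
    using concat_nth_sum[of q "k * n" i box_list] q i by auto
  have eq: "box_start q + (2 * k + 1) * i + c = box_base + ((2 * k + 1) * ?s + c)"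
    by (simp add: box_start_def algebra_simps)
  show "ws ! (box_start q + (2 * k + 1) * i + c) = encode_box k (box_list q ! i) ! c"
    unfolding eq ws_boxes unfolding boxes_def s(1)[symmetric]
    by (rule concat_nth_const[OF length_encode_box s(2) c])
  have "(2 * k + 1) * ?s + c < (2 * k + 1) * Suc ?s" using c by simp
  also have "\<dots> \<le> (2 * k + 1) * length (concat (map box_list [0..<k * n]))"
    using s(2) by (intro mult_left_mono) auto
  finally show "box_start q + (2 * k + 1) * i + c < length ws"
    unfolding eq length_ws length_boxes length_concat_sum by simp
qed

lemma box_start_Suc: "box_start (Suc q) = box_start q + (2 * k + 1) * length (box_list q)"
  by (simp add: box_start_def algebra_simps)

lemma box_start_le: "q \<le> k * n \<Longrightarrow> box_start q \<le> length ws"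
proof -
  assume "q \<le> k * n"
  then have "(\<Sum>q'<q. length (box_list q')) \<le> (\<Sum>q'<k * n. length (box_list q'))"
    by (intro sum_mono2) auto
  then show ?thesis by (simp add: box_start_def length_ws length_boxes)
qed

lemma search: "a < k \<Longrightarrow> search k (nb a) n EB EE L off val adj"
  by (rule search_axioms) (use k_pos nb_less nb_length nb_nonempty in auto)

lemma slot: "a < k \<Longrightarrow> l < n \<Longrightarrow> a * n + l < k * n \<and> box_list (a * n + l) = bx a l"
proof -
  assume a: "a < k" "l < n"
  have "a * n + l < Suc a * n" using a by simp
  also have "\<dots> \<le> k * n" using a by (intro mult_right_mono) auto
  finally show ?thesis using a by (simp add: box_list_def)
qed

lemma box_wellformed:
  assumes "a < k" "l < n" "mb \<in> set (bx a l)"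
  shows "fst mb < n" "length (snd mb) \<le> k" "\<And>s e. (s, e) \<in> set (snd mb) \<Longrightarrow> EB \<le> s \<and> s < e \<and> e \<le> EE"
    "real (search.steps (nb a) EB EE off val adj (snd mb) k []) \<le> T"
proof -
  interpret S: search k "nb a" "ne a" "le a" n EB EE L off val adj by (rule search[OF assms(1)])
  have "fst mb < n \<and> S.box_ok (snd mb) \<and> real (S.steps (snd mb) k []) \<le> T"
    using bx[OF assms(1,2)] assms(3) unfolding S.keyed_boxes_def by (cases mb) auto
  then show "fst mb < n" "length (snd mb) \<le> k"
    "\<And>s e. (s, e) \<in> set (snd mb) \<Longrightarrow> EB \<le> s \<and> s < e \<and> e \<le> EE" "real (S.steps (snd mb) k []) \<le> T"
    by (auto simp: S.box_ok_def)
qed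

end

section \<open>Correctness of the query program\<close>

context listing_data
begin

definition matches :: "nat \<Rightarrow> real \<Rightarrow> real \<Rightarrow> nat list set" where
  "matches a x1 x2 = {p. length p = k \<and> set p \<subseteq> {..<n} \<and> (\<forall>i<k. \<forall>j\<in>set (nb a i). adj (p ! j) (p ! i)) \<and>
     (\<forall>(i, j)\<in>set (ne a). p ! i \<noteq> p ! j) \<and> (\<forall>(i, j)\<in>set (le a). p ! i < p ! j) \<and>
     x1 \<le> att (p ! 0) \<and> (\<forall>i<k. att (p ! i) \<le> x2)}"

definition picture :: "nat \<Rightarrow> nat list \<Rightarrow> nat ugraph" where
  "picture a p = \<lparr>verts = (\<lambda>i. vid (p ! i)) ` {..<k},
     edges = {{vid (p ! j), vid (p ! i)} | i j. i < k \<and> j \<in> set (nb a i)}\<rparr>"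

context
  assumes size: "2 * length ws < 2 ^ w" and code: "(n + 1) * n < 2 ^ w"
begin

lemma EE_le: "EE \<le> length ws" "box_base \<le> length ws"
  by (simp_all add: length_ws box_base_def)

lemma words_less: "x \<in> set ws \<Longrightarrow> x < 2 ^ w"
proof -
  have len: "x < 2 ^ w" if "x \<le> length ws" for x using that size by linarith
  have bb: "EE + 2 * n + k * n + 2 \<le> length ws" using EE_le by (simp add: box_base_def)
  assume "x \<in> set ws"
  then consider "x \<in> set header" | "x \<in> set E" | "x \<in> off ` {..n}" | "x \<in> vid ` {..<n}"
    | "x \<in> box_start ` {..k * n}" | "x \<in> set boxes"
    by (auto simp: ws_def)
  then show "x < 2 ^ w"
  proof cases
    case 1
    have "a * n \<le> k * n" if "a < k" for a using that by (intro mult_right_mono) auto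
    moreover from 1 have "x = n \<or> x = EE \<or> x = EE + n + 1 \<or> (\<exists>a<k. x = EE + 2 * n + 1 + a * n)"
      by (auto simp: header_def)
    ultimately have "x \<le> EE + 2 * n + k * n + 2" by (auto intro: le_SucI)
    then show ?thesis using bb by (intro len) linarith
  next
    case 2
    then show ?thesis
    proof (cases "x < n")
      case False
      then obtain u v where x: "x = (u + 1) * n + v" "adj u v"
        using 2 set_codes by (auto simp: E_def)
      then have "u < n" "v < n" using adj_less by auto
      then have "x < (u + 2) * n" using x by (simp add: algebra_simps)
      moreover have "(u + 2) * n \<le> (n + 1) * n" using \<open>u < n\<close> by (intro mult_right_mono) auto
      ultimately show ?thesis using code by linarith
    qed (use len bb in auto)
  next
    case 3
    then obtain u where "x = off u" by blast
    then show ?thesis using off_bounds(2)[of u] EE_le by (intro len) linarith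
  next
    case 4
    then show ?thesis using vid_less by auto
  next
    case 5
    then show ?thesis using box_start_le by (auto intro!: len)
  next
    case 6
    then obtain q mb where q: "q < k * n" "mb \<in> set (box_list q)" "x \<in> set (encode_box k mb)"
      by (auto simp: boxes_def)
    have a: "q div n < k" "q mod n < n" using q(1) n_pos by (auto simp: less_mult_imp_div_less)
    have mb: "mb \<in> set (bx (q div n) (q mod n))" using q(2) by (simp add: box_list_def)
    note wf = box_wellformed[OF a mb]
    from q(3) consider "x = fst mb" | "x = 0" | i where "i < length (snd mb)" "x = fst (snd mb ! i) \<or> x = snd (snd mb ! i)"
      by (auto simp: encode_box_def split: if_splits)
    then show ?thesis
    proof cases
      case 3
      then show ?thesis using wf(3)[of "fst (snd mb ! i)" "snd (snd mb ! i)"] EE_le by (auto intro!: len)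
    qed (use wf bb len in auto)
  qed
qed

lemma graph_memory: "a < k \<Longrightarrow> graph_memory k (nb a) (ne a) (le a) n EB EE L off val adj w M EE (EE + n + 1) vid att"
proof -
  assume a: "a < k"
  interpret S: search k "nb a" "ne a" "le a" n EB EE L off val adj by (rule search[OF a])
  have bb: "EE + 2 * n + k * n + 2 \<le> length ws" "EB < length ws" using EE_le by (auto simp: box_base_def EE_def)
  show ?thesis
  proof
    show "2 * k + 1 < 2 ^ w" "3 < (2::nat) ^ w" using bb size by linarith+
    show "2 * length (words M) < 2 ^ w" using size by (simp add: M_def)
    show "(n + 1) * n < 2 ^ w" by (rule code)
    show "EE \<le> length (words M)" using EE_le by (simp add: M_def)
    show "words M ! s < words M ! t" if "EB \<le> s" "s < t" "t < EE" for s t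
      using ws_E[of "s - EB"] ws_E[of "t - EB"] E_nth_less[of "s - EB" "t - EB"] that
      by (simp add: M_def EE_def)
    show "adj u v \<longleftrightarrow> (\<exists>t\<ge>EB. t < EE \<and> words M ! t = (u + 1) * n + v)" if "u < n" "v < n" for u v
    proof -
      have "(\<exists>t\<ge>EB. t < EE \<and> words M ! t = (u + 1) * n + v) \<longleftrightarrow> (\<exists>t<length E. E ! t = (u + 1) * n + v)"
      proof
        assume "\<exists>t\<ge>EB. t < EE \<and> words M ! t = (u + 1) * n + v"
        then obtain t where "EB \<le> t" "t < EE" "words M ! t = (u + 1) * n + v" by blast
        then show "\<exists>t<length E. E ! t = (u + 1) * n + v"
          using ws_E[of "t - EB"] by (intro exI[of _ "t - EB"]) (simp add: M_def EE_def)
      next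
        assume "\<exists>t<length E. E ! t = (u + 1) * n + v"
        then obtain t where "t < length E" "E ! t = (u + 1) * n + v" by blast
        then show "\<exists>t\<ge>EB. t < EE \<and> words M ! t = (u + 1) * n + v"
          using ws_E[of t] by (intro exI[of _ "EB + t"]) (simp add: M_def EE_def)
      qed
      then show ?thesis using E_code[OF that] by simp
    qed
    show "words M ! t mod n = val t" if "EB \<le> t" "t < EE" for t
      using ws_E[of "t - EB"] that by (simp add: M_def EE_def val_def)
    show "EE + u < length (words M) \<and> words M ! (EE + u) = off u" if "u \<le> n" for u
      using ws_off[OF that] bb that by (simp add: M_def)
    show "EE + n + 1 + u < length (words M) \<and> words M ! (EE + n + 1 + u) = vid u" if "u < n" for u
      using ws_vid[OF that] bb that by (simp add: M_def)
    show "length (reals M) = n" "\<And>u. u < n \<Longrightarrow> reals M ! u = att u" by (simp_all add: M_def)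
  qed (use ne_less[OF a] le_less[OF a] in auto)
qed

lemma list_from_run:
  assumes a: "a < k" and x: "x1 \<le> x2" and s: "graph_memory.env k n EB EE M EE (EE + n + 1) x1 x2 s"
    and Z: "length (ne a) + length (le a) \<le> Z" and T: "0 \<le> T"
  shows "wp w (pattern.list_from k (nb a) (ne a) (le a) (4 + a)) s (\<lambda>t s'.
     (\<exists>ps. distinct ps \<and> set ps = matches a x1 x2 \<and> mset (outputs t) = mset (map (picture a) ps)) \<and>
     delay_at_most (5 + real L * (2 * (real ((20 + 6 * L) * (k + 1) + 20 * k + 2 * Z + 20) * T + 10) + 10)) t \<and>
     same_outer {9..14} s s')"
proof -
  interpret G: graph_memory k "nb a" "ne a" "le a" n EB EE L off val adj w M EE "EE + n + 1" vid att x1 x2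
    by (rule graph_memory[OF a])
  have bb: "EE + 2 * n + k * n + 2 \<le> length ws" "EB + n \<le> length ws" using EE_le G.E_range by (auto simp: box_base_def)
  have hd: "words M ! (4 + a) = EE + 2 * n + 1 + a * n"
    using ws_header[of "4 + a"] a by (simp add: M_def header_def nth_append)
  have st: "words M ! (words M ! (4 + a) + l) = box_start (a * n + l)" if "l \<le> n" for l
  proof -
    have "Suc a * n \<le> k * n" using a by (intro mult_right_mono) auto
    then have "a * n + l \<le> k * n" using that by simp
    then show ?thesis using ws_start[of "a * n + l"] unfolding hd by (simp add: M_def add.assoc)
  qed
  \<comment> \<open>Costs are natural numbers, so rounding the real bound \<open>T\<close> down
    loses nothing.\<close>
  define B where "B = nat \<lfloor>T\<rfloor>"
  have BT: "real B \<le> T" using T by (simp add: B_def)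
  \<comment> \<open>Ranks are sorted by attribute, so those with attribute below \<open>x1\<close>
    form an initial segment.\<close>
  obtain j0 where j0: "j0 \<le> n" "\<And>r. r < n \<Longrightarrow> att r < x1 \<longleftrightarrow> r < j0"
  proof (cases "\<exists>r<n. x1 \<le> att r")
    case True
    define j where "j = (LEAST r. r < n \<and> x1 \<le> att r)"
    have j: "j < n" "x1 \<le> att j" using LeastI_ex[OF True] by (auto simp: j_def)
    have "att r < x1 \<longleftrightarrow> r < j" if "r < n" for r
    proof
      assume "r < j" then show "att r < x1" using not_less_Least[of r] that unfolding j_def by force
    next
      assume "att r < x1" then show "r < j" using att_mono[of j r] j that by force
    qed
    then show ?thesis using that[of j] j by auto
  qed (use that[of n] in force)
  note kb = bx[OF a]
  have boxes_at: "G.boxes_at (words M ! (words M ! (4 + a) + l)) (bx a l)" if l: "l < n" for l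
  proof -
    have q: "a * n + l < k * n" "box_list (a * n + l) = bx a l" using slot[OF a l] by auto
    have start: "words M ! (words M ! (4 + a) + l) = box_start (a * n + l)" using st l by simp
    have "box_start (Suc (a * n + l)) \<le> length ws" using q(1) by (intro box_start_le) simp
    then have end_le: "box_start (a * n + l) + (2 * k + 1) * length (bx a l) \<le> length ws"
      unfolding box_start_Suc q(2) .
    have "words M ! (box_start (a * n + l) + (2 * k + 1) * i) = fst (bx a l ! i) \<and> fst (bx a l ! i) < n \<and>
        G.box_at (box_start (a * n + l) + (2 * k + 1) * i) (snd (bx a l ! i))" if i: "i < length (bx a l)" for i
    proof -
      let ?b = "bx a l ! i" let ?p = "box_start (a * n + l) + (2 * k + 1) * i"
      have b: "?b \<in> set (bx a l)" using i by simp
      note wf = box_wellformed[OF a l b]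
      have cell: "words M ! (?p + c) = encode_box k ?b ! c" "?p + c < length ws" if "c < 2 * k + 1" for c
        using ws_box[OF q(1) _ that, of i] q(2) i by (simp_all add: M_def)
      have e: "encode_box k ?b ! (1 + 2 * j) = (if j < length (snd ?b) then fst (snd ?b ! j) else 0)"
        "encode_box k ?b ! (2 + 2 * j) = (if j < length (snd ?b) then snd (snd ?b ! j) else 0)" if "j < k" for j
      proof -
        have "(1 + 2 * j - 1) div 2 = j" "(2 + 2 * j - 1) div 2 = j" by presburger+
        then show "encode_box k ?b ! (1 + 2 * j) = (if j < length (snd ?b) then fst (snd ?b ! j) else 0)"
          "encode_box k ?b ! (2 + 2 * j) = (if j < length (snd ?b) then snd (snd ?b ! j) else 0)"
          using that by (simp_all add: encode_box_def del: upt_Suc)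
      qed
      have "encode_box k ?b ! 0 = fst ?b" by (simp add: encode_box_def del: upt_Suc)
      then have "words M ! ?p = fst ?b" using cell(1)[of 0] by simp
      moreover have "G.box_at ?p (snd ?b)"
        unfolding G.box_at_def
      proof (intro conjI allI impI)
        show "G.box_ok (snd ?b)" using wf by (auto simp: G.box_ok_def)
        show "?p + 2 * k < length (words M)" using cell(2)[of "2 * k"] by (simp add: M_def)
        fix j assume j: "j < k"
        show "words M ! (?p + 1 + 2 * j) = (if j < length (snd ?b) then fst (snd ?b ! j) else 0)"
          using cell(1)[of "1 + 2 * j"] e(1)[OF j] j by (simp add: add.assoc)
        show "words M ! (?p + 2 + 2 * j) = (if j < length (snd ?b) then snd (snd ?b ! j) else 0)"
          using cell(1)[of "2 + 2 * j"] e(2)[OF j] j by (simp add: add.assoc)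
      qed
      ultimately show ?thesis using wf(1) by simp
    qed
    then show ?thesis unfolding start G.boxes_at_def using end_le by (simp add: M_def)
  qed
  have run: "wp w (G.list_from (4 + a)) s (\<lambda>t s'.
      mset (outputs t) = mset (map G.rep (filter G.all_ok (G.root_leaves j0 n))) \<and>
      delay_at_most (5 + L * (2 * real (G.unit_time * B + 10) + 10)) t \<and> same_outer {9..14} s s')"
  proof (rule G.list_from_correct[where bx = "bx a", OF _ _ _ _ _ _ j0 s])
    show "4 + a < length (words M)" using a bb by (simp add: M_def)
    have "Suc a * n \<le> k * n" using a by (intro mult_right_mono) auto
    then show "words M ! (4 + a) + n < length (words M)" using bb unfolding hd by (simp add: M_def)
    fix l assume l: "l < n"
    show "G.boxes_at (words M ! (words M ! (4 + a) + l)) (bx a l) \<and>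
      words M ! (words M ! (4 + a) + l + 1) = words M ! (words M ! (4 + a) + l) + (2 * k + 1) * length (bx a l)"
      using boxes_at[OF l] st[of l] st[of "l + 1"] l box_start_Suc[of "a * n + l"] slot[OF a l]
      by (simp add: add.assoc) (simp add: One_nat_def)
    show "sorted_wrt (\<lambda>x y. att (fst x) \<le> att (fst y)) (bx a l)"
      by (rule G.keyed_boxes_found(1)[OF kb[OF l] att_mono])
    show "mset (concat (map (\<lambda>x. G.found (snd x)) (bx a l))) = mset (filter G.all_ok (G.root_leaves l (bound_in L 0 n l)))"
      by (rule G.keyed_boxes_found(3)[OF kb[OF l] att_mono])
    fix y assume y: "y \<in> set (bx a l)"
    have "real (G.steps (snd y) k []) \<le> T" by (rule box_wellformed(4)[OF a l y])
    then have "G.steps (snd y) k [] \<le> B" unfolding B_def by (simp add: le_nat_floor)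
    then show "(G.found (snd y) \<noteq> [] \<longleftrightarrow> att (fst y) \<le> x2) \<and> G.steps (snd y) k [] \<le> B"
      using G.keyed_boxes_found(2)[OF kb[OF l] _ y] att_mono by blast
  qed
  define ps where "ps = filter G.all_ok (G.root_leaves j0 n)"
  have "distinct ps" unfolding ps_def using G.root_leaves_set(1)[of n j0] by simp
  moreover have "set ps = matches a x1 x2"
  proof -
    have "p \<in> set ps \<longleftrightarrow> p \<in> matches a x1 x2" for p
    proof -
      have "j0 \<le> p ! 0 \<and> p ! 0 < n \<longleftrightarrow> x1 \<le> att (p ! 0)" if "length p = k" "set p \<subseteq> {..<n}"
      proof -
        have "p ! 0 \<in> set p" using that k_pos by (intro nth_mem) simp
        then have "p ! 0 < n" using that by auto
        then show ?thesis using j0(2)[of "p ! 0"] by auto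
      qed
      then show ?thesis
        unfolding ps_def using G.root_leaves_set(2)[of n j0]
        by (auto simp: matches_def G.all_ok_def G.accepted_def G.in_range_def G.valid_def)
    qed
    then show ?thesis by blast
  qed
  moreover have "G.rep = picture a"
    by (auto simp: G.rep_def picture_def fun_eq_iff G.edge_list_iff image_iff) (metis G.edge_list_iff)+
  moreover have "real (G.unit_time * B) \<le> real ((20 + 6 * L) * (k + 1) + 20 * k + 2 * Z + 20) * T"
    unfolding of_nat_mult using Z BT by (intro mult_mono) (auto simp: G.unit_time_def)
  then have "5 + real L * (2 * real (G.unit_time * B + 10) + 10) \<le>
      5 + real L * (2 * (real ((20 + 6 * L) * (k + 1) + 20 * k + 2 * Z + 20) * T + 10) + 10)"
    by (intro add_left_mono mult_left_mono add_right_mono) simp_all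
  ultimately show ?thesis
    using run by (auto elim!: wp_mono delay_mono simp: ps_def[symmetric])
qed

end

end

text \<open>Register 1 starts at zero, so the entry word 0 passes the first test and the memory is
  never read.\<close>

lemma listing_program_empty:
  "\<exists>t s'. exec w (listing_program k nb ne le) (query_state 0 \<M> x1 x2) t s' \<and> mem s' = \<M> \<and>
     outputs t = [] \<and> length t \<le> 2"
proof -
  have "wp w (listing_program k nb ne le) (query_state 0 \<M> x1 x2)
      (\<lambda>t s'. mem s' = \<M> \<and> outputs t = [] \<and> length t \<le> 2)"
    unfolding listing_program_def by (simp add: query_state_def)
  then show ?thesis unfolding wp_def by blast
qed

context listing_data
begin

definition list_delay :: "nat \<Rightarrow> real" where
  "list_delay Z = 5 + real L * (2 * (real ((20 + 6 * L) * (k + 1) + 20 * k + 2 * Z + 20) * T + 10) + 10)"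

lemma listing_program_correct:
  assumes size: "2 * length ws < 2 ^ w" and code: "(n + 1) * n < 2 ^ w"
    and x: "x1 \<le> x2" and Z: "\<And>a. a < k \<Longrightarrow> length (ne a) + length (le a) \<le> Z" and T: "0 \<le> T"
    and inj: "\<And>a. a < k \<Longrightarrow> inj_on (picture a) (matches a x1 x2)"
    and disj: "\<And>a b. a < k \<Longrightarrow> b < k \<Longrightarrow> a \<noteq> b \<Longrightarrow>
      picture a ` matches a x1 x2 \<inter> picture b ` matches b x1 x2 = {}"
  shows "\<exists>t s'. exec w (listing_program k nb ne le) (query_state 1 M x1 x2) t s' \<and> mem s' = M \<and>
     distinct (outputs t) \<and> set (outputs t) = (\<Union>a<k. picture a ` matches a x1 x2) \<and>
     delay_at_most (20 + real k * list_delay Z) t"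
proof -
  let ?OFF = EE and ?VID = "EE + n + 1"
  let ?env = "graph_memory.env k n EB EE M ?OFF ?VID x1 x2"
  note G = graph_memory[OF size code]
  have env_def: "?env s \<longleftrightarrow> mem s = M \<and> rreg s 0 = x1 \<and> rreg s 1 = x2 \<and> reg s 1 = 0 \<and> reg s 2 = 1 \<and>
     reg s 3 = 2 \<and> reg s 4 = n \<and> reg s 5 = EB \<and> reg s 6 = EE \<and> reg s 7 = ?OFF \<and> reg s 8 = ?VID \<and>
     reg s 15 = 2 * k + 1" for s
    using graph_memory.env_def[OF G[OF k_pos]] .
  \<comment> \<open>Outputs are tracked as multisets because the boxes deliver the labellings
    ordered by key, not in search order. Distinctness is recovered at the end from
    \<open>inj\<close> and \<open>disj\<close>.\<close>
  have fold: "wp w (foldr (\<lambda>a. Seq (pattern.list_from k (nb a) (ne a) (le a) (4 + a))) as Skip) s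
     (\<lambda>t s'. mset (outputs t) = (\<Sum>a\<leftarrow>as. image_mset (picture a) (mset_set (matches a x1 x2))) \<and>
       delay_at_most (1 + real (length as) * list_delay Z) t \<and> mem s' = M)"
    if "set as \<subseteq> {..<k}" "?env s" for as s
    using that
  proof (induction as arbitrary: s)
    case Nil
    then show ?case by (simp add: env_def delay_length)
  next
    case (Cons a as)
    have a: "a < k" using Cons.prems by simp
    show ?case
      unfolding foldr_Cons comp_def wp_Seq
    proof (rule wp_mono[OF list_from_run[OF size code a x Cons.prems(2) Z[OF a] T]], elim conjE exE)
      fix t s1 ps assume t: "delay_at_most (5 + real L * (2 * (real ((20 + 6 * L) * (k + 1) + 20 * k + 2 * Z + 20) * T + 10) + 10)) t"
        and s1: "same_outer {9..14} s s1"
        and ps: "distinct ps" "set ps = matches a x1 x2" "mset (outputs t) = mset (map (picture a) ps)"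
      have e1: "?env s1" by (rule graph_memory.env_outer[OF G[OF a] Cons.prems(2) s1]) simp
      have m: "mset (outputs t) = image_mset (picture a) (mset_set (matches a x1 x2))"
        using ps by (simp add: mset_set_set[symmetric])
      have as: "set as \<subseteq> {..<k}" using Cons.prems(1) by simp
      show "wp w (foldr (\<lambda>a. Seq (pattern.list_from k (nb a) (ne a) (le a) (4 + a))) as Skip) s1
         (\<lambda>t2 s2. mset (outputs (t @ t2)) = (\<Sum>a\<leftarrow>a # as. image_mset (picture a) (mset_set (matches a x1 x2))) \<and>
           delay_at_most (1 + real (length (a # as)) * list_delay Z) (t @ t2) \<and> mem s2 = M)"
      proof (rule wp_mono[OF Cons.IH[OF as e1]], elim conjE)
        fix t2 s2 assume "mset (outputs t2) = (\<Sum>a\<leftarrow>as. image_mset (picture a) (mset_set (matches a x1 x2)))"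
          and d: "delay_at_most (1 + real (length as) * list_delay Z) t2" and "mem s2 = M"
        moreover have "delay_at_most (list_delay Z + (1 + real (length as) * list_delay Z)) (t @ t2)"
          using t d unfolding list_delay_def[symmetric] by (rule delay_append)
        then have "delay_at_most (1 + real (length (a # as)) * list_delay Z) (t @ t2)"
          by (simp add: algebra_simps)
        ultimately show "mset (outputs (t @ t2)) = (\<Sum>a\<leftarrow>a # as. image_mset (picture a) (mset_set (matches a x1 x2))) \<and>
           delay_at_most (1 + real (length (a # as)) * list_delay Z) (t @ t2) \<and> mem s2 = M"
          using m by simp
      qed
    qed
  qed
  define s0 where "s0 = query_state 1 M x1 x2"
  have big: "EE + n + 1 \<le> length ws" "EB \<le> length ws" "2 * k + 1 < 2 ^ w" "3 < (2::nat) ^ w"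
  proof -
    show "EE + n + 1 \<le> length ws" "EB \<le> length ws" by (simp_all add: length_ws box_base_def EE_def)
    show "2 * k + 1 < 2 ^ w" "3 < (2::nat) ^ w"
      using graph_memory.k_bound[OF G[OF k_pos]] graph_memory.three[OF G[OF k_pos]] by auto
  qed
  have sm: "1 mod 2 ^ w = (1::nat)" "2 mod 2 ^ w = (2::nat)" "3 mod 2 ^ w = (3::nat)"
    "(2 * k + 1) mod 2 ^ w = 2 * k + 1" "(4 + k) mod 2 ^ w = 4 + k"
    by (intro mod_less; use big size in linarith)+
  have w: "0 < w" using big(4) by (cases w) auto
  \<comment> \<open>\<open>init\<close> reads cells 1 and 2 through the constant registers 2 and 3,
    which hold the addresses 1 and 2.\<close>
  have h: "ws ! 0 = n" "ws ! 1 = EE" "ws ! 2 = EE" "ws ! 3 = EE + n + 1"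
    "0 < length ws" "1 < length ws" "2 < length ws" "3 < length ws"
  proof -
    show "ws ! 0 = n" "ws ! 1 = EE" "ws ! 2 = EE" "ws ! 3 = EE + n + 1"
      using ws_header[of 0] ws_header[of 1] ws_header[of 2] ws_header[of 3]
      by (auto simp: header_def nth_append numeral_eq_Suc One_nat_def)
    have "i < length ws" if "i < 4" for i using that big(2) by linarith
    from this[of 0] this[of 1] this[of 2] this[of 3]
    show "0 < length ws" "1 < length ws" "2 < length ws" "3 < length ws" by simp_all
  qed
  have "ws \<noteq> []" using h(5) by simp
  then have init: "wp w (init k) s0 (\<lambda>t s'. outputs t = [] \<and> length t \<le> 10 \<and> ?env s')"
    unfolding init_def s0_def env_def by (simp add: query_state_def sm h M_def w)
  have "wp w (listing_program k nb ne le) s0 (\<lambda>t s'.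
      mset (outputs t) = (\<Sum>a\<leftarrow>[0..<k]. image_mset (picture a) (mset_set (matches a x1 x2))) \<and>
      delay_at_most (20 + real k * list_delay Z) t \<and> mem s' = M)"
  proof -
    have t: "\<not> test_holds (Equal 0 1) s0" by (simp add: s0_def query_state_def)
    show ?thesis
      unfolding listing_program_def wp_Cond wp_Seq using t apply (simp only: if_False wp_Seq)
    proof (rule wp_mono[OF init], elim conjE)
      fix t s1 assume t: "outputs t = []" "length t \<le> 10" and e: "?env s1"
      have as: "set [0..<k] \<subseteq> {..<k}" by auto
      show "wp w (foldr (\<lambda>a. Seq (pattern.list_from k (nb a) (ne a) (le a) (4 + a))) [0..<k] Skip) s1
         (\<lambda>t2 s2. mset (outputs (Tick # t @ t2)) = (\<Sum>a\<leftarrow>[0..<k]. image_mset (picture a) (mset_set (matches a x1 x2))) \<and>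
           delay_at_most (20 + real k * list_delay Z) (Tick # t @ t2) \<and> mem s2 = M)"
      proof (rule wp_mono[OF fold[OF as e]], elim conjE)
        fix t2 s2 assume "mset (outputs t2) = (\<Sum>a\<leftarrow>[0..<k]. image_mset (picture a) (mset_set (matches a x1 x2)))"
          and d: "delay_at_most (1 + real (length [0..<k]) * list_delay Z) t2" and "mem s2 = M"
        moreover have "delay_at_most (11 + (1 + real (length [0..<k]) * list_delay Z)) ((Tick # t) @ t2)"
          using d t by (intro delay_append) (auto intro: delay_length)
        then have "delay_at_most (20 + real k * list_delay Z) (Tick # t @ t2)"
          unfolding append_Cons by (rule delay_mono) simp
        ultimately show "mset (outputs (Tick # t @ t2)) = (\<Sum>a\<leftarrow>[0..<k]. image_mset (picture a) (mset_set (matches a x1 x2))) \<and>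
           delay_at_most (20 + real k * list_delay Z) (Tick # t @ t2) \<and> mem s2 = M"
          using t by simp
      qed
    qed
  qed
  then obtain t s' where run: "exec w (listing_program k nb ne le) s0 t s'" "mem s' = M"
    "delay_at_most (20 + real k * list_delay Z) t"
    and m: "mset (outputs t) = (\<Sum>a\<leftarrow>[0..<k]. image_mset (picture a) (mset_set (matches a x1 x2)))"
    unfolding wp_def by blast
  have fin: "finite (matches a x1 x2)" for a
    by (rule finite_subset[OF _ finite_lists_length_eq[of "{..<n}" k]]) (auto simp: matches_def)
  have "\<exists>ps. set ps = matches a x1 x2 \<and> distinct ps" for a
    using finite_distinct_list[OF fin] by blast
  then obtain ps where ps: "\<And>a. set (ps a) = matches a x1 x2" "\<And>a. distinct (ps a)" by metis
  have m': "mset (outputs t) = mset (concat (map (\<lambda>a. map (picture a) (ps a)) [0..<k]))"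
    unfolding m mset_concat by (simp add: ps(1)[symmetric] mset_set_set ps(2) comp_def)
  have "distinct (concat (map (\<lambda>a. map (picture a) (ps a)) [0..<k]))"
    by (rule distinct_concat_map) (use inj disj ps in \<open>auto simp: distinct_map\<close>)
  then have "distinct (outputs t)" using m' mset_eq_imp_distinct_iff by blast
  moreover have "set (outputs t) = set (concat (map (\<lambda>a. map (picture a) (ps a)) [0..<k]))"
    using m' by (rule mset_eq_setD)
  then have "set (outputs t) = (\<Union>a<k. picture a ` matches a x1 x2)"
    using ps(1) by (auto simp: atLeast0LessThan)
  ultimately show ?thesis using run unfolding s0_def by blast
qed

end

section \<open>Occurrences and symmetry breaking\<close>

definition copy :: "('a \<Rightarrow> 'b) \<Rightarrow> 'a ugraph \<Rightarrow> 'b ugraph" where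
  "copy h Q = \<lparr>verts = h ` verts Q, edges = (\<lambda>e. h ` e) ` edges Q\<rparr>"

lemma copy_cong: "simple_graph Q \<Longrightarrow> (\<And>x. x \<in> verts Q \<Longrightarrow> h x = h' x) \<Longrightarrow> copy h Q = copy h' Q"
  unfolding copy_def simple_graph_def by (auto intro!: image_cong simp: subset_iff)

lemma occurrences_iff:
  assumes Q: "simple_graph Q" and G: "simple_graph G"
  shows "H \<in> occurrences Q G \<longleftrightarrow> (\<exists>h. inj_on h (verts Q) \<and> h ` verts Q \<subseteq> verts G \<and>
    (\<forall>e\<in>edges Q. h ` e \<in> edges G) \<and> H = copy h Q)"
proof
  assume "H \<in> occurrences Q G"
  then obtain h where h: "subgraph_of H G" "bij_betw h (verts Q) (verts H)" "edges H = (\<lambda>e. h ` e) ` edges Q"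
    by (auto simp: occurrences_def isomorphic_graphs_def)
  then show "\<exists>h. inj_on h (verts Q) \<and> h ` verts Q \<subseteq> verts G \<and>
    (\<forall>e\<in>edges Q. h ` e \<in> edges G) \<and> H = copy h Q"
    by (intro exI[of _ h]) (auto simp: copy_def subgraph_of_def bij_betw_def)
next
  assume "\<exists>h. inj_on h (verts Q) \<and> h ` verts Q \<subseteq> verts G \<and>
    (\<forall>e\<in>edges Q. h ` e \<in> edges G) \<and> H = copy h Q"
  then obtain h where h: "inj_on h (verts Q)" "h ` verts Q \<subseteq> verts G" "\<And>e. e \<in> edges Q \<Longrightarrow> h ` e \<in> edges G"
    and H: "H = copy h Q" by blast
  have "card (h ` e) = 2" "h ` e \<subseteq> h ` verts Q" if "e \<in> edges Q" for e
  proof -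
    have "e \<subseteq> verts Q" "card e = 2" using Q that by (auto simp: simple_graph_def)
    then show "card (h ` e) = 2" "h ` e \<subseteq> h ` verts Q" using h(1) by (auto simp: card_image inj_on_subset)
  qed
  then have "simple_graph H" using Q unfolding H simple_graph_def copy_def by auto
  then have "subgraph_of H G" using h unfolding H subgraph_of_def copy_def by auto
  moreover have "isomorphic_graphs Q H"
    unfolding isomorphic_graphs_def using h(1) by (intro exI[of _ h]) (auto simp: H copy_def bij_betw_def)
  ultimately show "H \<in> occurrences Q G" by (simp add: occurrences_def)
qed

definition connected_order :: "'a ugraph \<Rightarrow> 'a list \<Rightarrow> bool" where
  "connected_order Q xs \<longleftrightarrow> distinct xs \<and> set xs \<subseteq> verts Q \<and>
     (\<forall>i<length xs. 0 < i \<longrightarrow> (\<exists>j<i. {xs ! j, xs ! i} \<in> edges Q))"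

lemma connected_order_exists:
  assumes Q: "simple_graph Q" "connected_graph Q" and a: "a \<in> verts Q"
  shows "\<exists>xs. connected_order Q xs \<and> set xs = verts Q \<and> xs ! 0 = a"
proof -
  have fin: "finite (verts Q)" using Q(1) by (simp add: simple_graph_def)
  have "\<exists>xs. connected_order Q xs \<and> length xs = Suc m \<and> xs ! 0 = a" if "Suc m \<le> card (verts Q)" for m
    using that
  proof (induction m)
    case 0
    then show ?case using a by (intro exI[of _ "[a]"]) (auto simp: connected_order_def)
  next
    case (Suc m)
    then obtain xs where xs: "connected_order Q xs" "length xs = Suc m" "xs ! 0 = a" by auto
    have "card (set xs) = Suc m" using xs by (simp add: connected_order_def distinct_card)
    then obtain v where v: "v \<in> verts Q" "v \<notin> set xs"
      using Suc.prems card_mono[of "set xs" "verts Q"] by force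
    have "(a, v) \<in> {(a, b). {a, b} \<in> edges Q}\<^sup>*" using Q(2) a v by (auto simp: connected_graph_def)
    moreover have "a \<in> set xs" using xs by (metis nth_mem zero_less_Suc)
    \<comment> \<open>A path from \<open>a\<close> to a vertex outside \<open>xs\<close> has to
      leave \<open>xs\<close> along some edge.\<close>
    ultimately have "\<exists>u y. u \<in> set xs \<and> y \<notin> set xs \<and> {u, y} \<in> edges Q"
      using v(2) by (induction rule: rtrancl_induct) auto
    then obtain u y where uy: "u \<in> set xs" "y \<notin> set xs" "{u, y} \<in> edges Q" by blast
    have y: "y \<in> verts Q" using uy(3) Q(1) by (auto simp: simple_graph_def)
    obtain j where j: "j < length xs" "xs ! j = u" using uy(1) by (auto simp: in_set_conv_nth)
    have "connected_order Q (xs @ [y])"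
      unfolding connected_order_def
    proof (intro conjI allI impI)
      fix i assume i: "i < length (xs @ [y])" "0 < i"
      show "\<exists>j<i. {(xs @ [y]) ! j, (xs @ [y]) ! i} \<in> edges Q"
      proof (cases "i < length xs")
        case True
        then obtain j where "j < i" "{xs ! j, xs ! i} \<in> edges Q"
          using xs(1) i by (auto simp: connected_order_def)
        then show ?thesis using True by (intro exI[of _ j]) (auto simp: nth_append)
      next
        case False
        then have "i = length xs" using i by simp
        then show ?thesis using uy(3) j by (intro exI[of _ j]) (auto simp: nth_append)
      qed
    qed (use xs(1) uy(2) y in \<open>auto simp: connected_order_def\<close>)
    then show ?case using xs by (intro exI[of _ "xs @ [y]"]) (auto simp: nth_append)
  qed
  moreover have "0 < card (verts Q)" using a fin by (auto simp: card_gt_0_iff)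
  ultimately obtain xs where xs: "connected_order Q xs" "length xs = card (verts Q)" "xs ! 0 = a"
    by (metis Suc_pred le_refl)
  then have "set xs = verts Q"
    using fin by (intro card_subset_eq) (auto simp: connected_order_def distinct_card)
  then show ?thesis using xs by blast
qed

section \<open>Automorphisms and canonical labellings\<close>

definition automorphisms :: "'a ugraph \<Rightarrow> ('a \<Rightarrow> 'a) set" where
  "automorphisms Q = {\<sigma>. \<sigma> permutes verts Q \<and> (\<lambda>e. \<sigma> ` e) ` edges Q = edges Q}"

text \<open>Symmetry breaking: for an injective labelling \<open>g\<close>, the conditions \<open>g x < g y\<close> for the pairs
  \<open>(x, y)\<close> below say that \<open>g\<close> is lexicographically least among all \<open>g \<circ> \<sigma>\<close>.\<close>

definition symmetry_pairs :: "'a ugraph \<Rightarrow> 'a list \<Rightarrow> ('a \<times> 'a) set" where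
  "symmetry_pairs Q vs = {(vs ! i, \<sigma> (vs ! i)) | i \<sigma>. \<sigma> \<in> automorphisms Q \<and> i < length vs \<and>
     (\<forall>j<i. \<sigma> (vs ! j) = vs ! j) \<and> \<sigma> (vs ! i) \<noteq> vs ! i}"

definition canonical :: "'a ugraph \<Rightarrow> 'a list \<Rightarrow> ('a \<Rightarrow> nat) \<Rightarrow> bool" where
  "canonical Q vs g \<longleftrightarrow> (\<forall>(x, y)\<in>symmetry_pairs Q vs. g x < g y)"

lemma automorphism_permutes: "\<sigma> \<in> automorphisms Q \<Longrightarrow> \<sigma> permutes verts Q"
  unfolding automorphisms_def by blast

lemma automorphism_inv: "\<sigma> \<in> automorphisms Q \<Longrightarrow> inv \<sigma> \<in> automorphisms Q"
proof -
  assume "\<sigma> \<in> automorphisms Q"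
  then have s: "\<sigma> permutes verts Q" "(\<lambda>e. \<sigma> ` e) ` edges Q = edges Q"
    unfolding automorphisms_def by blast+
  have "inv \<sigma> ` \<sigma> ` e = e" for e using permutes_inv_o(2)[OF s(1)] by (simp add: image_comp)
  then have "(\<lambda>e. inv \<sigma> ` e) ` (\<lambda>e. \<sigma> ` e) ` edges Q = edges Q" by (simp add: image_image)
  then have "(\<lambda>e. inv \<sigma> ` e) ` edges Q = edges Q" by (simp only: s(2))
  then show ?thesis using permutes_inv[OF s(1)] unfolding automorphisms_def by blast
qed

lemma automorphism_comp:
  "\<sigma> \<in> automorphisms Q \<Longrightarrow> \<tau> \<in> automorphisms Q \<Longrightarrow> \<sigma> \<circ> \<tau> \<in> automorphisms Q"
proof -
  assume a: "\<sigma> \<in> automorphisms Q" "\<tau> \<in> automorphisms Q"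
  have "(\<lambda>e. (\<sigma> \<circ> \<tau>) ` e) ` edges Q = (\<lambda>e. \<sigma> ` e) ` (\<lambda>e. \<tau> ` e) ` edges Q"
    by (simp add: image_image)
  also have "\<dots> = (\<lambda>e. \<sigma> ` e) ` edges Q" using a(2) by (simp only: automorphisms_def mem_Collect_eq)
  also have "\<dots> = edges Q" using a(1) by (simp only: automorphisms_def mem_Collect_eq)
  finally show ?thesis
    using permutes_compose[of \<tau> "verts Q" \<sigma>] a unfolding automorphisms_def by blast
qed

text \<open>At the first vertex that \<open>\<sigma>\<close> moves, \<open>\<sigma>\<close> and its
  inverse both yield a symmetry pair. For \<open>g\<close> and \<open>g \<circ> \<sigma>\<close>
  these demand opposite strict inequalities.\<close>

lemma canonical_unique:
  assumes vs: "set vs = verts Q" and s: "\<sigma> \<in> automorphisms Q"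
    and c: "canonical Q vs g" "canonical Q vs (g \<circ> \<sigma>)"
  shows "\<sigma> = id"
proof (rule ccontr)
  assume ne: "\<sigma> \<noteq> id"
  have p: "\<sigma> permutes verts Q" using s by (rule automorphism_permutes)
  have "\<exists>i<length vs. \<sigma> (vs ! i) \<noteq> vs ! i"
  proof (rule ccontr)
    assume "\<not> ?thesis"
    then have "\<sigma> x = x" if "x \<in> verts Q" for x using that vs by (metis in_set_conv_nth)
    then have "\<sigma> x = x" for x using p by (cases "x \<in> verts Q") (auto simp: permutes_def)
    then show False using ne by auto
  qed
  then obtain i where i: "i < length vs" "\<sigma> (vs ! i) \<noteq> vs ! i" "\<And>j. j < i \<Longrightarrow> \<sigma> (vs ! j) = vs ! j"
    using exists_least_iff[of "\<lambda>i. i < length vs \<and> \<sigma> (vs ! i) \<noteq> vs ! i"] by (metis less_trans)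
  have inv: "inv \<sigma> (\<sigma> x) = x" "\<sigma> (inv \<sigma> x) = x" for x
    using permutes_inverses[OF p] by auto
  have "(vs ! i, \<sigma> (vs ! i)) \<in> symmetry_pairs Q vs" using i s by (auto simp: symmetry_pairs_def)
  then have "g (vs ! i) < g (\<sigma> (vs ! i))" using c(1) by (auto simp: canonical_def)
  moreover have "(vs ! i, inv \<sigma> (vs ! i)) \<in> symmetry_pairs Q vs"
    using i automorphism_inv[OF s] inv unfolding symmetry_pairs_def by (auto intro!: exI[of _ "inv \<sigma>"] exI[of _ i]) metis+
  then have "g (\<sigma> (vs ! i)) < g (\<sigma> (inv \<sigma> (vs ! i)))" using c(2) by (auto simp: canonical_def)
  ultimately show False using inv by simp
qed

text \<open>A lexicographically least \<open>g \<circ> \<sigma>\<close> exists since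
  \<open>lexn\<close> over a well-founded order is well-founded. If it violated the pair of some
  \<open>\<tau>\<close>, composing with \<open>\<tau>\<close> would keep the labels before position
  \<open>i\<close> and lower the one at \<open>i\<close>.\<close>

lemma canonical_exists:
  assumes vs: "set vs = verts Q" and g: "inj_on g (verts Q)"
  shows "\<exists>\<sigma>\<in>automorphisms Q. canonical Q vs (g \<circ> \<sigma>)"
proof -
  define f where "f \<sigma> = map (\<lambda>x. g (\<sigma> x)) vs" for \<sigma>
  have "id \<in> automorphisms Q" by (auto simp: automorphisms_def permutes_id)
  moreover have "wf (lexn less_than (length vs))" by (rule wf_lexn) simp
  ultimately obtain \<sigma> where s: "\<sigma> \<in> automorphisms Q"
    and min: "\<And>\<tau>. (f \<tau>, f \<sigma>) \<in> lexn less_than (length vs) \<Longrightarrow> \<tau> \<notin> automorphisms Q"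
    using wfE_min[OF wf_inv_image, of "lexn less_than (length vs)" id "automorphisms Q" f]
    by (metis in_inv_image)
  have "canonical Q vs (g \<circ> \<sigma>)"
    unfolding canonical_def
  proof (intro ballI, clarify, rule ccontr)
    fix x y assume "(x, y) \<in> symmetry_pairs Q vs" and n: "\<not> (g \<circ> \<sigma>) x < (g \<circ> \<sigma>) y"
    then obtain i \<tau> where t: "\<tau> \<in> automorphisms Q" "i < length vs" "\<And>j. j < i \<Longrightarrow> \<tau> (vs ! j) = vs ! j"
      "\<tau> (vs ! i) \<noteq> vs ! i" "x = vs ! i" "y = \<tau> (vs ! i)"
      unfolding symmetry_pairs_def by blast
    have p: "\<sigma> permutes verts Q" "\<tau> permutes verts Q" using s t automorphism_permutes by blast+
    have V: "vs ! i \<in> verts Q" using nth_mem[OF t(2)] vs by simp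
    then have "\<tau> (vs ! i) \<in> verts Q" using p(2) by (simp add: permutes_in_image)
    then have V2: "\<sigma> (vs ! i) \<in> verts Q" "\<sigma> (\<tau> (vs ! i)) \<in> verts Q"
      using p(1) V by (simp_all add: permutes_in_image)
    have "\<sigma> (vs ! i) \<noteq> \<sigma> (\<tau> (vs ! i))" using t(4) permutes_inj[OF p(1)] by (metis injD)
    then have "g (\<sigma> (vs ! i)) \<noteq> g (\<sigma> (\<tau> (vs ! i)))" using g V2 by (meson inj_onD)
    then have less: "g (\<sigma> (\<tau> (vs ! i))) < g (\<sigma> (vs ! i))" using n t by simp
    have len: "length (f \<sigma>) = length vs" for \<sigma> by (simp add: f_def)
    have "take i (f (\<sigma> \<circ> \<tau>)) = take i (f \<sigma>)"
      by (rule nth_equalityI) (use t(2,3) in \<open>auto simp: f_def\<close>)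
    then have "f (\<sigma> \<circ> \<tau>) = take i (f \<sigma>) @ g (\<sigma> (\<tau> (vs ! i))) # drop (Suc i) (f (\<sigma> \<circ> \<tau>))"
      "f \<sigma> = take i (f \<sigma>) @ g (\<sigma> (vs ! i)) # drop (Suc i) (f \<sigma>)"
      using id_take_nth_drop[of i "f (\<sigma> \<circ> \<tau>)"] id_take_nth_drop[of i "f \<sigma>"] t(2) len
      by (simp_all add: f_def)
    then have "(f (\<sigma> \<circ> \<tau>), f \<sigma>) \<in> lexn less_than (length vs)"
      unfolding lexn_conv using less len by blast
    then show False using min automorphism_comp[OF s t(1)] by blast
  qed
  then show ?thesis using s by blast
qed

lemma equal_copies:
  assumes Q: "simple_graph Q" and g: "inj_on g (verts Q)" "inj_on g' (verts Q)" and eq: "copy g Q = copy g' Q"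
  shows "\<exists>\<sigma>\<in>automorphisms Q. \<forall>x\<in>verts Q. g' x = g (\<sigma> x)"
proof -
  let ?V = "verts Q"
  have im: "g ` ?V = g' ` ?V" "(\<lambda>e. g ` e) ` edges Q = (\<lambda>e. g' ` e) ` edges Q"
    using eq by (auto simp: copy_def)
  \<comment> \<open>The automorphism is \<open>g'\<close> followed by the inverse of
    \<open>g\<close>, extended by the identity to a permutation.\<close>
  define \<sigma> where "\<sigma> x = (if x \<in> ?V then inv_into ?V g (g' x) else x)" for x
  have gs: "g (\<sigma> x) = g' x" "\<sigma> x \<in> ?V" if "x \<in> ?V" for x
    using that im(1) by (auto simp: \<sigma>_def intro!: f_inv_into_f inv_into_into)
  have "inj_on \<sigma> ?V" using gs g(2) by (metis inj_on_def)
  moreover have fin: "finite ?V" using Q by (simp add: simple_graph_def)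
  ultimately have "bij_betw \<sigma> ?V ?V"
    using gs(2) by (auto simp: bij_betw_def endo_inj_surj image_subset_iff)
  then have p: "\<sigma> permutes ?V" by (rule bij_imp_permutes) (simp add: \<sigma>_def)
  have sub: "e \<subseteq> ?V" if "e \<in> edges Q" for e using Q that by (auto simp: simple_graph_def)
  have se: "\<sigma> ` e \<in> edges Q" if e: "e \<in> edges Q" for e
  proof -
    have "g ` \<sigma> ` e = g' ` e" unfolding image_image using gs(1) sub[OF e] by (intro image_cong) auto
    also have "\<dots> \<in> (\<lambda>e. g ` e) ` edges Q" unfolding im(2) using e by (rule imageI)
    finally obtain e' where e': "e' \<in> edges Q" "g ` \<sigma> ` e = g ` e'" by blast
    have "\<sigma> ` e \<subseteq> ?V" using gs(2) sub[OF e] by auto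
    then have "\<sigma> ` e = e'" using inj_on_image_eq_iff[OF g(1), of "\<sigma> ` e" e'] e'(2) sub[OF e'(1)] by simp
    then show ?thesis using e'(1) by simp
  qed
  have "inj_on (\<lambda>e. \<sigma> ` e) (edges Q)"
    using permutes_inj[OF p] by (auto intro!: inj_onI simp: inj_image_eq_iff)
  then have "(\<lambda>e. \<sigma> ` e) ` edges Q = edges Q"
    using se finite_edges[OF Q] by (intro endo_inj_surj) auto
  then show ?thesis using p gs(1) by (intro bexI[of _ \<sigma>]) (simp_all add: automorphisms_def)
qed

text \<open>The search order \<open>ord a\<close> depends on the root, whereas symmetry is broken
  along the one list \<open>vs\<close> for all roots. Hence the canonical labelling of an occurrence
  does not depend on the root, and its least rank determines the root.\<close>

locale pattern_graph =
  fixes Q :: "'a ugraph" and vs :: "'a list" and ord :: "nat \<Rightarrow> 'a list"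
  assumes Q: "simple_graph Q"
    and vs: "distinct vs" "set vs = verts Q" "2 \<le> length vs"
    and ord: "\<And>a. a < length vs \<Longrightarrow> connected_order Q (ord a) \<and> set (ord a) = verts Q \<and> ord a ! 0 = vs ! a"
begin

abbreviation k :: nat where "k \<equiv> length vs"

definition nb :: "nat \<Rightarrow> nat \<Rightarrow> nat list" where
  "nb a i = (if a < k \<and> i < k then filter (\<lambda>j. {ord a ! j, ord a ! i} \<in> edges Q) [0..<i] else [])"

definition ne :: "nat \<Rightarrow> (nat \<times> nat) list" where
  "ne a = filter (\<lambda>(i, j). j < i) (List.product [0..<k] [0..<k])"

text \<open>The pairs with first component 0 make the root the vertex of least rank, so that each
  occurrence belongs to exactly one root and position 0 alone decides about
  \<open>x1\<close>.\<close>

definition le :: "nat \<Rightarrow> (nat \<times> nat) list" where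
  "le a = filter (\<lambda>(i, j). i = 0 \<and> 0 < j \<or> (ord a ! i, ord a ! j) \<in> symmetry_pairs Q vs)
     (List.product [0..<k] [0..<k])"

lemma ord_facts:
  assumes "a < k"
  shows "distinct (ord a)" "set (ord a) = verts Q" "length (ord a) = k" "ord a ! 0 = vs ! a"
proof -
  show "distinct (ord a)" "set (ord a) = verts Q" "ord a ! 0 = vs ! a"
    using ord[OF assms] by (auto simp: connected_order_def)
  then show "length (ord a) = k" using vs by (metis distinct_card)
qed

lemma nb_iff: "a < k \<Longrightarrow> i < k \<Longrightarrow> j \<in> set (nb a i) \<longleftrightarrow> j < i \<and> {ord a ! j, ord a ! i} \<in> edges Q"
  by (auto simp: nb_def)

lemma nb_props:
  "a < k \<Longrightarrow> j \<in> set (nb a i) \<Longrightarrow> j < i"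
  "a < k \<Longrightarrow> i < k \<Longrightarrow> length (nb a i) \<le> k"
  "a < k \<Longrightarrow> 0 < i \<Longrightarrow> i < k \<Longrightarrow> nb a i \<noteq> []"
proof -
  show "a < k \<Longrightarrow> j \<in> set (nb a i) \<Longrightarrow> j < i" by (auto simp: nb_def split: if_splits)
  show "a < k \<Longrightarrow> i < k \<Longrightarrow> length (nb a i) \<le> k"
    using length_filter_le[of "\<lambda>j. {ord a ! j, ord a ! i} \<in> edges Q" "[0..<i]"] by (simp add: nb_def)
  show "a < k \<Longrightarrow> 0 < i \<Longrightarrow> i < k \<Longrightarrow> nb a i \<noteq> []"
    using ord[of a] ord_facts(3)[of a] by (simp add: nb_def connected_order_def filter_empty_conv atLeast0LessThan Bex_def lessThan_iff)
qed

lemma ne_le_less: "(i, j) \<in> set (ne a) \<Longrightarrow> i < k \<and> j < k" "(i, j) \<in> set (le a) \<Longrightarrow> i < k \<and> j < k"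
  by (auto simp: ne_def le_def)

lemma ne_le_length: "length (ne a) + length (le a) \<le> 2 * k * k"
proof -
  have "length (ne a) \<le> k * k" "length (le a) \<le> k * k"
    unfolding ne_def le_def by (rule order_trans[OF length_filter_le], simp add: length_product)+
  then show ?thesis by simp
qed

lemma position: "a < k \<Longrightarrow> x \<in> verts Q \<Longrightarrow> \<exists>i<k. x = ord a ! i"
  using ord_facts[of a] by (metis in_set_conv_nth)

lemma edge_sub: "e \<in> edges Q \<Longrightarrow> e \<subseteq> verts Q \<and> card e = 2"
  using Q by (simp add: simple_graph_def)

lemma edge_positions:
  assumes a: "a < k" and e: "e \<in> edges Q"
  shows "\<exists>i j. i < k \<and> j \<in> set (nb a i) \<and> e = {ord a ! j, ord a ! i}"
proof -
  obtain x y where xy: "e = {x, y}" "x \<noteq> y" "x \<in> verts Q" "y \<in> verts Q"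
    using edge_sub[OF e] by (auto simp: card_2_iff)
  obtain i j where ij: "i < k" "j < k" "x = ord a ! i" "y = ord a ! j"
    using position[OF a] xy by metis
  then consider "j < i" | "i < j" using xy(2) by force
  then show ?thesis
  proof cases
    case 1
    then show ?thesis using ij xy(1) e by (intro exI[of _ i] exI[of _ j]) (auto simp: nb_iff[OF a] insert_commute)
  next
    case 2
    then show ?thesis using ij xy(1) e by (intro exI[of _ j] exI[of _ i]) (auto simp: nb_iff[OF a] insert_commute)
  qed
qed

lemma vertex_covered: "x \<in> verts Q \<Longrightarrow> \<exists>e\<in>edges Q. x \<in> e"
proof -
  assume x: "x \<in> verts Q"
  have k0: "0 < k" "1 < k" by (rule less_le_trans[OF _ vs(3)], simp)+
  obtain i where i: "i < k" "x = ord 0 ! i" using position[OF k0(1) x] by blast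
  \<comment> \<open>The root has no earlier neighbour; it is covered through position 1, whose only
    possible earlier neighbour is the root.\<close>
  define i' where "i' = (if i = 0 then 1 else i)"
  have "0 < i'" "i' < k" using i k0 by (auto simp: i'_def)
  then obtain j where j: "j < i'" "{ord 0 ! j, ord 0 ! i'} \<in> edges Q"
    using ord[OF k0(1)] ord_facts(3)[OF k0(1)] by (auto simp: connected_order_def)
  have "i = i' \<or> i = j" using j(1) by (auto simp: i'_def split: if_splits)
  then have "x \<in> {ord 0 ! j, ord 0 ! i'}" using i by auto
  then show ?thesis using j by blast
qed

lemma edge_list_bij:
  assumes a: "a < k"
  shows "bij_betw (\<lambda>(j, i). {ord a ! j, ord a ! i}) (set (pattern.edge_list k (nb a))) (edges Q)"
proof -
  have el: "(j, i) \<in> set (pattern.edge_list k (nb a)) \<longleftrightarrow> i < k \<and> j \<in> set (nb a i)" for i j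
    by (auto simp: pattern.edge_list_def)
  note o = ord_facts[OF a]
  show ?thesis
    unfolding bij_betw_def
  proof
    show "inj_on (\<lambda>(j, i). {ord a ! j, ord a ! i}) (set (pattern.edge_list k (nb a)))"
    proof (rule inj_onI, clarify)
      fix j i j' i' assume m: "(j, i) \<in> set (pattern.edge_list k (nb a))"
        "(j', i') \<in> set (pattern.edge_list k (nb a))" and eq: "{ord a ! j, ord a ! i} = {ord a ! j', ord a ! i'}"
      then have l: "j < i" "i < k" "j' < i'" "i' < k" using el nb_props(1)[OF a] by blast+
      have nth: "ord a ! x = ord a ! y \<longleftrightarrow> x = y" if "x < k" "y < k" for x y
        using nth_eq_iff_index_eq[OF o(1)] that o(3) by simp
      show "j = j' \<and> i = i'" using eq l nth by (auto simp: doubleton_eq_iff)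
    qed
    show "(\<lambda>(j, i). {ord a ! j, ord a ! i}) ` set (pattern.edge_list k (nb a)) = edges Q"
    proof (intro equalityI subsetI)
      fix e assume "e \<in> edges Q"
      then obtain i j where "i < k" "j \<in> set (nb a i)" "e = {ord a ! j, ord a ! i}"
        using edge_positions[OF a] by blast
      then show "e \<in> (\<lambda>(j, i). {ord a ! j, ord a ! i}) ` set (pattern.edge_list k (nb a))"
        using el by (intro image_eqI[of _ _ "(j, i)"]) auto
    qed (auto simp: el nb_iff[OF a])
  qed
qed

text \<open>Transport along \<open>edge_list_bij\<close>. The total weight is the same for every
  root, so one optimal cover of \<open>Q\<close> gives all roots the same exponent.\<close>

lemma cover_positions:
  assumes W: "fractional_edge_cover Q W" and a: "a < k"
  defines "x \<equiv> \<lambda>e. W ((\<lambda>(j, i). {ord a ! j, ord a ! i}) e)"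
  shows "\<And>e. e \<in> set (pattern.edge_list k (nb a)) \<Longrightarrow> 0 \<le> x e"
    and "\<And>i. i < k \<Longrightarrow> 1 \<le> (\<Sum>e\<in>{e \<in> set (pattern.edge_list k (nb a)). fst e = i \<or> snd e = i}. x e)"
    and "(\<Sum>e\<in>set (pattern.edge_list k (nb a)). x e) = (\<Sum>e\<in>edges Q. W e)"
proof -
  let ?f = "\<lambda>(j, i). {ord a ! j, ord a ! i}" let ?E = "set (pattern.edge_list k (nb a))"
  note bij = edge_list_bij[OF a] and o = ord_facts[OF a]
  show "0 \<le> x e" if "e \<in> ?E" for e
  proof -
    have "?f e \<in> edges Q" using bij that unfolding bij_betw_def by blast
    then show ?thesis using W unfolding x_def fractional_edge_cover_def by blast
  qed
  show "(\<Sum>e\<in>?E. x e) = (\<Sum>e\<in>edges Q. W e)"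
    unfolding x_def by (rule sum.reindex_bij_betw[OF bij])
  fix i assume i: "i < k"
  have "bij_betw ?f {e \<in> ?E. fst e = i \<or> snd e = i} {e \<in> edges Q. ord a ! i \<in> e}"
  proof (rule bij_betw_subset[OF bij])
    have "ord a ! i \<in> ?f e \<longleftrightarrow> fst e = i \<or> snd e = i" if e: "e \<in> ?E" for e
    proof -
      have l: "snd e < k" "fst e < snd e" using e nb_props(1)[OF a] by (auto simp: pattern.edge_list_def)
      then show ?thesis
        using nth_eq_iff_index_eq[OF o(1), of i "fst e"] nth_eq_iff_index_eq[OF o(1), of i "snd e"] o(3) i
        by (auto simp: case_prod_unfold)
    qed
    then have 1: "{e \<in> ?E. fst e = i \<or> snd e = i} = {e \<in> ?E. ord a ! i \<in> ?f e}" by blast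
    have 2: "?f ` ?E = edges Q" using bij by (simp only: bij_betw_def)
    show "?f ` {e \<in> ?E. fst e = i \<or> snd e = i} = {e \<in> edges Q. ord a ! i \<in> e}"
      unfolding 1 2[symmetric] by (rule Compr_image_eq[symmetric])
  qed auto
  then have "(\<Sum>e\<in>{e \<in> ?E. fst e = i \<or> snd e = i}. x e) = (\<Sum>e\<in>{e \<in> edges Q. ord a ! i \<in> e}. W e)"
    unfolding x_def by (rule sum.reindex_bij_betw)
  moreover have "ord a ! i \<in> verts Q" using i o(2,3) nth_mem by metis
  ultimately show "1 \<le> (\<Sum>e\<in>{e \<in> ?E. fst e = i \<or> snd e = i}. x e)"
    using W by (simp add: fractional_edge_cover_def)
qed

end

section \<open>The matches of all roots are exactly the occurrences\<close>

locale listing_instance = pattern_graph Q vs ord + listing_data "length vs" n L adj nb ne le vid att T w bx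
  for Q :: "'a ugraph" and vs ord n L adj vid att T w bx +
  fixes G :: "nat ugraph" and A :: "nat \<Rightarrow> real"
  assumes G: "simple_graph G"
    and vid: "inj_on vid {..<n}" "vid ` {..<n} = \<Union> (edges G)"
    and adj: "\<And>u v. adj u v \<longleftrightarrow> u < n \<and> v < n \<and> {vid u, vid v} \<in> edges G"
    and att: "\<And>u. u < n \<Longrightarrow> att u = A (vid u)"
begin

definition good :: "nat \<Rightarrow> ('a \<Rightarrow> nat) \<Rightarrow> real \<Rightarrow> real \<Rightarrow> bool" where
  "good a g x1 x2 \<longleftrightarrow> inj_on g (verts Q) \<and> g ` verts Q \<subseteq> {..<n} \<and>
     (\<forall>x\<in>verts Q. \<forall>y\<in>verts Q. {x, y} \<in> edges Q \<longrightarrow> adj (g x) (g y)) \<and> canonical Q vs g \<and>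
     (\<forall>x\<in>verts Q. x \<noteq> vs ! a \<longrightarrow> g (vs ! a) < g x) \<and>
     x1 \<le> att (g (vs ! a)) \<and> (\<forall>x\<in>verts Q. att (g x) \<le> x2)"

lemma symmetry_pairs_verts: "(x, y) \<in> symmetry_pairs Q vs \<Longrightarrow> x \<in> verts Q \<and> y \<in> verts Q"
proof -
  assume "(x, y) \<in> symmetry_pairs Q vs"
  then obtain i \<sigma> where s: "\<sigma> \<in> automorphisms Q" "i < k" "x = vs ! i" "y = \<sigma> x"
    unfolding symmetry_pairs_def by blast
  then have "x \<in> verts Q" using vs nth_mem by metis
  then show ?thesis using s permutes_in_image[OF automorphism_permutes[OF s(1)]] by simp
qed

lemma matches_good:
  assumes a: "a < k"
  shows "map g (ord a) \<in> matches a x1 x2 \<longleftrightarrow> good a g x1 x2"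
proof -
  note o = ord_facts[OF a]
  have all: "(\<forall>x\<in>verts Q. P x) \<longleftrightarrow> (\<forall>i<k. P (ord a ! i))" for P
    using o(2,3) by (metis in_set_conv_nth)
  have nth: "map g (ord a) ! i = g (ord a ! i)" if "i < k" for i using that o(3) by simp
  have eq: "ord a ! i = ord a ! j \<longleftrightarrow> i = j" if "i < k" "j < k" for i j
    using nth_eq_iff_index_eq[OF o(1)] that o(3) by simp
  have 1: "(\<forall>(i, j)\<in>set (ne a). map g (ord a) ! i \<noteq> map g (ord a) ! j) \<longleftrightarrow> inj_on g (verts Q)"
  proof -
    have "(\<forall>(i, j)\<in>set (ne a). map g (ord a) ! i \<noteq> map g (ord a) ! j) \<longleftrightarrow>
        (\<forall>i<k. \<forall>j<i. g (ord a ! i) \<noteq> g (ord a ! j))"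
      by (auto simp: ne_def nth)
    also have "\<dots> \<longleftrightarrow> (\<forall>i<k. \<forall>j<k. i \<noteq> j \<longrightarrow> g (ord a ! i) \<noteq> g (ord a ! j))"
      by (metis less_trans nat_neq_iff)
    also have "\<dots> \<longleftrightarrow> inj_on g (verts Q)" unfolding inj_on_def all using eq by blast
    finally show ?thesis .
  qed
  have 2: "(\<forall>i<k. \<forall>j\<in>set (nb a i). adj (map g (ord a) ! j) (map g (ord a) ! i)) \<longleftrightarrow>
      (\<forall>x\<in>verts Q. \<forall>y\<in>verts Q. {x, y} \<in> edges Q \<longrightarrow> adj (g x) (g y))"
  proof -
    have "(\<forall>i<k. \<forall>j\<in>set (nb a i). adj (map g (ord a) ! j) (map g (ord a) ! i)) \<longleftrightarrow>
        (\<forall>i<k. \<forall>j<i. {ord a ! j, ord a ! i} \<in> edges Q \<longrightarrow> adj (g (ord a ! j)) (g (ord a ! i)))"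
    proof -
      have "(\<forall>j\<in>set (nb a i). adj (map g (ord a) ! j) (map g (ord a) ! i)) \<longleftrightarrow>
          (\<forall>j<i. {ord a ! j, ord a ! i} \<in> edges Q \<longrightarrow> adj (g (ord a ! j)) (g (ord a ! i)))" if i: "i < k" for i
      proof -
        have "adj (map g (ord a) ! j) (map g (ord a) ! i) = adj (g (ord a ! j)) (g (ord a ! i))" if "j < i" for j
          using nth[OF i] nth[of j] that i by simp
        then show ?thesis using nb_iff[OF a i] by blast
      qed
      then show ?thesis by blast
    qed
    also have "\<dots> \<longleftrightarrow> (\<forall>i<k. \<forall>j<k. {ord a ! j, ord a ! i} \<in> edges Q \<longrightarrow> adj (g (ord a ! j)) (g (ord a ! i)))"
      (is "?l \<longleftrightarrow> ?r")
    proof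
      assume l: ?l
      show ?r
      proof (intro allI impI)
        fix i j assume ij: "i < k" "j < k" "{ord a ! j, ord a ! i} \<in> edges Q"
        have "i \<noteq> j" using edge_sub[OF ij(3)] by auto
        then consider "j < i" | "i < j" by linarith
        then show "adj (g (ord a ! j)) (g (ord a ! i))"
        proof cases
          \<comment> \<open>Each pattern edge is tested in one direction only; the other follows
            from the symmetry of \<open>adj\<close>.\<close>
          case 2
          then have "adj (g (ord a ! i)) (g (ord a ! j))" using l ij by (simp add: insert_commute)
          then show ?thesis by (rule adj_sym)
        qed (use l ij in blast)
      qed
    qed (meson less_trans)
    also have "\<dots> \<longleftrightarrow> (\<forall>x\<in>verts Q. \<forall>y\<in>verts Q. {x, y} \<in> edges Q \<longrightarrow> adj (g x) (g y))"
      unfolding all by blast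
    finally show ?thesis .
  qed
  have 3: "(\<forall>(i, j)\<in>set (le a). map g (ord a) ! i < map g (ord a) ! j) \<longleftrightarrow>
      canonical Q vs g \<and> (\<forall>x\<in>verts Q. x \<noteq> vs ! a \<longrightarrow> g (vs ! a) < g x)"
  proof -
    have k0: "0 < k" by (rule le_less_trans[OF _ a]) simp
    have "(\<forall>(i, j)\<in>set (le a). map g (ord a) ! i < map g (ord a) ! j) \<longleftrightarrow>
      (\<forall>i<k. \<forall>j<k. (ord a ! i, ord a ! j) \<in> symmetry_pairs Q vs \<longrightarrow> g (ord a ! i) < g (ord a ! j)) \<and>
      (\<forall>j<k. 0 < j \<longrightarrow> g (ord a ! 0) < g (ord a ! j))"
      using k0 by (auto simp: le_def nth)
    also have "(\<forall>j<k. 0 < j \<longrightarrow> g (ord a ! 0) < g (ord a ! j)) \<longleftrightarrow>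
        (\<forall>x\<in>verts Q. x \<noteq> vs ! a \<longrightarrow> g (vs ! a) < g x)"
      unfolding all using o(4) eq k0 by (metis neq0_conv)
    also have "(\<forall>i<k. \<forall>j<k. (ord a ! i, ord a ! j) \<in> symmetry_pairs Q vs \<longrightarrow> g (ord a ! i) < g (ord a ! j)) \<longleftrightarrow>
       (\<forall>x\<in>verts Q. \<forall>y\<in>verts Q. (x, y) \<in> symmetry_pairs Q vs \<longrightarrow> g x < g y)"
      unfolding all by blast
    also have "\<dots> \<longleftrightarrow> canonical Q vs g"
      unfolding canonical_def using symmetry_pairs_verts by blast
    finally show ?thesis .
  qed
  have 4: "(\<forall>i<k. att (map g (ord a) ! i) \<le> x2) \<longleftrightarrow> (\<forall>x\<in>verts Q. att (g x) \<le> x2)"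
    unfolding all by (simp add: nth)
  have 5: "map g (ord a) ! 0 = g (vs ! a)" using nth[of 0] a o(4) by fastforce
  show ?thesis
    unfolding matches_def good_def mem_Collect_eq 1 2 3 4 5 using o(2,3) by auto
qed

lemma matchesE:
  assumes a: "a < k" and p: "p \<in> matches a x1 x2"
  obtains g where "p = map g (ord a)" "good a g x1 x2"
proof -
  note o = ord_facts[OF a]
  define g where "g x = p ! (inv_into {..<k} ((!) (ord a)) x)" for x
  have "inj_on ((!) (ord a)) {..<k}" using o by (intro inj_on_nth) auto
  then have "p = map g (ord a)"
    using p o(3) by (intro nth_equalityI) (auto simp: matches_def g_def inv_into_f_f)
  then show thesis using that[of g] matches_good[OF a, of g] p by blast
qed

lemma picture_copy:
  assumes a: "a < k" shows "picture a (map g (ord a)) = copy (vid \<circ> g) Q"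
proof -
  note o = ord_facts[OF a]
  have nth: "map g (ord a) ! i = g (ord a ! i)" if "i < k" for i using that o(3) by simp
  have "verts Q = (\<lambda>i. ord a ! i) ` {..<k}" unfolding o(2)[symmetric] set_conv_nth o(3) by auto
  then have "verts (picture a (map g (ord a))) = verts (copy (vid \<circ> g) Q)"
    by (auto simp: picture_def copy_def nth image_image)
  moreover have "edges (picture a (map g (ord a))) = edges (copy (vid \<circ> g) Q)"
  proof -
    have "e \<in> edges (picture a (map g (ord a))) \<longleftrightarrow>
        (\<exists>i j. i < k \<and> j \<in> set (nb a i) \<and> e = (vid \<circ> g) ` {ord a ! j, ord a ! i})" for e
    proof -
      have "{vid (map g (ord a) ! j), vid (map g (ord a) ! i)} = (vid \<circ> g) ` {ord a ! j, ord a ! i}"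
        if "i < k" "j \<in> set (nb a i)" for i j
        using that nb_props(1)[OF a that(2)] by (simp add: nth less_trans)
      then show ?thesis unfolding picture_def ugraph.select_convs mem_Collect_eq by metis
    qed
    moreover have "e \<in> edges (copy (vid \<circ> g) Q) \<longleftrightarrow>
        (\<exists>i j. i < k \<and> j \<in> set (nb a i) \<and> e = (vid \<circ> g) ` {ord a ! j, ord a ! i})" for e
    proof -
      have "edges (copy (vid \<circ> g) Q) = (\<lambda>e. (vid \<circ> g) ` e) ` edges Q" by (simp add: copy_def)
      moreover have "e' \<in> edges Q \<longleftrightarrow> (\<exists>i j. i < k \<and> j \<in> set (nb a i) \<and> e' = {ord a ! j, ord a ! i})" for e'
        using edge_positions[OF a, of e'] nb_iff[OF a] by metis
      ultimately show ?thesis by (simp only: image_iff Bex_def) metis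
    qed
    ultimately show ?thesis by (intro set_eqI) (simp only:)
  qed
  ultimately show ?thesis by simp
qed

text \<open>Equal pictures differ by an automorphism, which is the identity because both labellings
  are canonical. The labellings then agree on \<open>Q\<close>, and the vertex where they are least
  is the root of either.\<close>

lemma picture_unique:
  assumes ab: "a < k" "b < k" and p: "p \<in> matches a x1 x2" "q \<in> matches b x1 x2"
    and eq: "picture a p = picture b q"
  shows "a = b \<and> p = q"
proof -
  obtain g where g: "p = map g (ord a)" "good a g x1 x2" using matchesE[OF ab(1) p(1)] .
  obtain g' where g': "q = map g' (ord b)" "good b g' x1 x2" using matchesE[OF ab(2) p(2)] .
  have c: "copy (vid \<circ> g) Q = copy (vid \<circ> g') Q"
    using eq picture_copy ab g g' by simp
  have gn: "g x < n" "g' x < n" if "x \<in> verts Q" for x using that g(2) g'(2) by (auto simp: good_def)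
  have "inj_on (vid \<circ> g) (verts Q)" "inj_on (vid \<circ> g') (verts Q)"
    using g(2) g'(2) vid(1) by (auto simp: good_def intro!: comp_inj_on intro: inj_on_subset)
  from equal_copies[OF Q this c] obtain \<sigma> where
    s: "\<sigma> \<in> automorphisms Q" "\<And>x. x \<in> verts Q \<Longrightarrow> vid (g' x) = vid (g (\<sigma> x))" by auto
  have sV: "\<sigma> x \<in> verts Q" if "x \<in> verts Q" for x
    using that permutes_in_image[OF automorphism_permutes[OF s(1)]] by simp
  have gs: "g' x = g (\<sigma> x)" if "x \<in> verts Q" for x
    using s(2)[OF that] gn(2)[OF that] gn(1)[OF sV[OF that]] vid(1) by (auto dest: inj_onD)
  have "canonical Q vs (g \<circ> \<sigma>)"
    using g'(2) gs symmetry_pairs_verts unfolding good_def canonical_def by fastforce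
  then have "\<sigma> = id" using canonical_unique[OF vs(2) s(1)] g(2) by (auto simp: good_def)
  then have gg: "g' x = g x" if "x \<in> verts Q" for x using gs that by simp
  have V: "vs ! a \<in> verts Q" "vs ! b \<in> verts Q" using ab vs(2) nth_mem by metis+
  have "vs ! a = vs ! b"
  proof (rule ccontr)
    assume ne: "vs ! a \<noteq> vs ! b"
    then have "g (vs ! a) < g (vs ! b)" "g' (vs ! b) < g' (vs ! a)"
      using g(2) g'(2) V by (auto simp: good_def)
    then show False using gg V by simp
  qed
  then have "a = b" using nth_eq_iff_index_eq[OF vs(1)] ab by simp
  then show ?thesis using g g' gg ord_facts(2)[OF ab(2)] by simp
qed

lemma range_simple: "simple_graph (range_subgraph G A x1 x2)"
  using G by (auto simp: simple_graph_def range_subgraph_def induced_subgraph_def)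

lemma matches_occurrences: "(\<Union>a<k. picture a ` matches a x1 x2) = occurrences Q (range_subgraph G A x1 x2)"
proof (intro equalityI subsetI)
  fix H assume "H \<in> (\<Union>a<k. picture a ` matches a x1 x2)"
  then obtain a p where a: "a < k" and p: "p \<in> matches a x1 x2" "H = picture a p" by blast
  obtain g where g: "p = map g (ord a)" "good a g x1 x2" using matchesE[OF a p(1)] .
  have H: "H = copy (vid \<circ> g) Q" using p(2) g(1) picture_copy[OF a] by simp
  have gn: "g x < n" if "x \<in> verts Q" for x using that g(2) by (auto simp: good_def)
  have inV: "vid (g x) \<in> verts G" "x1 \<le> A (vid (g x))" "A (vid (g x)) \<le> x2" if x: "x \<in> verts Q" for x
  proof -
    have "vid (g x) \<in> \<Union> (edges G)" using vid(2) gn[OF x] by blast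
    then show "vid (g x) \<in> verts G" using G by (auto simp: simple_graph_def)
    have V: "vs ! a \<in> verts Q" using a vs(2) nth_mem by metis
    have "g (vs ! a) \<le> g x" using g(2) x by (cases "x = vs ! a") (auto simp: good_def)
    then have "att (g (vs ! a)) \<le> att (g x)" using gn[OF x] by (rule att_mono)
    then have "x1 \<le> att (g x)" using g(2) by (auto simp: good_def)
    then show "x1 \<le> A (vid (g x))" using att[OF gn[OF x]] by simp
    have "att (g x) \<le> x2" using g(2) x by (auto simp: good_def)
    then show "A (vid (g x)) \<le> x2" using att[OF gn[OF x]] by simp
  qed
  have "inj_on (vid \<circ> g) (verts Q)"
    using g(2) vid(1) by (auto simp: good_def intro!: comp_inj_on intro: inj_on_subset)
  moreover have "(vid \<circ> g) ` verts Q \<subseteq> verts (range_subgraph G A x1 x2)"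
    using inV by (auto simp: range_subgraph_def induced_subgraph_def)
  moreover have "(vid \<circ> g) ` e \<in> edges (range_subgraph G A x1 x2)" if e: "e \<in> edges Q" for e
  proof -
    obtain x y where xy: "e = {x, y}" "x \<in> verts Q" "y \<in> verts Q"
      using edge_sub[OF e] by (auto simp: card_2_iff)
    then have "adj (g x) (g y)" using g(2) e by (auto simp: good_def)
    then show ?thesis using inV xy by (auto simp: adj range_subgraph_def induced_subgraph_def)
  qed
  ultimately show "H \<in> occurrences Q (range_subgraph G A x1 x2)"
    unfolding occurrences_iff[OF Q range_simple] using H by blast
next
  fix H assume "H \<in> occurrences Q (range_subgraph G A x1 x2)"
  then obtain h where h: "inj_on h (verts Q)" "h ` verts Q \<subseteq> verts (range_subgraph G A x1 x2)"
    "\<And>e. e \<in> edges Q \<Longrightarrow> h ` e \<in> edges (range_subgraph G A x1 x2)" and H: "H = copy h Q"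
    unfolding occurrences_iff[OF Q range_simple] by blast
  have hG: "h ` e \<in> edges G" if "e \<in> edges Q" for e
    using h(3)[OF that] by (auto simp: range_subgraph_def induced_subgraph_def)
  have hA: "x1 \<le> A (h x)" "A (h x) \<le> x2" if "x \<in> verts Q" for x
    using h(2) that by (auto simp: range_subgraph_def induced_subgraph_def)
  \<comment> \<open>Only vertices on edges have ranks; this is enough because every vertex of
    \<open>Q\<close> lies on an edge.\<close>
  have hv: "h x \<in> vid ` {..<n}" if x: "x \<in> verts Q" for x
    using vertex_covered[OF x] hG unfolding vid(2) by blast
  define g0 where "g0 x = inv_into {..<n} vid (h x)" for x
  have g0: "vid (g0 x) = h x" "g0 x < n" if "x \<in> verts Q" for x
    using f_inv_into_f[OF hv[OF that]] inv_into_into[OF hv[OF that]] by (auto simp: g0_def)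
  have "inj_on g0 (verts Q)" using h(1) g0(1) by (metis inj_on_def)
  then obtain \<sigma> where s: "\<sigma> \<in> automorphisms Q" and can: "canonical Q vs (g0 \<circ> \<sigma>)"
    using canonical_exists[OF vs(2)] by blast
  note perm = automorphism_permutes[OF s]
  have sV: "\<sigma> x \<in> verts Q" if "x \<in> verts Q" for x using that permutes_in_image[OF perm] by simp
  define g where "g = g0 \<circ> \<sigma>"
  have g: "vid (g x) = h (\<sigma> x)" "g x < n" if "x \<in> verts Q" for x
    using g0[OF sV[OF that]] by (auto simp: g_def)
  have ginj: "inj_on g (verts Q)"
    unfolding g_def using \<open>inj_on g0 (verts Q)\<close> permutes_inj_on[OF perm] permutes_image[OF perm]
    by (intro comp_inj_on) auto
  have se: "\<sigma> ` e \<in> edges Q" if "e \<in> edges Q" for e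
    using s that unfolding automorphisms_def by blast
  have fin: "finite (verts Q)" "verts Q \<noteq> {}" using Q vs by (auto simp: simple_graph_def)
  \<comment> \<open>The root from which this occurrence is found.\<close>
  define m where "m = arg_min_on g (verts Q)"
  have m: "m \<in> verts Q" "\<And>x. x \<in> verts Q \<Longrightarrow> g m \<le> g x"
    using arg_min_if_finite(1)[OF fin, of g] arg_min_least[OF fin, of _ g] by (auto simp: m_def)
  obtain a where a: "a < k" "vs ! a = m" using m(1) vs(2) by (metis in_set_conv_nth)
  have "good a g x1 x2"
    unfolding good_def a(2)
  proof (intro conjI ballI impI)
    show "inj_on g (verts Q)" by (rule ginj)
    show "canonical Q vs g" using can by (simp add: g_def)
    show "g ` verts Q \<subseteq> {..<n}" using g by auto
    show "adj (g x) (g y)" if "x \<in> verts Q" "y \<in> verts Q" "{x, y} \<in> edges Q" for x y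
      using hG[OF se[OF that(3)]] g that by (simp add: adj)
    show "g m < g x" if "x \<in> verts Q" "x \<noteq> m" for x
      using m(2)[OF that(1)] ginj that m(1) by (metis inj_onD le_neq_implies_less)
    show "x1 \<le> att (g m)" using hA(1)[OF sV[OF m(1)]] g[OF m(1)] att[OF g(2)[OF m(1)]] by simp
    show "att (g x) \<le> x2" if "x \<in> verts Q" for x
      using hA(2)[OF sV[OF that]] g[OF that] att[OF g(2)[OF that]] by simp
  qed
  then have "map g (ord a) \<in> matches a x1 x2" using matches_good[OF a(1)] by simp
  moreover have "picture a (map g (ord a)) = H"
  proof -
    have "copy (vid \<circ> g) Q = copy (h \<circ> \<sigma>) Q" using g(1) by (intro copy_cong[OF Q]) simp
    also have "\<dots> = copy h Q"
    proof -
      have "(\<lambda>e. (h \<circ> \<sigma>) ` e) ` edges Q = (\<lambda>e. h ` e) ` (\<lambda>e. \<sigma> ` e) ` edges Q"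
        by (simp add: image_image)
      also have "(\<lambda>e. \<sigma> ` e) ` edges Q = edges Q" using s unfolding automorphisms_def by blast
      finally have "(\<lambda>e. (h \<circ> \<sigma>) ` e) ` edges Q = (\<lambda>e. h ` e) ` edges Q" .
      moreover have "(h \<circ> \<sigma>) ` verts Q = h ` verts Q"
        by (simp only: image_comp[symmetric] permutes_image[OF perm])
      ultimately show ?thesis by (simp add: copy_def)
    qed
    finally show ?thesis using picture_copy[OF a(1)] H by simp
  qed
  ultimately show "H \<in> (\<Union>a<k. picture a ` matches a x1 x2)" using a(1) by blast
qed

end

section \<open>Space and delay\<close>

context pattern_graph
begin

definition rho :: real where
  "rho = fractional_edge_cover_number Q"

lemma optimal_cover:
  obtains W where "fractional_edge_cover Q W" "(\<Sum>e\<in>edges Q. W e) = rho"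
proof -
  have "fractional_edge_cover Q (\<lambda>_. 1)"
    unfolding fractional_edge_cover_def
  proof (intro conjI ballI)
    fix x assume x: "x \<in> verts Q"
    have "{e \<in> edges Q. x \<in> e} \<noteq> {}" using vertex_covered[OF x] by blast
    moreover have "finite {e \<in> edges Q. x \<in> e}" using finite_edges[OF Q] by simp
    ultimately have "0 < card {e \<in> edges Q. x \<in> e}" by (simp add: card_gt_0_iff)
    then show "1 \<le> (\<Sum>e\<in>{e \<in> edges Q. x \<in> e}. 1::real)" by simp
  qed simp
  from fractional_edge_cover_number_attained[OF Q this] show thesis
    using that unfolding rho_def by blast
qed

lemma rho_nonneg: "0 \<le> rho"
proof -
  obtain W where "fractional_edge_cover Q W" "(\<Sum>e\<in>edges Q. W e) = rho" by (rule optimal_cover)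
  then show ?thesis by (metis fractional_edge_cover_def sum_nonneg)
qed

text \<open>The first summand pays for header, arcs, vertex tables, list starts and attributes. The
  second is \<open>2 * k + 1\<close> cells per box for \<open>k\<close> roots; with \<open>l\<close>
  the logarithm of \<open>m + 2\<close>, \<open>30 = 6 * 5\<close> comes from
  \<open>L + 1 \<le> 6 * l\<close> and \<open>L \<le> 5 * l\<close>, and the 2 from
  \<open>n \<le> 2 * m\<close>.\<close>

definition space_const :: real where
  "space_const = (16 + 3 * real k) + (2 * real k + 1) * real k * (2 + 30 * real k * (1 + real k * 2 powr rho))"

text \<open>By \<open>L \<le> 5 * l\<close> the adjacency time \<open>20 + 6 * L\<close> gives 50,
  and the \<open>L\<close> rounds of the walk give the factor 10 and
  \<open>155 = 5 + 5 * 30\<close>. The factor \<open>3 + 2 * k\<close> bounds the cost of one box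
  per unit of \<open>\<Delta>\<close>, and \<open>4 * k * k\<close> is two ticks for each of at most
  \<open>2 * k * k\<close> comparisons.\<close>

definition delay_const :: real where
  "delay_const = 20 + real k * (155 + 10 * ((50 * (real k + 1) + 20 * real k + 4 * real k * real k + 20) * (3 + 2 * real k)))"

lemma no_occurrences:
  assumes G: "simple_graph G" "edges G = {}"
  shows "occurrences Q (range_subgraph G A x1 x2) = {}"
proof -
  have "vs ! 0 \<in> verts Q" using vs nth_mem[of 0 vs] by force
  then obtain e where e: "e \<in> edges Q" using vertex_covered by blast
  have "simple_graph (range_subgraph G A x1 x2)" "edges (range_subgraph G A x1 x2) = {}"
    using G by (auto simp: simple_graph_def range_subgraph_def induced_subgraph_def)
  then show ?thesis using e occurrences_iff[OF Q] by blast
qed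

end

text \<open>Leaving isolated vertices without rank keeps all tables within \<open>O(m)\<close>,
  whatever the number of vertices is. Each edge accounts for at most two ranks and at most two
  arcs.\<close>

lemma rank_vertices:
  fixes G :: "nat ugraph" and A :: "nat \<Rightarrow> real"
  assumes G: "simple_graph G" and m: "card (edges G) = m"
  obtains vl where "distinct vl" "set vl = \<Union> (edges G)" "sorted (map A vl)" "length vl \<le> 2 * m"
    "card {(u, v). u < length vl \<and> v < length vl \<and> {vl ! u, vl ! v} \<in> edges G} \<le> 2 * m"
proof -
  have c2: "card e = 2" if "e \<in> edges G" for e using G that by (auto simp: simple_graph_def)
  have fe: "finite (edges G)" using finite_edges[OF G] .
  have fin: "finite (\<Union> (edges G))"
    using fe c2 by (intro finite_Union) (auto intro: card_ge_0_finite)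
  define vl where "vl = sort_key A (sorted_list_of_set (\<Union> (edges G)))"
  have vl: "distinct vl" "set vl = \<Union> (edges G)" "sorted (map A vl)"
    using fin by (auto simp: vl_def)
  have "length vl = card (\<Union> (edges G))" using vl distinct_card by metis
  also have "\<dots> \<le> (\<Sum>e\<in>edges G. card e)" by (rule card_Union_le_sum_card) 
  also have "\<dots> = 2 * m" using c2 m by simp
  finally have len: "length vl \<le> 2 * m" .
  let ?n = "length vl"
  let ?A = "\<lambda>e. {(u, v). u < ?n \<and> v < ?n \<and> {vl ! u, vl ! v} = e}"
  have sm: "card (?A e) \<le> 2" if e: "e \<in> edges G" for e
  proof -
    obtain x y where xy: "e = {x, y}" using c2[OF e] by (auto simp: card_2_iff)
    have "x \<in> set vl" "y \<in> set vl" using xy e vl(2) by auto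
    then obtain i j where ij: "i < ?n" "j < ?n" "x = vl ! i" "y = vl ! j" by (metis in_set_conv_nth)
    have "?A e \<subseteq> {(i, j), (j, i)}" (is "_ \<subseteq> ?S")
      using ij nth_eq_iff_index_eq[OF vl(1)] unfolding xy by (auto simp: doubleton_eq_iff)
    then have "card (?A e) \<le> card ?S" by (rule card_mono[rotated]) simp
    also have "card ?S \<le> length [(i, j), (j, i)]"
      using card_length[of "[(i, j), (j, i)]"] by (simp only: list.set)
    also have "\<dots> = 2" by simp
    finally show ?thesis .
  qed
  have "{(u, v). u < ?n \<and> v < ?n \<and> {vl ! u, vl ! v} \<in> edges G} = (\<Union>e\<in>edges G. ?A e)" by auto
  then have "card {(u, v). u < ?n \<and> v < ?n \<and> {vl ! u, vl ! v} \<in> edges G} \<le> (\<Sum>e\<in>edges G. card (?A e))"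
    using card_UN_le[OF fe, of ?A] by simp
  also have "\<dots> \<le> (\<Sum>e\<in>edges G. 2)" using sm by (rule sum_mono)
  finally have "card {(u, v). u < ?n \<and> v < ?n \<and> {vl ! u, vl ! v} \<in> edges G} \<le> 2 * m" using m by simp
  then show thesis by (rule that[OF vl len])
qed

text \<open>\<open>4 * m\<close> bounds the ranks plus the arcs, at most \<open>2 * m\<close> each.
  The bound \<open>l \<le> real m + 2\<close> lets the logarithms disappear in a power of
  \<open>m + 2\<close> when the word length is checked.\<close>

lemma log_width:
  fixes m :: nat
  defines "l \<equiv> log 2 (real m + 2)"
  obtains L where "4 * m < 2 ^ L" "1 \<le> l" "real L \<le> 5 * l" "l \<le> real m + 2"
proof -
  have l1: "1 \<le> l" unfolding l_def by (simp add: le_log_iff)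
  have pl: "2 powr l = real m + 2" unfolding l_def by simp
  define L where "L = nat \<lceil>l\<rceil> + 3"
  have Ll: "l \<le> real (nat \<lceil>l\<rceil>)" "real (nat \<lceil>l\<rceil>) \<le> l + 1" using l1 by linarith+
  have "real m + 2 \<le> 2 powr real (nat \<lceil>l\<rceil>)" unfolding pl[symmetric] using Ll by (intro powr_mono) auto
  then have "real m + 2 \<le> real (2 ^ nat \<lceil>l\<rceil>)" by (simp add: powr_realpow)
  then have "m + 2 \<le> 2 ^ nat \<lceil>l\<rceil>" by linarith
  then have "4 * m < 2 ^ L" by (simp add: L_def power_add)
  moreover have "real L \<le> 5 * l" unfolding L_def of_nat_add using Ll l1 by linarith
  moreover have "l \<le> real m + 2"
  proof -
    have "m + 2 < 2 ^ (m + 2)" by (rule less_exp)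
    then have "real m + 2 \<le> real (2 ^ (m + 2))" by (metis less_imp_le of_nat_add of_nat_le_iff of_nat_numeral)
    then have "real m + 2 \<le> 2 powr (real m + 2)" by (simp add: powr_add powr_realpow power_add)
    then show ?thesis unfolding l_def by (subst log_le_iff) auto
  qed
  ultimately show thesis using that l1 by blast
qed

lemma (in listing_data) total_boxes:
  "(\<Sum>q<k * n. length (box_list q)) = (\<Sum>a<k. \<Sum>l<n. length (bx a l))"
proof -
  have "(\<Sum>q<k * n. length (box_list q)) = (\<Sum>a<k. \<Sum>q = a * n..<a * n + n. length (box_list q))"
    by (rule sum.nat_group[symmetric])
  also have "\<dots> = (\<Sum>a<k. \<Sum>l<n. length (bx a l))"
  proof (rule sum.cong[OF refl])
    fix a assume a: "a \<in> {..<k}"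
    have "(\<Sum>q = a * n..<a * n + n. length (box_list q)) = (\<Sum>l = 0..<n. length (box_list (l + a * n)))"
      using sum.shift_bounds_nat_ivl[of "\<lambda>q. length (box_list q)" 0 "a * n" n] by (simp add: add.commute)
    also have "\<dots> = (\<Sum>l<n. length (bx a l))"
      using slot a by (intro sum.cong) (auto simp: add.commute)
    finally show "(\<Sum>q = a * n..<a * n + n. length (box_list q)) = (\<Sum>l<n. length (bx a l))" .
  qed
  finally show ?thesis .
qed

section \<open>Existence of the structure with explicit constants\<close>

context pattern_graph
begin

lemma structure_exists:
  fixes G :: "nat ugraph" and A :: "nat \<Rightarrow> real" and \<Delta> :: real
  assumes G: "simple_graph G" "card (edges G) = m" and m: "0 < m" and D: "1 \<le> \<Delta>"
    and w: "verts G \<subseteq> {..<2 ^ w}"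
      "(3 + rho + log 2 (4 * space_const + 4)) * log 2 (real m + 2) \<le> real w"
  defines "l \<equiv> log 2 (real m + 2)"
  shows "\<exists>\<M>. range_listing_structure w (listing_program k nb ne le) Q G A
     (space_const * (real m + real m powr rho / \<Delta>) * l ^ 2) (delay_const * \<Delta> * l ^ 2) 1 \<M>"
proof -
  obtain L where L: "4 * m < 2 ^ L" "1 \<le> l" "real L \<le> 5 * l" "l \<le> real m + 2"
    using log_width[of m] unfolding l_def by blast
  obtain vl where vl: "distinct vl" "set vl = \<Union> (edges G)" "sorted (map A vl)" "length vl \<le> 2 * m"
    "card {(u, v). u < length vl \<and> v < length vl \<and> {vl ! u, vl ! v} \<in> edges G} \<le> 2 * m"
    using rank_vertices[OF G] by blast
  define n where "n = length vl"
  define adj where "adj u v \<longleftrightarrow> u < n \<and> v < n \<and> {vl ! u, vl ! v} \<in> edges G" for u v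
  define vid where "vid u = vl ! u" for u
  define att where "att u = A (vl ! u)" for u
  have k: "0 < k" "2 \<le> k" by (rule less_le_trans[OF _ vs(3)], simp, rule vs(3))
  have arcs: "card {(u, v). adj u v} \<le> 2 * m" using vl(5) by (simp add: adj_def n_def)
  have edge_pair: "\<exists>x y. e = {x, y} \<and> x \<noteq> y" if "e \<in> edges G" for e
    using G(1) that by (auto simp: simple_graph_def card_2_iff)
  have n_pos: "0 < n"
  proof -
    obtain e where "e \<in> edges G" using m G(2) by fastforce
    then have "\<Union> (edges G) \<noteq> {}" using edge_pair by fastforce
    then show ?thesis using vl(2) by (auto simp: n_def)
  qed
  have n2m: "n \<le> 2 * m" using vl(4) by (simp add: n_def)
  interpret R: ranked_graph k n L adj
  proof
    show "0 < n" by (rule n_pos)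
    show "u < n \<and> v < n" if "adj u v" for u v using that by (simp add: adj_def)
    show "adj v u" if "adj u v" for u v using that by (simp add: adj_def insert_commute)
    show "n + card {(u, v). adj u v} < 2 ^ L" using n2m arcs L(1) by linarith
    fix u assume u: "u < n"
    then have "vl ! u \<in> \<Union> (edges G)" using vl(2) nth_mem by (metis n_def)
    then obtain e where e: "e \<in> edges G" "vl ! u \<in> e" by blast
    then obtain y where y: "e = {vl ! u, y}" using edge_pair[OF e(1)] by auto
    then have "y \<in> set vl" using e(1) vl(2) by auto
    then obtain v where "v < n" "y = vl ! v" by (metis in_set_conv_nth n_def)
    then show "\<exists>v. adj u v" using e(1) y u by (auto simp: adj_def)
  qed
  obtain W where W: "fractional_edge_cover Q W" "(\<Sum>e\<in>edges Q. W e) = rho" by (rule optimal_cover)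
  \<comment> \<open>Twice \<open>\<Delta>\<close>, so that \<open>1 \<le> \<Delta>\<close> gives the
    \<open>2 \<le> B\<close> of the decomposition.\<close>
  define B where "B = 2 * \<Delta>"
  define T where "T = B + 1 + 2 * real k"
  define X where "X = real m powr rho / \<Delta>"
  have B: "2 \<le> B" using D by (simp add: B_def)
  have X0: "0 \<le> X" using D by (simp add: X_def)
  have search: "search k (nb a) n R.EB R.EE L R.off R.val adj" if "a < k" for a
    using nb_props[OF that] k by (intro R.search_axioms) auto
  have "\<exists>bx. (\<forall>l<n. search.keyed_boxes k (nb a) (ne a) (le a) n R.EB R.EE R.off R.val adj T (bx l)
        (search.root_leaves k (nb a) R.EB R.EE R.off R.val adj l (bound_in L 0 n l))) \<and>
      real (\<Sum>l<n. length (bx l)) \<le> 2 * real m + 30 * real k * (l ^ 2) * (real m + real k * 2 powr rho * X)"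
    if a: "a < k" for a
  proof -
    interpret S: weighted_search k "nb a" "ne a" "le a" n R.EB R.EE L R.off R.val adj
      "\<lambda>e. W ((\<lambda>(j, i). {ord a ! j, ord a ! i}) e)"
      using search[OF a] cover_positions[OF W(1) a]
      by (intro weighted_search.intro weighted_search_axioms.intro) auto
    obtain r where r: "k = Suc r" using k by (cases k) auto
    have "S.total = card {(u, v). adj u v}"
    proof -
      have "{(u, v). adj u v} = Sigma {..<n} (\<lambda>u. {v. adj u v})" using R.adj_less by auto
      then show ?thesis by (simp add: S.total_def S.deg_def)
    qed
    then have tot: "real S.total \<le> 2 * real m" using arcs by linarith
    have "real (S.run_cost r [] R.EB (R.EB + n)) \<le> real n + (2 * real r + 1) * real S.total powr rho"
      using S.root_cost[OF r] cover_positions(3)[OF W(1) a] W(2) by simp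
    also have "\<dots> \<le> 2 * real m + (2 * real k) * (2 * real m) powr rho"
      using n2m r tot rho_nonneg by (intro add_mono mult_mono powr_mono2) auto
    also have "(2 * real m) powr rho = 2 powr rho * (X * \<Delta>)"
      using D by (simp add: powr_mult X_def)
    finally have "real (S.run_cost r [] R.EB (R.EB + n)) / B \<le>
        (2 * real m + 2 * real k * (2 powr rho * (X * \<Delta>))) / B"
      using B by (intro divide_right_mono) auto
    also have "\<dots> = real m / \<Delta> + real k * 2 powr rho * X" using D by (simp add: B_def field_simps)
    also have "\<dots> \<le> real m + real k * 2 powr rho * X" using D m by (simp add: divide_le_eq mult_le_cancel_left1)
    finally have cost: "real (S.run_cost r [] R.EB (R.EB + n)) / B \<le> real m + real k * 2 powr rho * X" .
    have "real (k * (L + 1)) * real L \<le> (real k * (6 * l)) * (5 * l)"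
      unfolding of_nat_mult of_nat_add using L by (intro mult_mono) auto
    also have "\<dots> = 30 * real k * l ^ 2" by (simp add: power2_eq_square)
    finally have KL: "real (k * (L + 1)) * real L \<le> 30 * real k * l ^ 2" .
    obtain bx where bx: "\<forall>l<n. S.keyed_boxes (B + 1 + 2 * k) (bx l) (S.root_leaves l (bound_in L 0 n l))"
      "real (\<Sum>l<n. length (bx l)) \<le> real n +
         real (k * (L + 1)) * real L * real (S.run_cost r [] R.EB (R.EB + n)) / B"
      using S.box_lists_exist[OF B r] by blast
    note bx(2)
    also have "real n + real (k * (L + 1)) * real L * real (S.run_cost r [] R.EB (R.EB + n)) / B =
        real n + (real (k * (L + 1)) * real L) * (real (S.run_cost r [] R.EB (R.EB + n)) / B)" by simp
    also have "\<dots> \<le> 2 * real m + (30 * real k * l ^ 2) * (real m + real k * 2 powr rho * X)"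
      by (rule add_mono[OF _ mult_mono[OF KL cost]]) (use n2m B in auto)
    finally show ?thesis using bx(1) by (intro exI[of _ bx]) (simp add: T_def)
  qed
  then obtain bx where bx: "\<And>a l. a < k \<Longrightarrow> l < n \<Longrightarrow>
      search.keyed_boxes k (nb a) (ne a) (le a) n R.EB R.EE R.off R.val adj T (bx a l)
        (search.root_leaves k (nb a) R.EB R.EE R.off R.val adj l (bound_in L 0 n l))"
    and bxl: "\<And>a. a < k \<Longrightarrow> real (\<Sum>l<n. length (bx a l)) \<le>
      2 * real m + 30 * real k * (l ^ 2) * (real m + real k * 2 powr rho * X)"
    by metis
  interpret I: listing_instance Q vs ord n L adj vid att T w bx G A
  proof unfold_locales
    show "0 < k" by (rule k)
    show "att u \<le> att v" if "u \<le> v" "v < n" for u v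
      using sorted_nth_mono[OF vl(3), of u v] that by (simp add: att_def n_def)
    show "vid u < 2 ^ w" if "u < n" for u
    proof -
      have "vl ! u \<in> \<Union> (edges G)" using that vl(2) nth_mem by (metis n_def)
      then have "vl ! u \<in> verts G" using G(1) by (auto simp: simple_graph_def)
      then show ?thesis using w(1) by (auto simp: vid_def)
    qed
    show "inj_on vid {..<n}" 
      using nth_eq_iff_index_eq[OF vl(1)] by (simp add: inj_on_def vid_def n_def)
    show "vid ` {..<n} = \<Union> (edges G)"
      unfolding vl(2)[symmetric] by (auto simp: vid_def n_def set_conv_nth)
  qed (rule bx nb_props ne_le_less G(1); assumption | simp add: adj_def vid_def att_def)+
  have kr: "2 \<le> real k" using k by simp
  have l2: "1 \<le> l ^ 2" using L(2) by (simp add: one_le_power)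
  have mX: "0 \<le> real m + X" "1 \<le> real m" using X0 m by auto
  have boxes: "real (\<Sum>a<k. \<Sum>l<n. length (bx a l)) \<le>
      real k * (2 * real m + 30 * real k * (l ^ 2) * (real m + real k * 2 powr rho * X))"
  proof -
    have "real (\<Sum>a<k. \<Sum>l<n. length (bx a l)) = (\<Sum>a<k. real (\<Sum>l<n. length (bx a l)))" by simp
    also have "\<dots> \<le> (\<Sum>a<k. 2 * real m + 30 * real k * (l ^ 2) * (real m + real k * 2 powr rho * X))"
      using bxl by (intro sum_mono) auto
    finally show ?thesis by simp
  qed
  have space: "real (space_used I.M) \<le> space_const * (real m + X) * l ^ 2"
  proof -
    let ?Y = "(real m + X) * l ^ 2"
    have Y: "real m \<le> ?Y" "0 \<le> ?Y" "(real m + X) \<le> ?Y"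
    proof -
      show "real m + X \<le> ?Y" using mult_left_mono[OF l2 mX(1)] by simp
      then show "real m \<le> ?Y" using X0 by linarith
      then show "0 \<le> ?Y" using mX(2) by linarith
    qed
    have "R.EE = 4 + k + n + card {(u, v). adj u v}" by (simp add: R.EE_eq R.length_codes)
    then have "real (I.box_base + n) \<le> real (6 + k) + 2 * real m + (4 + real k) * real n"
      using arcs by (simp add: I.box_base_def algebra_simps)
    also have "\<dots> \<le> (6 + real k) * real m + 2 * real m + (4 + real k) * (2 * real m)"
    proof (intro add_mono mult_left_mono)
      show "real (6 + k) \<le> (6 + real k) * real m" using mult_left_mono[OF mX(2), of "6 + real k"] by simp
    qed (use n2m in auto)
    also have "\<dots> = (16 + 3 * real k) * real m" by (simp add: algebra_simps)
    also have "\<dots> \<le> (16 + 3 * real k) * ?Y" using Y by (intro mult_left_mono) auto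
    finally have 1: "real (I.box_base + n) \<le> (16 + 3 * real k) * ?Y" .
    have each: "2 * real m + 30 * real k * (l ^ 2) * (real m + real k * 2 powr rho * X) \<le>
        2 * ?Y + 30 * real k * ((1 + real k * 2 powr rho) * ?Y)"
    proof (rule add_mono)
      have "real m + real k * 2 powr rho * X \<le> (1 + real k * 2 powr rho) * (real m + X)"
        using X0 by (simp add: algebra_simps)
      then have "30 * real k * (l ^ 2) * (real m + real k * 2 powr rho * X) \<le>
          30 * real k * (l ^ 2) * ((1 + real k * 2 powr rho) * (real m + X))"
        by (intro mult_left_mono) auto
      also have "\<dots> = 30 * real k * ((1 + real k * 2 powr rho) * ?Y)" by simp
      finally show "30 * real k * (l ^ 2) * (real m + real k * 2 powr rho * X) \<le>
          30 * real k * ((1 + real k * 2 powr rho) * ?Y)" .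
    qed (use Y in auto)
    have "real (\<Sum>a<k. \<Sum>l<n. length (bx a l)) \<le>
        real k * (2 * ?Y + 30 * real k * ((1 + real k * 2 powr rho) * ?Y))"
      by (rule order_trans[OF boxes mult_left_mono[OF each]]) simp
    then have "(2 * real k + 1) * real (\<Sum>a<k. \<Sum>l<n. length (bx a l)) \<le>
        (2 * real k + 1) * (real k * (2 * ?Y + 30 * real k * ((1 + real k * 2 powr rho) * ?Y)))"
      by (intro mult_left_mono) auto
    with 1 have "real (I.box_base + n) + (2 * real k + 1) * real (\<Sum>a<k. \<Sum>l<n. length (bx a l)) \<le>
        (16 + 3 * real k) * ?Y +
        (2 * real k + 1) * (real k * (2 * ?Y + 30 * real k * ((1 + real k * 2 powr rho) * ?Y)))"
      by (rule add_mono)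
    also have "\<dots> = space_const * (real m + X) * l ^ 2"
      by (simp add: space_const_def algebra_simps)
    finally show ?thesis
      unfolding I.space_used_M I.total_boxes by (simp add: algebra_simps)
  qed
  have sc: "0 < space_const"
    unfolding space_const_def using kr by (intro add_pos_nonneg mult_nonneg_nonneg) auto
  \<comment> \<open>The hypothesis on \<open>w\<close> amounts to \<open>c' * Y \<le> 2 ^ w\<close>.
    The exponent \<open>3 + rho\<close> leaves room for \<open>m + m powr rho\<close> times
    \<open>l ^ 2\<close>, as \<open>l \<le> m + 2\<close>; the constant becomes an exponent because
    \<open>2 \<le> m + 2\<close>. In \<open>c'\<close>, the part \<open>4 * space_const\<close>
    serves twice the memory length and the summand 4 the arc codes.\<close>
  define c' where "c' = 4 * space_const + 4"
  define Y where "Y = (real m + 2) powr (3 + rho)"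
  have big: "c' * Y \<le> 2 ^ w"
  proof -
    have c': "4 < c'" using sc by (simp add: c'_def)
    have "c' = 2 powr (log 2 c')" using c' by simp
    also have "\<dots> \<le> (real m + 2) powr (log 2 c')"
      using c' by (intro powr_mono2) (auto simp: zero_le_log_cancel_iff)
    finally have "c' * Y \<le> (real m + 2) powr (log 2 c') * Y" by (intro mult_right_mono) (auto simp: Y_def)
    also have "\<dots> = (real m + 2) powr (3 + rho + log 2 c')" by (simp add: Y_def powr_add)
    also have "\<dots> = 2 powr ((3 + rho + log 2 c') * l)"
    proof -
      have "real m + 2 = 2 powr l" by (simp add: l_def)
      then show ?thesis by (simp only: powr_powr mult.commute)
    qed
    also have "\<dots> \<le> 2 powr (real w)" using w(2) unfolding l_def c'_def by (intro powr_mono) auto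
    also have "\<dots> = 2 ^ w" by (simp add: powr_realpow)
    finally show ?thesis .
  qed
  have m2: "1 \<le> real m + 2" by simp
  have Y2: "(real m + 2) powr 2 * (real m + 2) powr 1 \<le> Y" "(real m + 2) powr 2 * (real m + 2) powr rho \<le> Y"
    "(real m + 2) powr 2 \<le> Y" "1 \<le> Y"
    unfolding Y_def using rho_nonneg m2
    by (auto simp only: powr_add[symmetric] intro!: powr_mono ge_one_powr_ge_zero)
  have size: "2 * length I.ws < 2 ^ w"
  proof -
    have "X \<le> real m powr rho" unfolding X_def using D by (simp add: divide_le_eq mult_le_cancel_left1)
    also have "\<dots> \<le> (real m + 2) powr rho" using rho_nonneg by (intro powr_mono2) auto
    finally have "real m + X \<le> (real m + 2) powr 1 + (real m + 2) powr rho" by simp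
    moreover have "l ^ 2 \<le> (real m + 2) powr 2"
      using L(2,4) by (simp add: powr_numeral power_mono)
    ultimately have "(real m + X) * l ^ 2 \<le> ((real m + 2) powr 1 + (real m + 2) powr rho) * (real m + 2) powr 2"
      using mX by (intro mult_mono) auto
    also have "\<dots> \<le> 2 * Y" using Y2(1,2) unfolding distrib_right
      by (simp only: mult.commute[of _ "(real m + 2) powr 2"])
    finally have "space_const * ((real m + X) * l ^ 2) \<le> space_const * (2 * Y)" using sc by (intro mult_left_mono) auto
    moreover have "real (length I.ws) \<le> real (space_used I.M)" by (simp add: space_used_def I.M_def)
    ultimately have "real (length I.ws) \<le> space_const * (2 * Y)" using space unfolding mult.assoc by linarith
    then have "2 * real (length I.ws) \<le> 4 * space_const * Y" by (simp add: mult_ac)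
    also have "\<dots> < c' * Y" using Y2(4) by (simp add: c'_def algebra_simps)
    also have "\<dots> \<le> 2 ^ w" by (rule big)
    finally have "real (2 * length I.ws) < real (2 ^ w)" by simp
    then show ?thesis by (simp only: of_nat_less_iff)
  qed
  have code: "(n + 1) * n < 2 ^ w"
  proof -
    have "(n + 1) * n \<le> (2 * m + 1) * (2 * m)" using n2m by (intro mult_mono) auto
    then have "real ((n + 1) * n) \<le> real ((2 * m + 1) * (2 * m))" by (simp only: of_nat_le_iff)
    also have "\<dots> \<le> 4 * (real m + 2) ^ 2" by (simp add: power2_eq_square algebra_simps)
    also have "\<dots> \<le> 4 * Y" using Y2(3) by (simp add: powr_numeral)
    also have "\<dots> < c' * Y" using sc Y2(4) by (simp add: c'_def)
    also have "\<dots> \<le> 2 ^ w" by (rule big)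
    finally have "real ((n + 1) * n) < real (2 ^ w)" by simp
    then show ?thesis by (simp only: of_nat_less_iff)
  qed
  have T0: "0 \<le> T" using B by (simp add: T_def)
  have delay: "20 + real k * I.list_delay (2 * k * k) \<le> delay_const * \<Delta> * l ^ 2"
  proof -
    let ?K = "50 * (real k + 1) + 20 * real k + 4 * real k * real k + 20"
    let ?K2 = "?K * (3 + 2 * real k)"
    have dl: "1 \<le> \<Delta> * l" "1 \<le> \<Delta> * l ^ 2"
      using D L(2) l2 mult_mono[of 1 \<Delta> 1 l] mult_mono[of 1 \<Delta> 1 "l ^ 2"] by auto
    have "real ((20 + 6 * L) * (k + 1) + 20 * k + 2 * (2 * k * k) + 20) =
        (20 + 6 * real L) * (real k + 1) + (20 * real k + 4 * real k * real k + 20) * 1" by simp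
    also have "\<dots> \<le> (50 * l) * (real k + 1) + (20 * real k + 4 * real k * real k + 20) * l"
      using L by (intro add_mono mult_right_mono mult_left_mono) auto
    also have "\<dots> = ?K * l" by (simp add: algebra_simps)
    finally have U: "real ((20 + 6 * L) * (k + 1) + 20 * k + 2 * (2 * k * k) + 20) \<le> ?K * l" .
    have "1 + 2 * real k \<le> (1 + 2 * real k) * \<Delta>" using mult_left_mono[OF D, of "1 + 2 * real k"] by simp
    then have "T \<le> (3 + 2 * real k) * \<Delta>" by (simp add: T_def B_def algebra_simps)
    with U have "real ((20 + 6 * L) * (k + 1) + 20 * k + 2 * (2 * k * k) + 20) * T \<le> (?K * l) * ((3 + 2 * real k) * \<Delta>)"
      using T0 L(2) by (intro mult_mono) auto
    also have "\<dots> = ?K2 * (\<Delta> * l)" by simp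
    finally have UT: "real ((20 + 6 * L) * (k + 1) + 20 * k + 2 * (2 * k * k) + 20) * T \<le> ?K2 * (\<Delta> * l)" .
    have "2 * (real ((20 + 6 * L) * (k + 1) + 20 * k + 2 * (2 * k * k) + 20) * T + 10) + 10 \<le> (2 * ?K2 + 30) * (\<Delta> * l)"
      (is "?V \<le> _")
    proof -
      have "2 * (x + 10) + 10 \<le> (2 * z + 30) * y" if "x \<le> z * y" "1 \<le> y" for x y z :: real
        using that by (simp add: algebra_simps)
      then show ?thesis using UT dl(1) .
    qed
    then have "real L * ?V \<le> (5 * l) * ((2 * ?K2 + 30) * (\<Delta> * l))"
      using L T0 by (intro mult_mono) auto
    also have "\<dots> = (10 * ?K2 + 150) * (\<Delta> * l ^ 2)" by (simp add: power2_eq_square algebra_simps)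
    finally have "I.list_delay (2 * k * k) \<le> 5 + (10 * ?K2 + 150) * (\<Delta> * l ^ 2)"
      unfolding I.list_delay_def by simp
    also have "\<dots> \<le> (155 + 10 * ?K2) * (\<Delta> * l ^ 2)"
    proof -
      have "(155 + 10 * ?K2) * (\<Delta> * l ^ 2) = 5 * (\<Delta> * l ^ 2) + (10 * ?K2 + 150) * (\<Delta> * l ^ 2)"
        by (simp only: distrib_right[symmetric]) simp
      then show ?thesis using dl(2) by linarith
    qed
    finally have "real k * I.list_delay (2 * k * k) \<le> real k * ((155 + 10 * ?K2) * (\<Delta> * l ^ 2))"
      by (intro mult_left_mono) auto
    moreover have "20 \<le> 20 * (\<Delta> * l ^ 2)" using dl(2) by simp
    ultimately have "20 + real k * I.list_delay (2 * k * k) \<le>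
        20 * (\<Delta> * l ^ 2) + real k * ((155 + 10 * ?K2) * (\<Delta> * l ^ 2))" by linarith
    also have "\<dots> = delay_const * \<Delta> * l ^ 2"
      unfolding delay_const_def by (simp only: distrib_right mult.assoc)
    finally show ?thesis .
  qed
  have "range_listing_structure w (listing_program k nb ne le) Q G A
     (space_const * (real m + X) * l ^ 2) (delay_const * \<Delta> * l ^ 2) 1 {I.M}"
    unfolding range_listing_structure_def
  proof (intro conjI ballI allI impI)
    show "1 < (2::nat) ^ w"
    proof -
      have "4 \<le> length I.ws" by (simp add: I.length_ws I.box_base_def R.EE_eq)
      then show ?thesis using size by linarith
    qed
    fix M assume M: "M \<in> {I.M}"
    show "x < 2 ^ w" if "x \<in> set (words M)" for x
      using that M I.words_less[OF size code] by (auto simp: I.M_def)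
    show "real (space_used M) \<le> space_const * (real m + X) * l ^ 2" using M space by simp
    fix x1 x2 :: real assume x: "x1 \<le> x2"
    have "\<exists>t s'. exec w (listing_program k nb ne le) (query_state 1 I.M x1 x2) t s' \<and> mem s' = I.M \<and>
     distinct (outputs t) \<and> set (outputs t) = (\<Union>a<k. I.picture a ` I.matches a x1 x2) \<and>
     delay_at_most (20 + real k * I.list_delay (2 * k * k)) t"
    proof (rule I.listing_program_correct[OF size code x _ T0])
      show "length (ne a) + length (le a) \<le> 2 * k * k" for a by (rule ne_le_length)
      show "inj_on (I.picture a) (I.matches a x1 x2)" if "a < k" for a
        using I.picture_unique[OF that that] by (auto intro: inj_onI)
      show "I.picture a ` I.matches a x1 x2 \<inter> I.picture b ` I.matches b x1 x2 = {}"
        if "a < k" "b < k" "a \<noteq> b" for a b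
        using I.picture_unique[OF that(1,2)] that(3) by fastforce
    qed
    then show "\<exists>M'\<in>{I.M}. answers_query w (listing_program k nb ne le) 1 Q G A (delay_const * \<Delta> * l ^ 2) M x1 x2 M'"
      using M delay unfolding answers_query_def I.matches_occurrences by (auto intro: delay_mono)
  qed auto
  then show ?thesis unfolding X_def by blast
qed

end

lemma range_listing_structure_mono:
  assumes S: "range_listing_structure w P Q G A S D entry \<M>" and le: "S \<le> S'" "D \<le> D'"
  shows "range_listing_structure w P Q G A S' D' entry \<M>"
proof -
  have q: "answers_query w P entry Q G A D' M x1 x2 M'" if "answers_query w P entry Q G A D M x1 x2 M'" for M x1 x2 M'
    using that delay_mono[OF _ le(2)] unfolding answers_query_def by blast
  show ?thesis
    unfolding range_listing_structure_def
  proof (intro conjI ballI allI impI)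
    fix M assume M: "M \<in> \<M>"
    show "real (space_used M) \<le> S'" using S M le(1) unfolding range_listing_structure_def by (meson order_trans)
    show "x < 2 ^ w" if "x \<in> set (words M)" for x using S M that unfolding range_listing_structure_def by blast
    fix x1 x2 :: real assume "x1 \<le> x2"
    then show "\<exists>M'\<in>\<M>. answers_query w P entry Q G A D' M x1 x2 M'"
      using S M q unfolding range_listing_structure_def by blast
  qed (use S in \<open>auto simp: range_listing_structure_def\<close>)
qed

theorem theorem5:
  fixes Q :: "'a ugraph"
  assumes "simple_graph Q" and "connected_graph Q" and "card (verts Q) \<ge> 2"
  shows "\<exists>(P :: com) (c :: real) (C :: real) (d :: nat).
    \<forall>(G :: nat ugraph) (A :: nat \<Rightarrow> real) (\<Delta> :: real) (w :: nat) (m :: nat).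
      simple_graph G \<and> card (edges G) = m \<and> \<Delta> \<ge> 1 \<and>
      verts G \<subseteq> {..<2 ^ w} \<and> c * log 2 (real m + 2) \<le> real w \<longrightarrow>
      (\<exists>entry \<M>. range_listing_structure w P Q G A
         (C * (real m + real m powr fractional_edge_cover_number Q / \<Delta>)
            * log 2 (real m + 2) ^ d)
         (C * \<Delta> * log 2 (real m + 2) ^ d)
         entry \<M>)"
proof -
  have fin: "finite (verts Q)" using assms(1) by (simp add: simple_graph_def)
  obtain vs where vs: "set vs = verts Q" "distinct vs" using finite_distinct_list[OF fin] by blast
  then have len: "2 \<le> length vs" using assms(3) distinct_card by metis
  have "\<exists>xs. connected_order Q xs \<and> set xs = verts Q \<and> xs ! 0 = vs ! a" if "a < length vs" for a
    using connected_order_exists[OF assms(1,2), of "vs ! a"] that vs(1) nth_mem by blast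
  then obtain ord where "\<And>a. a < length vs \<Longrightarrow>
      connected_order Q (ord a) \<and> set (ord a) = verts Q \<and> ord a ! 0 = vs ! a" by metis
  then interpret pattern_graph Q vs ord using assms(1) vs len by unfold_locales auto
  \<comment> \<open>The summand 2 pays for the two ticks of a query on a graph without
    edges.\<close>
  define C where "C = space_const + delay_const + 2"
  have c: "0 \<le> space_const" "0 \<le> delay_const" by (auto simp: space_const_def delay_const_def)
  have "\<exists>entry \<M>. range_listing_structure w (listing_program k nb ne le) Q G A
         (C * (real m + real m powr rho / \<Delta>) * log 2 (real m + 2) ^ 2)
         (C * \<Delta> * log 2 (real m + 2) ^ 2) entry \<M>"
    if G: "simple_graph G" "card (edges G) = m" and D: "1 \<le> \<Delta>" and w: "verts G \<subseteq> {..<2 ^ w}"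
      "(3 + rho + log 2 (4 * space_const + 4)) * log 2 (real m + 2) \<le> real w"
    for G A \<Delta> w m
  proof -
    let ?l = "log 2 (real m + 2)"
    show ?thesis
    proof (cases "m = 0")
      \<comment> \<open>For \<open>m = 0\<close> the space bound is zero, as
        \<open>0 powr rho = 0\<close>, so the memory has to be empty; the logarithm is one, so the
        delay bound stays positive.\<close>
      case True
      have e: "edges G = {}" using G finite_edges[OF G(1)] True by simp
      define M where "M = \<lparr>words = [], reals = []\<rparr>"
      have "range_listing_structure w (listing_program k nb ne le) Q G A
         (C * (real m + real m powr rho / \<Delta>) * ?l ^ 2) (C * \<Delta> * ?l ^ 2) 0 {M}"
        unfolding range_listing_structure_def
      proof (intro conjI ballI allI impI)
        fix M' and x1 x2 :: real assume M': "M' \<in> {M}"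
        obtain t s' where t: "exec w (listing_program k nb ne le) (query_state 0 M x1 x2) t s'" "mem s' = M"
          "outputs t = []" "length t \<le> 2" using listing_program_empty by blast
        have "2 \<le> C * \<Delta>" using c D mult_mono[of 2 C 1 \<Delta>] by (simp add: C_def)
        then have "delay_at_most (C * \<Delta> * ?l ^ 2) t" using t(4) True by (intro delay_length) simp
        then show "\<exists>M''\<in>{M}. answers_query w (listing_program k nb ne le) 0 Q G A (C * \<Delta> * ?l ^ 2) M' x1 x2 M''"
          using t M' no_occurrences[OF G(1) e] unfolding answers_query_def by fastforce
      qed (use True in \<open>auto simp: M_def space_used_def\<close>)
      then show ?thesis by blast
    next
      case False
      then obtain \<M> where S: "range_listing_structure w (listing_program k nb ne le) Q G A
          (space_const * (real m + real m powr rho / \<Delta>) * ?l ^ 2) (delay_const * \<Delta> * ?l ^ 2) 1 \<M>"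
        using structure_exists[OF G _ D w] by blast
      have "space_const * (real m + real m powr rho / \<Delta>) * ?l ^ 2 \<le> C * (real m + real m powr rho / \<Delta>) * ?l ^ 2"
        "delay_const * \<Delta> * ?l ^ 2 \<le> C * \<Delta> * ?l ^ 2"
        using c D by (auto intro!: mult_right_mono simp: C_def)
      then have "range_listing_structure w (listing_program k nb ne le) Q G A
          (C * (real m + real m powr rho / \<Delta>) * ?l ^ 2) (C * \<Delta> * ?l ^ 2) 1 \<M>"
        by (rule range_listing_structure_mono[OF S])
      then show ?thesis by blast
    qed
  qed
  then show ?thesis unfolding rho_def by blast
qed

end
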